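(* Let $a,b,c$ be positive integers with $D:=b^2-ac>0$. For generic nonzero complex $x_1,x_2,y_1,y_2$, \[\begin{split} \sum_{r_1,s_1\in\mathbb{Z}} &\mathrm{sg}(r_1,s_1)\, q^{\frac12a r_1^2+br_1s_1+\frac12cs_1^2}\, x_1^{r_1}y_1^{s_1}\\ &=\sum_{t=0}^{c-1} x_1^tq^{\frac12at^2} \Theta(-y_1q^{bt+\frac{c}{2}};q^c)\, m(-q^{D(\frac{c}{2}-t)}x_1^cy_1^{-b},-q^{\frac12 cD}x_2;q^{cD})\\ &\quad + \sum_{t=0}^{a-1} y_1^t q^{\frac12ct^2} \Theta(-x_1q^{bt+\frac{a}{2}};q^{a})\, m(-q^{D(\frac{a}{2}-t)}y_{1}^{a}x_{1}^{-b},-q^{\frac12 aD}y_2;q^{aD})\\ &\quad -\Big ( \Theta(-x_2q^{\frac12 cD};q^{cD})\,\Theta(-y_2q^{\frac12 aD};q^{aD})\Big ) ^{-1} \sum_{u,v\bmod b} q^{\frac12au^2+buv+\frac12cv^2} x_1^{u}y_1^{v} \\ &\qquad\cdot \sum_{r_2,s_2\in\mathbb{Z}} q^{\frac12 b^2c r_2^2+abc r_2 s_2+\frac12ab^2s_2^2 +c(au+bv)r_2+a(bu+cv)s_2}(x_1^cx_2)^{r_2} (y_1^ay_2)^{s_2}\\ & \qquad\cdot \frac{(q^{bD};q^{bD})_{\infty}^3\, \Theta(x_1^{c-b}y_1^{a-b} x_2y_2 q^{-D(u+v)};q^{bD})}{\Theta(x_1^cy_1^{-b}x_2q^{-Du};q^{bD})\,\Theta(x_1^{-b}y_1^a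 y_2 q^{-Dv};q^{bD})}, \end{split}\] where $u,v$ each run over a complete residue system modulo $b$.
   Context: Let $q$ be a complex number with $0<|q|<1$ (fractional powers of $q$ understood via $q=e^{2\pi i\tau}$). Write $(x;q)_\infty=\prod_{i\ge0}(1-xq^i)$ and $\Theta(x;q):=(x;q)_\infty(q/x;q)_\infty(q;q)_\infty=\sum_{n\in\mathbb{Z}}(-1)^nq^{\binom n2}x^n$. Let $\mathrm{sg}(r)=1$ if $r\ge0$ and $-1$ if $r<0$, and $\mathrm{sg}(r,s):=(\mathrm{sg}(r)+\mathrm{sg}(s))/2$. The Appell function is $$m(x,z;q):=\frac{1}{\Theta(z;q)}\sum_{r\in\mathbb{Z}}\frac{(-1)^rq^{\binom{r}{2}}z^r}{1-q^{r-1}xz}.$$ *)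

theory Defs
  imports "HOL-Analysis.Analysis" "HOL-Number_Theory.Cong"
begin

text \<open>
  Fractional powers of \<open>q = exp (2 \<pi> i \<tau>)\<close>: \<open>qpow \<tau> e\<close> is \<open>q\<close> to the power \<open>e\<close>, taken with respect
  to the chosen \<open>\<tau>\<close>. (The function \<open>powr\<close> would instead use the principal logarithm of \<open>q\<close>.)
\<close>

definition qpow :: "complex \<Rightarrow> real \<Rightarrow> complex" where
  "qpow \<tau> e = exp (2 * of_real pi * \<i> * \<tau> * of_real e)"

definition qpochhammer_inf :: "complex \<Rightarrow> complex \<Rightarrow> complex" where
  "qpochhammer_inf x q = (\<Prod>i. 1 - x * q ^ i)"

definition Theta :: "complex \<Rightarrow> complex \<Rightarrow> complex" where
  "Theta x q = qpochhammer_inf x q * qpochhammer_inf (q / x) q * qpochhammer_inf q q"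

definition sg :: "int \<Rightarrow> real" where
  "sg r = (if r \<ge> 0 then 1 else -1)"

definition sg2 :: "int \<Rightarrow> int \<Rightarrow> real" where
  "sg2 r s = (sg r + sg s) / 2"

definition appell_m :: "complex \<Rightarrow> complex \<Rightarrow> complex \<Rightarrow> complex" where
  "appell_m x z q =
     1 / Theta z q *
     (\<Sum>\<^sub>\<infinity>r\<in>(UNIV :: int set).
        (-1) powi r * q powi (r * (r - 1) div 2) * z powi r / (1 - q powi (r - 1) * x * z))"

definition complete_residue_system :: "int \<Rightarrow> int set \<Rightarrow> bool" where
  "complete_residue_system m U \<longleftrightarrow> (\<forall>n. \<exists>!u. u \<in> U \<and> [u = n] (mod m))"

end

theory Submission
  imports Defs
begin

text \<open>
  Write \<open>q = exp h\<close>, \<open>x\<^sub>i = exp \<xi>\<^sub>i\<close>, \<open>y\<^sub>i = exp \<eta>\<^sub>i\<close>, \<open>X = x\<^sub>1\<^sup>c y\<^sub>1\<^sup>-\<^sup>b x\<^sub>2\<close>, \<open>Y = x\<^sub>1\<^sup>-\<^sup>b y\<^sub>1\<^sup>a y\<^sub>2\<close>,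
  and multiply the claim by the two theta functions of \<open>x\<^sub>2\<close> and \<open>y\<^sub>2\<close>, summed over \<open>r\<^sub>2\<close> and \<open>s\<^sub>2\<close>.
  Every term becomes a sum of the same summand over \<open>(r\<^sub>1, s\<^sub>1, r\<^sub>2, s\<^sub>2)\<close>, weighted by half the sum of two
  signs out of \<open>\<epsilon>\<^sub>1 = sg r\<^sub>1\<close>, \<open>\<epsilon>\<^sub>2 = sg s\<^sub>1\<close>, \<open>\<epsilon>\<^sub>3 = \<plusminus>1\<close> and \<open>\<epsilon>\<^sub>4 = \<plusminus>1\<close>, where \<open>\<epsilon>\<^sub>3 = 1\<close> iff
  \<open>\<bar>q\<bar>\<close> to the power \<open>D (c r\<^sub>2 - r\<^sub>1)\<close> times \<open>\<bar>X\<bar>\<close> is less than 1, and \<open>\<epsilon>\<^sub>4\<close> is defined in the same way from \<open>Y\<close>.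
  The indefinite theta series has the pair \<open>(\<epsilon>\<^sub>1, \<epsilon>\<^sub>2)\<close>, the two Appell parts, whose denominators are
  expanded into geometric series, have \<open>(\<epsilon>\<^sub>1, \<epsilon>\<^sub>3)\<close> and \<open>(\<epsilon>\<^sub>2, \<epsilon>\<^sub>4)\<close>, so the difference has \<open>(\<epsilon>\<^sub>3, \<epsilon>\<^sub>4)\<close>.
  Completing the square modulo \<open>b\<close> splits this last sum into definite theta series times
  Kronecker's double series, which is a quotient of theta functions.

  The geometric expansions require that \<open>\<bar>X\<bar>\<close> and \<open>\<bar>Y\<bar>\<close> are no powers of \<open>\<bar>q\<bar>\<^sup>D\<close>; the remaining
  parameters are reached by continuity, scaling \<open>x\<^sub>2\<close> and \<open>y\<^sub>2\<close> by a real factor that tends to 1.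
\<close>

subsection \<open>Dominated convergence and Gaussian sums\<close>

text \<open>Dominated convergence along an arbitrary nontrivial filter. By the Weierstrass test the
  finite partial sums converge uniformly in \<open>n\<close>, so the two limits may be
  interchanged.\<close>

lemma tendsto_infsum_dominated:
  fixes f :: "'a \<Rightarrow> 'b \<Rightarrow> 'c :: banach"
  assumes lim: "\<And>x. x \<in> X \<Longrightarrow> (f x \<longlongrightarrow> g x) F"
    and bound: "\<forall>\<^sub>F n in F. \<forall>x\<in>X. norm (f x n) \<le> M x"
    and M: "M summable_on X" and F: "F \<noteq> bot"
  shows "((\<lambda>n. \<Sum>\<^sub>\<infinity>x\<in>X. f x n) \<longlongrightarrow> (\<Sum>\<^sub>\<infinity>x\<in>X. g x)) F"
proof (rule swap_uniform_limit'[where F = "finite_subsets_at_top X" and G = F and g = "sum g"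
      and f = "\<lambda>Y n. \<Sum>x\<in>Y. f x n" and S = "{n. \<forall>x\<in>X. norm (f x n) \<le> M x}"])
  show "\<forall>\<^sub>F Y in finite_subsets_at_top X. ((\<lambda>n. \<Sum>x\<in>Y. f x n) \<longlongrightarrow> sum g Y) F"
    by (rule eventually_finite_subsets_at_top_weakI) (auto intro!: tendsto_sum lim)
  \<comment> \<open>The limits inherit the majorant because \<open>F\<close> is nontrivial, hence
    their series converges absolutely.\<close>
  have "norm (g x) \<le> M x" if "x \<in> X" for x
  proof (rule tendsto_upperbound[OF tendsto_norm[OF lim[OF that]] _ F])
    show "\<forall>\<^sub>F n in F. norm (f x n) \<le> M x"
      using bound by (rule eventually_mono) (use that in auto)
  qed
  with M have "(\<lambda>x. norm (g x)) summable_on X"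
    by (rule Infinite_Sum.abs_summable_on_comparison_test')
  then show "(sum g \<longlongrightarrow> infsum g X) (finite_subsets_at_top X)"
    by (rule infsum_tendsto[OF abs_summable_summable])
  \<comment> \<open>Uniformity is claimed only on the set of \<open>n\<close> at which the majorant
    is valid; \<open>F\<close> eventually lies in this set.\<close>
  show "uniform_limit {n. \<forall>x\<in>X. norm (f x n) \<le> M x} (\<lambda>Y n. \<Sum>x\<in>Y. f x n)
      (\<lambda>n. \<Sum>\<^sub>\<infinity>x\<in>X. f x n) (finite_subsets_at_top X)"
    by (rule Weierstrass_m_test_general[OF _ M]) auto
qed (use bound in simp_all)

lemma summable_on_two_sided_geometric:
  fixes \<alpha> \<beta> :: real
  assumes "0 \<le> \<alpha>" "\<alpha> < 1" "0 \<le> \<beta>" "\<beta> < 1"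
  shows "(\<lambda>n::int. if n \<ge> 0 then \<alpha> ^ nat n else \<beta> ^ nat (-n)) summable_on UNIV"
    (is "?f summable_on _")
proof -
  have geo: "(\<lambda>n::nat. c ^ n) summable_on UNIV" if "0 \<le> c" "c < 1" for c :: real
    using that by (intro norm_summable_imp_summable_on) (auto intro: summable_geometric)
  have "?f summable_on {0..}"
    using geo[of \<alpha>] assms
    by (subst summable_on_reindex_bij_witness[of _ int nat UNIV "\<lambda>n. \<alpha> ^ n"]) auto
  moreover have "?f summable_on {..<0}"
  proof -
    have "(\<lambda>n::nat. \<beta> ^ Suc n) summable_on UNIV"
      using summable_on_cmult_right[OF geo[of \<beta>], of \<beta>] assms by simp
    moreover have "Suc (nat (- n - 1)) = nat (- n)" if "n < 0" for n :: int
      using that by linarith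
    ultimately show ?thesis
      by (subst summable_on_reindex_bij_witness[of _ "\<lambda>n. - int (Suc n)" "\<lambda>n. nat (- n - 1)" UNIV
            "\<lambda>n. \<beta> ^ Suc n"]) (auto simp del: power_Suc of_nat_Suc)
  qed
  ultimately have "?f summable_on ({0..} \<union> {..<0})"
    by (rule summable_on_union)
  moreover have "{0..} \<union> {..<0} = (UNIV :: int set)"
    by auto
  ultimately show ?thesis
    by simp
qed

text \<open>The quadratic term beats any linear one, so the series is dominated by a multiple of the
  sum of \<open>exp (- \<bar>n\<bar>)\<close>.\<close>

lemma summable_on_gauss:
  fixes h \<beta> :: real
  assumes "h > 0"
  shows "(\<lambda>n::int. exp (\<beta> * n - h * n\<^sup>2)) summable_on UNIV"
proof (rule summable_on_comparison_test)
  have "(\<lambda>n::int. exp (-\<bar>real_of_int n\<bar>)) summable_on UNIV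
    \<longleftrightarrow> (\<lambda>n::int. if n \<ge> 0 then exp (-1::real) ^ nat n else exp (-1) ^ nat (-n)) summable_on UNIV"
    by (intro summable_on_cong) (auto simp flip: exp_of_nat_mult)
  with summable_on_two_sided_geometric[of "exp (-1)" "exp (-1)"]
  have "(\<lambda>n::int. exp (-\<bar>real_of_int n\<bar>)) summable_on UNIV"
    by simp
  then show "(\<lambda>n::int. exp ((\<bar>\<beta>\<bar> + 1)\<^sup>2 / (4 * h)) * exp (-\<bar>real_of_int n\<bar>)) summable_on UNIV"
    by (rule summable_on_cmult_right)
  fix n :: int
  have "\<beta> * n + \<bar>real_of_int n\<bar> \<le> (\<bar>\<beta>\<bar> + 1) * \<bar>real_of_int n\<bar>"
    using abs_ge_self[of "\<beta> * n"] by (simp add: abs_mult algebra_simps)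
  \<comment> \<open>Completing the square produces the constant
    \<open>(\<bar>\<beta>\<bar> + 1)^2 / (4 * h)\<close> of the majorant.\<close>
  moreover have "0 \<le> ((\<bar>\<beta>\<bar> + 1) / (2 * h) - \<bar>real_of_int n\<bar>)\<^sup>2 * h"
    using assms by simp
  moreover have "((\<bar>\<beta>\<bar> + 1) / (2 * h) - \<bar>real_of_int n\<bar>)\<^sup>2 * h
      = (\<bar>\<beta>\<bar> + 1)\<^sup>2 / (4 * h) - (\<bar>\<beta>\<bar> + 1) * \<bar>real_of_int n\<bar> + h * (real_of_int n)\<^sup>2"
    using assms by (simp add: power2_diff field_simps power2_eq_square)
  ultimately have "\<beta> * n - h * (real_of_int n)\<^sup>2 \<le> (\<bar>\<beta>\<bar> + 1)\<^sup>2 / (4 * h) + - \<bar>real_of_int n\<bar>"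
    by linarith
  then show "exp (\<beta> * n - h * (real_of_int n)\<^sup>2) \<le> exp ((\<bar>\<beta>\<bar> + 1)\<^sup>2 / (4 * h)) * exp (-\<bar>real_of_int n\<bar>)"
    by (subst exp_add[symmetric]) (simp only: exp_le_cancel_iff)
qed simp

lemma abs_summable_on_gauss_exp:
  fixes h \<xi> :: complex
  assumes "Re h < 0"
  shows "(\<lambda>n::int. norm (exp (h * of_int n ^ 2 + of_int n * \<xi>))) summable_on UNIV"
proof -
  have "(\<lambda>n::int. exp (Re \<xi> * n - (- Re h) * n\<^sup>2)) summable_on UNIV"
    using assms by (intro summable_on_gauss) auto
  then show ?thesis
    by (simp add: algebra_simps flip: of_int_power)
qed

subsection \<open>The infinite product\<close>

lemma convergent_prod_qpochhammer:
  fixes q x :: complex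
  assumes "norm q < 1"
  shows "(\<lambda>n. \<Prod>i<n. 1 - x * q ^ i) \<longlonglongrightarrow> qpochhammer_inf x q"
    and "(\<And>i. x * q ^ i \<noteq> 1) \<Longrightarrow> qpochhammer_inf x q \<noteq> 0"
proof -
  have "summable (\<lambda>i. norm (1 - x * q ^ i - 1))"
    using assms by (auto simp: norm_mult norm_power intro!: summable_mult summable_geometric)
  then have conv: "convergent_prod (\<lambda>i. 1 - x * q ^ i)"
    by (intro abs_convergent_prod_imp_convergent_prod summable_imp_abs_convergent_prod)
  then show "(\<lambda>n. \<Prod>i<n. 1 - x * q ^ i) \<longlonglongrightarrow> qpochhammer_inf x q"
    using convergent_prod_LIMSEQ[OF conv]
    by (subst filterlim_sequentially_Suc[symmetric]) (simp add: lessThan_Suc_atMost qpochhammer_inf_def)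
  show "qpochhammer_inf x q \<noteq> 0" if "\<And>i. x * q ^ i \<noteq> 1"
    unfolding qpochhammer_inf_def by (rule prodinf_nonzero[OF conv]) (use that in auto)
qed

lemma qpochhammer_inf_rec:
  assumes "norm q < 1"
  shows "qpochhammer_inf x q = (1 - x) * qpochhammer_inf (x * q) q"
proof (rule LIMSEQ_unique)
  show "(\<lambda>n. \<Prod>i<Suc n. 1 - x * q ^ i) \<longlonglongrightarrow> qpochhammer_inf x q"
    by (rule LIMSEQ_Suc[OF convergent_prod_qpochhammer(1)[OF assms]])
  show "(\<lambda>n. \<Prod>i<Suc n. 1 - x * q ^ i) \<longlonglongrightarrow> (1 - x) * qpochhammer_inf (x * q) q"
    unfolding prod.lessThan_Suc_shift
    using tendsto_mult_left[OF convergent_prod_qpochhammer(1)[OF assms, of "x * q"]]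
    by (simp add: mult.assoc)
qed

text \<open>On a closed disc of radius \<open>R\<close> the factors differ from 1 by at most
  \<open>R * norm q ^ i\<close>, so the partial products converge uniformly there; continuity is
  local.\<close>

lemma continuous_on_qpochhammer_inf:
  assumes "norm q < 1"
  shows "continuous_on UNIV (\<lambda>x. qpochhammer_inf x q)"
proof -
  have "continuous_on (cball 0 R) (\<lambda>x. qpochhammer_inf x q)" for R
  proof (rule uniform_limit_theorem)
    have "uniformly_convergent_on (cball 0 R) (\<lambda>n x. \<Prod>i<n. 1 - x * q ^ i)"
    proof (rule uniformly_convergent_on_prod')
      show "uniformly_convergent_on (cball 0 R) (\<lambda>n x. \<Sum>i<n. norm (1 - x * q ^ i - 1))"
      proof (rule Weierstrass_m_test')
        show "summable (\<lambda>i. R * norm q ^ i)"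
          using assms by (auto intro!: summable_mult summable_geometric)
      qed (auto simp: norm_mult norm_power intro!: mult_right_mono)
    qed (auto intro!: continuous_intros)
    then obtain l where l: "uniform_limit (cball 0 R) (\<lambda>n x. \<Prod>i<n. 1 - x * q ^ i) l sequentially"
      by (auto simp: uniformly_convergent_on_def)
    have "l x = qpochhammer_inf x q" if "x \<in> cball 0 R" for x
      by (rule LIMSEQ_unique[OF tendsto_uniform_limitI[OF l that] convergent_prod_qpochhammer(1)[OF assms]])
    with l show "uniform_limit (cball 0 R) (\<lambda>n x. \<Prod>i<n. 1 - x * q ^ i) (\<lambda>x. qpochhammer_inf x q) sequentially"
      by (subst uniform_limit_cong'[of _ _ _ _ l]) auto
  qed (auto intro!: always_eventually continuous_intros)
  then have "continuous_on (ball 0 R) (\<lambda>x. qpochhammer_inf x q)" for R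
    by (rule continuous_on_subset[OF _ ball_subset_cball])
  then have "isCont (\<lambda>x. qpochhammer_inf x q) x" for x
    using continuous_on_interior[of "ball 0 (norm x + 1)" _ x] by auto
  then show ?thesis
    by (simp add: continuous_on_eq_continuous_at)
qed

subsection \<open>The Jacobi triple product\<close>

text \<open>The Gaussian binomial coefficient, given by the q-Pascal rule so that no quotient is
  involved.\<close>

fun qbinom :: "complex \<Rightarrow> nat \<Rightarrow> nat \<Rightarrow> complex" where
  "qbinom q n 0 = 1"
| "qbinom q 0 (Suc k) = 0"
| "qbinom q (Suc n) (Suc k) = qbinom q n k + q ^ Suc k * qbinom q n (Suc k)"

lemma qbinom_eq_0: "k > n \<Longrightarrow> qbinom q n k = 0"
  by (induction q n k rule: qbinom.induct) auto

text \<open>Splitting off the factor \<open>1 + x\<close> leaves the product for \<open>n\<close> at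
  \<open>x * q\<close>, which is why the induction keeps \<open>x\<close> arbitrary; the q-Pascal
  rule then recombines the coefficients.\<close>

lemma qbinomial_theorem:
  "(\<Prod>i<n. 1 + x * q ^ i) = (\<Sum>k\<le>n. qbinom q n k * q ^ (k * (k - 1) div 2) * x ^ k)"
proof (induction n arbitrary: x)
  case (Suc n)
  define g where "g k = qbinom q n k * q ^ (k * (k - 1) div 2) * (x * q) ^ k" for k
  have ex: "Suc k * (Suc k - 1) div 2 = k * (k - 1) div 2 + k" for k
    by (cases k) (auto simp: algebra_simps)
  have "(\<Prod>i<Suc n. 1 + x * q ^ i) = (1 + x) * (\<Prod>i<n. 1 + (x * q) * q ^ i)"
    unfolding prod.lessThan_Suc_shift by (simp add: mult.assoc)
  also have "\<dots> = (1 + x) * (\<Sum>k\<le>n. g k)"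
    by (simp add: Suc.IH g_def)
  also have "\<dots> = (\<Sum>k\<le>Suc n. g k) + (\<Sum>k\<le>n. x * g k)"
  proof -
    have "g (Suc n) = 0"
      by (simp add: g_def qbinom_eq_0)
    then show ?thesis
      by (simp add: distrib_right sum_distrib_left sum.distrib)
  qed
  also have "\<dots> = 1 + (\<Sum>k\<le>n. g (Suc k) + x * g k)"
    by (subst sum.atMost_Suc_shift) (simp add: sum.distrib g_def)
  also have "\<dots> = 1 + (\<Sum>k\<le>n. qbinom q (Suc n) (Suc k) * q ^ (Suc k * (Suc k - 1) div 2) * x ^ Suc k)"
  proof -
    have "c * q ^ (e + k) * (x * q) ^ Suc k + x * (d * q ^ e * (x * q) ^ k)
        = (d + q ^ Suc k * c) * q ^ (e + k) * x ^ Suc k" for c d e k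
      by (simp add: power_mult_distrib power_add algebra_simps)
    then show ?thesis
      unfolding g_def ex by (simp del: power_Suc)
  qed
  also have "\<dots> = (\<Sum>k\<le>Suc n. qbinom q (Suc n) k * q ^ (k * (k - 1) div 2) * x ^ k)"
    by (simp only: sum.atMost_Suc_shift[where n = n]) simp
  finally show ?case .
qed simp

text \<open>The quotient formula for Gaussian binomials with denominators cleared. The induction
  rests on \<open>1 - q ^ (k + m) = (1 - q ^ k) + q ^ k * (1 - q ^ m)\<close>.\<close>

lemma qbinom_mult_prod:
  "qbinom q (k + m) k * (\<Prod>i<k. 1 - q ^ Suc i) * (\<Prod>i<m. 1 - q ^ Suc i) = (\<Prod>i<k + m. 1 - q ^ Suc i)"
proof (induction "k + m" arbitrary: k m)
  case (Suc n)
  show ?case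
  proof (cases k)
    case 0
    then show ?thesis by simp
  next
    case k: (Suc k')
    show ?thesis
    proof (cases m)
      case 0
      have "qbinom q k' k' * (\<Prod>i<k'. 1 - q ^ Suc i) = (\<Prod>i<k'. 1 - q ^ Suc i)"
        using Suc.hyps(1)[of k' 0] Suc.hyps(2) k 0 by simp
      then have "(qbinom q k' k' * (\<Prod>i<k'. 1 - q ^ Suc i)) * (1 - q ^ k) = (\<Prod>i<k. 1 - q ^ Suc i)"
        using k by simp
      then show ?thesis
        using k 0 by (simp add: qbinom_eq_0 mult.assoc)
    next
      case m: (Suc m')
      let ?P = "\<lambda>n. \<Prod>i<n. 1 - q ^ Suc i"
      have 1: "qbinom q (k' + m) k' * ?P k' * ?P m = ?P (k' + m)"
        using Suc.hyps(1)[of k' m] Suc.hyps(2) k by simp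
      have 2: "qbinom q (k + m') k * ?P k * ?P m' = ?P (k + m')"
        using Suc.hyps(1)[of k m'] Suc.hyps(2) m by simp
      have e: "k + m = Suc (k' + m)" "k + m' = k' + m"
        using k m by auto
      have "qbinom q (k + m) k * ?P k * ?P m
          = (qbinom q (k' + m) k' * ?P k' * ?P m) * (1 - q ^ k)
            + q ^ k * (1 - q ^ m) * (qbinom q (k' + m) k * ?P k * ?P m')"
        unfolding e(1) by (simp add: k m algebra_simps)
      also have "\<dots> = ?P (k' + m) * (1 - q ^ (k + m))"
        using 1 2 unfolding e(2) by (simp add: algebra_simps power_add)
      also have "\<dots> = ?P (k + m)"
        unfolding e(1) by simp
      finally show ?thesis .
    qed
  qed
qed auto

text \<open>Each factor satisfies \<open>1 + e = e * (1 + 1 / e)\<close>; the extracted factors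
  \<open>e\<close> multiply to a single exponential.\<close>

lemma prod_geometric_reflect:
  "(\<Prod>i<n. 1 + exp (\<xi> - of_nat (Suc i) * h))
    = exp (of_nat n * \<xi> - of_nat (n * Suc n) * h / 2) * (\<Prod>i<n. 1 + exp (of_nat (Suc i) * h - \<xi>))"
  for \<xi> h :: complex
proof (induction n)
  case (Suc n)
  define e where "e = exp (\<xi> - of_nat (Suc n) * h)"
  have 1: "1 + e = e * (1 + exp (of_nat (Suc n) * h - \<xi>))"
    unfolding e_def by (simp add: ring_distribs flip: exp_add)
  have 2: "exp (of_nat n * \<xi> - of_nat (n * Suc n) * h / 2) * e
      = exp (of_nat (Suc n) * \<xi> - of_nat (Suc n * Suc (Suc n)) * h / 2)"
    unfolding e_def by (simp add: field_simps flip: exp_add)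
  have "exp (of_nat n * \<xi> - of_nat (n * Suc n) * h / 2) * P * (1 + e)
      = exp (of_nat (Suc n) * \<xi> - of_nat (Suc n * Suc (Suc n)) * h / 2)
        * (P * (1 + exp (of_nat (Suc n) * h - \<xi>)))" for P
    unfolding 1 2[symmetric] by (simp only: mult_ac)
  then show ?case
    unfolding prod.lessThan_Suc Suc.IH e_def .
qed simp

text \<open>The q-binomial theorem with \<open>2 * n\<close> factors, centred: the upper half of the
  factors is the first product, and the lower half, reflected, is the second.\<close>

lemma finite_jacobi_triple_product:
  fixes h \<xi> :: complex
  shows "(\<Prod>i<n. 1 + exp \<xi> * exp h ^ i) * (\<Prod>i<n. 1 + exp h / exp \<xi> * exp h ^ i)
    = (\<Sum>j\<in>{- int n..int n}. qbinom (exp h) (2 * n) (nat (int n + j))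
        * exp (h * (of_int j * (of_int j - 1) / 2) + of_int j * \<xi>))"
proof -
  \<comment> \<open>The shift by \<open>n * h\<close> places the \<open>2 * n\<close> exponents
    symmetrically around those of \<open>exp \<xi>\<close>.\<close>
  define \<zeta> where "\<zeta> = \<xi> - of_nat n * h"
  have gauss: "exp h ^ (k * (k - 1) div 2) = exp (h * (of_nat k * (of_nat k - 1) / 2))" for k
  proof -
    have "2 dvd k * (k - 1)"
      by (cases k) auto
    then obtain m where m: "k * (k - 1) = 2 * m" ..
    have "of_nat (k * (k - 1) div 2) = (of_nat (k * (k - 1)) / 2 :: complex)"
      unfolding m by simp
    also have "of_nat (k * (k - 1)) = (of_nat k * (of_nat k - 1) :: complex)"
      by (cases k) (simp_all add: algebra_simps)
    finally show ?thesis
      by (metis exp_of_nat2_mult)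
  qed
  have "(\<Prod>i<2 * n. 1 + exp \<zeta> * exp h ^ i)
      = (\<Prod>i<n. 1 + exp \<zeta> * exp h ^ i) * (\<Prod>i<n. 1 + exp \<zeta> * exp h ^ (n + i))"
  proof -
    have "(\<Prod>i<n + m. f i) = (\<Prod>i<n. f i) * (\<Prod>i<m. f (n + i))" for m and f :: "nat \<Rightarrow> complex"
      by (induction m) (simp_all add: mult.assoc)
    then show ?thesis
      by (simp add: mult_2)
  qed
  also have "(\<Prod>i<n. 1 + exp \<zeta> * exp h ^ (n + i)) = (\<Prod>i<n. 1 + exp \<xi> * exp h ^ i)"
    by (intro prod.cong refl)
      (simp add: \<zeta>_def algebra_simps flip: exp_add exp_of_nat_mult)
  also have "(\<Prod>i<n. 1 + exp \<zeta> * exp h ^ i) = (\<Prod>i<n. 1 + exp (\<xi> - of_nat (Suc i) * h))"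
  proof -
    have "(\<Prod>i<n. 1 + exp \<zeta> * exp h ^ i) = (\<Prod>i<n. 1 + exp \<zeta> * exp h ^ (n - Suc i))"
      by (rule prod.nat_diff_reindex[symmetric])
    also have "\<dots> = (\<Prod>i<n. 1 + exp (\<xi> - of_nat (Suc i) * h))"
      by (intro prod.cong refl)
        (simp add: \<zeta>_def algebra_simps of_nat_diff flip: exp_add exp_of_nat_mult)
    finally show ?thesis .
  qed
  also have "\<dots> = exp (of_nat n * \<xi> - of_nat (n * Suc n) * h / 2)
      * (\<Prod>i<n. 1 + exp h / exp \<xi> * exp h ^ i)"
    unfolding prod_geometric_reflect
    by (intro arg_cong2[where f = times] prod.cong refl)
      (simp add: algebra_simps flip: exp_add exp_of_nat_mult exp_diff)
  finally have "(\<Prod>i<n. 1 + exp \<xi> * exp h ^ i) * (\<Prod>i<n. 1 + exp h / exp \<xi> * exp h ^ i)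
      = exp (- (of_nat n * \<xi> - of_nat (n * Suc n) * h / 2)) * (\<Prod>i<2 * n. 1 + exp \<zeta> * exp h ^ i)"
    by (simp add: exp_minus field_simps)
  also have "\<dots> = (\<Sum>k\<le>2 * n. qbinom (exp h) (2 * n) k
      * exp (h * (of_int (int k - int n) * (of_int (int k - int n) - 1) / 2) + of_int (int k - int n) * \<xi>))"
    unfolding qbinomial_theorem sum_distrib_left gauss
  proof (intro sum.cong refl, goal_cases)
    case (1 k)
    have "exp (- (of_nat n * \<xi> - of_nat (n * Suc n) * h / 2)) *
        (exp (h * (of_nat k * (of_nat k - 1) / 2)) * exp \<zeta> ^ k)
      = exp (h * (of_int (int k - int n) * (of_int (int k - int n) - 1) / 2) + of_int (int k - int n) * \<xi>)"
      unfolding \<zeta>_def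
      by (simp only: exp_add[symmetric] exp_of_nat_mult[symmetric], rule arg_cong[where f = exp])
        (simp add: field_simps)
    then show ?case
      by (simp add: mult_ac)
  qed
  also have "\<dots> = (\<Sum>j\<in>{- int n..int n}. qbinom (exp h) (2 * n) (nat (int n + j))
        * exp (h * (of_int j * (of_int j - 1) / 2) + of_int j * \<xi>))"
    by (rule sum.reindex_bij_witness[of _ "\<lambda>j. nat (int n + j)" "\<lambda>k. int k - int n"]) auto
  finally show ?thesis .
qed


section \<open>Limits and bounds of Gaussian binomials\<close>

lemma qpochhammer_inf_self_nonzero:
  assumes "norm q < 1"
  shows "qpochhammer_inf q q \<noteq> 0"
proof (rule convergent_prod_qpochhammer(2)[OF assms])
  fix i
  have "norm (q * q ^ i) < 1"
    using assms by (simp add: norm_mult norm_power power_less_one_iff[of "norm q" "Suc i", simplified])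
  then show "q * q ^ i \<noteq> 1"
    by auto
qed

text \<open>Write the binomial as \<open>P n / (P k * P (n - k))\<close>, where \<open>P\<close>
  converges to the nonzero value \<open>qpochhammer_inf q q\<close>. This yields the limit, and
  boundedness of \<open>P\<close> and of its inverse yields a bound uniform in both indices.\<close>

lemma
  assumes q: "norm q < 1"
  shows tendsto_central_qbinom:
      "(\<lambda>n. qbinom q (2 * n) (nat (int n + j))) \<longlonglongrightarrow> 1 / qpochhammer_inf q q"
    and bounded_qbinom: "\<exists>C. \<forall>n k. norm (qbinom q n k) \<le> C"
proof -
  define P where "P n = (\<Prod>i<n. 1 - q ^ Suc i)" for n
  have P: "P \<longlonglongrightarrow> qpochhammer_inf q q"
    using convergent_prod_qpochhammer(1)[OF q, of q] by (simp add: P_def[abs_def])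
  have "P n \<noteq> 0" for n
  proof -
    have "q ^ Suc i \<noteq> 1" for i
    proof
      assume "q ^ Suc i = 1"
      then have "norm q ^ Suc i = 1"
        by (metis norm_one norm_power)
      then show False
        using q power_less_one_iff[of "norm q" "Suc i"] by simp
    qed
    then show ?thesis
      by (auto simp: P_def simp del: power_Suc)
  qed
  then have qb: "qbinom q n k = P n / (P k * P (n - k))" if "k \<le> n" for n k
    using qbinom_mult_prod[of q k "n - k"] that by (simp add: P_def field_simps del: power_Suc)
  have lim: "filterlim (\<lambda>n. nat (int n + i)) at_top sequentially" for i
  proof (rule filterlim_at_top_mono)
    show "filterlim (\<lambda>n. n - nat \<bar>i\<bar>) at_top sequentially"
      by (rule filterlim_minus_const_nat_at_top)
  qed (auto intro!: always_eventually)
  have "(\<lambda>n. P (2 * n) / (P (nat (int n + j)) * P (nat (int n + - j))))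
      \<longlonglongrightarrow> qpochhammer_inf q q / (qpochhammer_inf q q * qpochhammer_inf q q)"
    using qpochhammer_inf_self_nonzero[OF q]
    by (intro tendsto_intros filterlim_compose[OF P] lim mult_nat_left_at_top) auto
  \<comment> \<open>Only for \<open>n\<close> at least \<open>\<bar>j\<bar>\<close> do the
    natural-number indices avoid truncation.\<close>
  moreover have "\<forall>\<^sub>F n in sequentially. P (2 * n) / (P (nat (int n + j)) * P (nat (int n + - j)))
      = qbinom q (2 * n) (nat (int n + j))"
    using eventually_ge_at_top[of "nat \<bar>j\<bar>"]
  proof eventually_elim
    case (elim n)
    then have "2 * n - nat (int n + j) = nat (int n - j)" "nat (int n + j) \<le> 2 * n"
      by linarith+
    then show ?case
      by (simp add: qb nat_mult_distrib)
  qed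
  ultimately show "(\<lambda>n. qbinom q (2 * n) (nat (int n + j))) \<longlonglongrightarrow> 1 / qpochhammer_inf q q"
    using qpochhammer_inf_self_nonzero[OF q] by (simp add: tendsto_cong)
  have "Bseq P" "Bseq (\<lambda>n. inverse (P n))"
    using P tendsto_inverse[OF P qpochhammer_inf_self_nonzero[OF q]]
    by (auto intro: convergent_imp_Bseq convergentI)
  then obtain B C where B: "B > 0" "\<And>n. norm (P n) \<le> B" and C: "C > 0" "\<And>n. norm (inverse (P n)) \<le> C"
    by (metis Bseq_def)
  have "norm (qbinom q n k) \<le> B * (C * C)" for n k
  proof (cases "k \<le> n")
    case True
    have "norm (P n * (inverse (P k) * inverse (P (n - k)))) \<le> B * (C * C)"
      unfolding norm_mult by (intro mult_mono B C) (use B(1) C(1) in auto)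
    then show ?thesis
      by (simp add: qb[OF True] divide_inverse)
  qed (use B(1) C(1) in \<open>auto simp: qbinom_eq_0\<close>)
  then show "\<exists>C. \<forall>n k. norm (qbinom q n k) \<le> C"
    by blast
qed

text \<open>The limit of the finite version: the coefficients tend to
  \<open>1 / qpochhammer_inf q q\<close>, and their uniform bound makes a multiple of the Gaussian
  terms a majorant.\<close>

theorem jacobi_triple_product:
  fixes h \<xi> :: complex
  assumes h: "Re h < 0"
  shows "((\<lambda>j::int. exp (h * (of_int j * (of_int j - 1) / 2) + of_int j * \<xi>))
      has_sum Theta (- exp \<xi>) (exp h)) UNIV"
proof -
  define q where "q = exp h"
  define e where "e j = exp (h * (of_int j * (of_int j - 1) / 2) + of_int j * \<xi>)" for j :: int
  have q: "norm q < 1"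
    using h by (simp add: q_def)
  have abs_summable: "(\<lambda>j. norm (e j)) summable_on UNIV"
  proof -
    have "(\<lambda>j::int. norm (exp (h / 2 * of_int j ^ 2 + of_int j * (\<xi> - h / 2)))) summable_on UNIV"
      using h by (intro abs_summable_on_gauss_exp) auto
    moreover have "h / 2 * of_int j ^ 2 + of_int j * (\<xi> - h / 2)
        = h * (of_int j * (of_int j - 1) / 2) + of_int j * \<xi>" for j :: int
      by (simp add: field_simps power2_eq_square)
    ultimately show ?thesis
      unfolding e_def by (simp only:)
  qed
  obtain C where C: "\<And>n k. norm (qbinom q n k) \<le> C"
    using bounded_qbinom[OF q] by blast
  \<comment> \<open>The finite sum is extended by zero to all integers. The case distinction
    matters: for \<open>j < - n\<close> the conversion \<open>nat\<close> would truncate to index 0,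
    where \<open>qbinom\<close> equals 1.\<close>
  define f where "f j n = (if \<bar>j\<bar> \<le> int n then qbinom q (2 * n) (nat (int n + j)) else 0) * e j" for j n
  have "(\<lambda>n. \<Sum>\<^sub>\<infinity>j. f j n) \<longlonglongrightarrow> (\<Sum>\<^sub>\<infinity>j. 1 / qpochhammer_inf q q * e j)"
  proof (rule tendsto_infsum_dominated)
    show "f j \<longlonglongrightarrow> 1 / qpochhammer_inf q q * e j" for j
      unfolding f_def
    proof (rule tendsto_mult_right)
      have "\<forall>\<^sub>F n in sequentially. qbinom q (2 * n) (nat (int n + j))
          = (if \<bar>j\<bar> \<le> int n then qbinom q (2 * n) (nat (int n + j)) else 0)"
        using eventually_ge_at_top[of "nat \<bar>j\<bar>"] by eventually_elim auto
      then show "(\<lambda>n. if \<bar>j\<bar> \<le> int n then qbinom q (2 * n) (nat (int n + j)) else 0)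
          \<longlonglongrightarrow> 1 / qpochhammer_inf q q"
        by (rule Lim_transform_eventually[OF tendsto_central_qbinom[OF q]])
    qed
    show "(\<lambda>j. C * norm (e j)) summable_on UNIV"
      by (intro summable_on_cmult_right abs_summable)
    have "0 \<le> C"
      using C[of 0 0] by (rule order_trans[rotated]) simp
    then show "\<forall>\<^sub>F n in sequentially. \<forall>j\<in>UNIV. norm (f j n) \<le> C * norm (e j)"
      by (auto simp: f_def norm_mult intro!: always_eventually mult_right_mono C)
  qed simp
  moreover have "(\<Sum>\<^sub>\<infinity>j. f j n) = (\<Prod>i<n. 1 - (- exp \<xi>) * q ^ i) * (\<Prod>i<n. 1 - q / (- exp \<xi>) * q ^ i)" for n
  proof -
    have "(\<Sum>\<^sub>\<infinity>j. f j n) = (\<Sum>\<^sub>\<infinity>j\<in>{- int n..int n}. f j n)"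
      by (rule infsum_cong_neutral) (auto simp: f_def)
    also have "\<dots> = (\<Sum>j\<in>{- int n..int n}. qbinom q (2 * n) (nat (int n + j)) * e j)"
      by (subst infsum_finite) (auto simp: f_def intro!: sum.cong)
    also have "\<dots> = (\<Prod>i<n. 1 + exp \<xi> * q ^ i) * (\<Prod>i<n. 1 + q / exp \<xi> * q ^ i)"
      unfolding q_def e_def by (rule finite_jacobi_triple_product[symmetric])
    finally show ?thesis
      by simp
  qed
  ultimately have "(\<lambda>n. (\<Prod>i<n. 1 - (- exp \<xi>) * q ^ i) * (\<Prod>i<n. 1 - q / (- exp \<xi>) * q ^ i))
      \<longlonglongrightarrow> (\<Sum>\<^sub>\<infinity>j. 1 / qpochhammer_inf q q * e j)"
    by simp
  then have "qpochhammer_inf (- exp \<xi>) q * qpochhammer_inf (q / (- exp \<xi>)) q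
      = (\<Sum>\<^sub>\<infinity>j. 1 / qpochhammer_inf q q * e j)"
    by (rule LIMSEQ_unique[OF tendsto_mult[OF convergent_prod_qpochhammer(1) convergent_prod_qpochhammer(1)], OF q q])
  also have "\<dots> = 1 / qpochhammer_inf q q * (\<Sum>\<^sub>\<infinity>j. e j)"
    by (rule infsum_cmult_right')
  finally have "(\<Sum>\<^sub>\<infinity>j. e j) = Theta (- exp \<xi>) q"
    using qpochhammer_inf_self_nonzero[OF q] by (simp add: Theta_def field_simps)
  with has_sum_infsum[OF abs_summable_summable[OF abs_summable]] show ?thesis
    by (simp add: e_def[abs_def] q_def)
qed

subsection \<open>Theta functions\<close>

text \<open>The sign \<open>(-1)^j\<close> is absorbed into the exponential as
  \<open>\<i> * pi * j\<close>, so that later identities of summands reduce to identities of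
  exponents.\<close>

lemma theta_has_sum:
  assumes "Re h < 0"
  shows "((\<lambda>j::int. exp (h * (of_int j * (of_int j - 1) / 2) + of_int j * (\<xi> + \<i> * of_real pi)))
      has_sum Theta (exp \<xi>) (exp h)) UNIV"
  using jacobi_triple_product[OF assms, of "\<xi> + \<i> * of_real pi"] by (simp add: exp_add)

text \<open>Shifting the summation index by \<open>m\<close> in the theta series completes the
  square and leaves a constant factor.\<close>

lemma theta_quasi_periodic:
  assumes "Re h < 0"
  shows "Theta (exp (\<xi> + of_int m * h)) (exp h)
    = exp (- h * (of_int m * (of_int m - 1) / 2) - of_int m * (\<xi> + \<i> * of_real pi)) * Theta (exp \<xi>) (exp h)"
proof -
  define e where "e \<xi> j = exp (h * (of_int j * (of_int j - 1) / 2) + of_int j * (\<xi> + \<i> * of_real pi))"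
    for \<xi> and j :: int
  define C where "C = exp (- h * (of_int m * (of_int m - 1) / 2) - of_int m * (\<xi> + \<i> * of_real pi))"
  have "((\<lambda>j. C * e \<xi> j) has_sum (C * Theta (exp \<xi>) (exp h))) UNIV"
    unfolding e_def by (intro has_sum_cmult_right theta_has_sum assms)
  also have "?this \<longleftrightarrow> (e (\<xi> + of_int m * h) has_sum (C * Theta (exp \<xi>) (exp h))) UNIV"
  proof (rule has_sum_reindex_bij_witness[of _ "\<lambda>j. j + m" "\<lambda>j. j - m"])
    show "e (\<xi> + of_int m * h) (j - m) = C * e \<xi> j" for j
      unfolding e_def C_def
      by (simp only: exp_add[symmetric], rule arg_cong[where f = exp]) (simp add: field_simps)
  qed auto
  finally show ?thesis
    using theta_has_sum[OF assms, of "\<xi> + of_int m * h"] has_sum_unique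
    unfolding e_def C_def by blast
qed

text \<open>The factor with argument \<open>q / q = 1\<close> vanishes.\<close>

lemma theta_at_base:
  assumes "norm q < 1" "q \<noteq> 0"
  shows "Theta q q = 0"
  using qpochhammer_inf_rec[OF assms(1), of 1] assms(2) by (simp add: Theta_def)

lemma theta_nonzero:
  assumes h: "Re h < 0" and \<xi>: "\<And>k::int. exp (\<xi> + of_int k * h) \<noteq> 1"
  shows "Theta (exp \<xi>) (exp h) \<noteq> 0"
proof -
  have q: "norm (exp h) < 1"
    using h by simp
  have "exp \<xi> * exp h ^ i \<noteq> 1" for i
    using \<xi>[of "int i"] by (simp add: exp_add exp_of_nat_mult)
  moreover have "exp h / exp \<xi> * exp h ^ i \<noteq> 1" for i
  proof
    assume "exp h / exp \<xi> * exp h ^ i = 1"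
    then have "exp (\<xi> + of_int (- int (Suc i)) * h) = 1"
      by (simp add: exp_diff exp_add exp_of_nat2_mult field_simps)
    then show False
      using \<xi> by blast
  qed
  ultimately show ?thesis
    unfolding Theta_def by (simp add: convergent_prod_qpochhammer(2)[OF q] qpochhammer_inf_self_nonzero[OF q])
qed

lemma continuous_on_theta:
  assumes "norm q < 1"
  shows "continuous_on (- {0}) (\<lambda>x. Theta x q)"
  unfolding Theta_def
  by (intro continuous_intros continuous_on_compose2[OF continuous_on_qpochhammer_inf[OF assms]]) auto

subsection \<open>Geometric series over the integers\<close>

text \<open>Half the sum of two signs, each encoded by the truth value of its being positive. The
  result type is polymorphic so that complex series and the real series of their norms share the
  same weight.\<close>

definition hsign :: "bool \<Rightarrow> bool \<Rightarrow> 'a :: real_normed_field" where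
  "hsign P Q = (if P \<longleftrightarrow> Q then if P then 1 else - 1 else 0)"

text \<open>In terms of signs this is
  \<open>(p + r) / 2 + (q + s) / 2 - (p + q) / 2 = (r + s) / 2\<close>. It is what turns the
  indefinite theta series and the two Appell parts into one series with the remaining sign
  pair.\<close>

lemma hsign_cocycle: "hsign P R + hsign Q S - hsign P Q = hsign R S"
  by (auto simp: hsign_def)

lemma sg2_eq_hsign: "complex_of_real (sg2 r s) = hsign (r \<ge> 0) (s \<ge> 0)"
  by (auto simp: sg2_def sg_def hsign_def)

text \<open>Inside the unit disc the expansion runs over \<open>k \<ge> m\<close> with sign plus,
  outside it over \<open>k < m\<close> with sign minus; \<open>hsign\<close> records both cases at
  once.\<close>

lemma has_sum_two_sided_geometric:
  fixes w :: "'a :: {real_normed_field, banach}"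
  assumes "w \<noteq> 0" "norm w \<noteq> 1"
  shows "((\<lambda>k::int. hsign (k \<ge> m) (norm w < 1) * w powi k) has_sum (w powi m / (1 - w))) UNIV"
proof (cases "norm w < 1")
  case True
  have "((\<lambda>n::nat. w ^ n) has_sum (1 / (1 - w))) UNIV"
    using True by (intro norm_summable_imp_has_sum)
      (auto simp: norm_power intro: summable_geometric geometric_sums)
  then have "((\<lambda>n::nat. w powi m * w ^ n) has_sum (w powi m * (1 / (1 - w)))) UNIV"
    by (rule has_sum_cmult_right)
  also have "?this \<longleftrightarrow> ((\<lambda>k. w powi k) has_sum (w powi m * (1 / (1 - w)))) {m..}"
    by (rule has_sum_reindex_bij_witness[of _ "\<lambda>k. nat (k - m)" "\<lambda>n. m + int n"])
      (use assms in \<open>auto simp: power_int_add\<close>)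
  also have "\<dots> \<longleftrightarrow> ((\<lambda>k. hsign (k \<ge> m) (norm w < 1) * w powi k) has_sum (w powi m / (1 - w))) UNIV"
    unfolding times_divide_eq_right mult_1_right
    by (rule has_sum_cong_neutral) (use True in \<open>auto simp: hsign_def\<close>)
  finally show ?thesis .
next
  case False
  \<comment> \<open>Outside the disc one expands in powers of \<open>inverse w\<close>; the top
    exponent is then \<open>m - 1\<close>.\<close>
  have "((\<lambda>n::nat. inverse w ^ n) has_sum (1 / (1 - inverse w))) UNIV"
    using False assms by (intro norm_summable_imp_has_sum)
      (auto simp: norm_power norm_inverse intro!: summable_geometric geometric_sums inverse_less_1_iff[THEN iffD2])
  then have "((\<lambda>n::nat. - (w powi (m - 1)) * inverse w ^ n) has_sum (- (w powi (m - 1)) * (1 / (1 - inverse w)))) UNIV"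
    by (rule has_sum_cmult_right)
  also have "- (w powi (m - 1)) * (1 / (1 - inverse w)) = w powi m / (1 - w)"
  proof -
    have "w \<noteq> 1"
      using assms by auto
    then show ?thesis
      using assms by (simp add: power_int_diff field_simps)
  qed
  also have "((\<lambda>n::nat. - (w powi (m - 1)) * inverse w ^ n) has_sum (w powi m / (1 - w))) UNIV
      \<longleftrightarrow> ((\<lambda>k. - (w powi k)) has_sum (w powi m / (1 - w))) {..<m}"
    by (rule has_sum_reindex_bij_witness[of _ "\<lambda>k. nat (m - 1 - k)" "\<lambda>n. m - 1 - int n"])
      (use assms in \<open>auto simp: power_int_diff power_int_add power_inverse field_simps\<close>)
  also have "\<dots> \<longleftrightarrow> ((\<lambda>k. hsign (k \<ge> m) (norm w < 1) * w powi k) has_sum (w powi m / (1 - w))) UNIV"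
    by (rule has_sum_cong_neutral) (use False in \<open>auto simp: hsign_def\<close>)
  finally show ?thesis .
qed

text \<open>All terms of the real series in \<open>norm w\<close> carry the same sign, that of
  \<open>1 - norm w\<close>, so the series of norms is again geometric.\<close>

lemma has_sum_norm_two_sided_geometric:
  fixes w :: "'a :: {real_normed_field, banach}"
  assumes "w \<noteq> 0" "norm w \<noteq> 1"
  shows "((\<lambda>k::int. norm (hsign (k \<ge> m) (norm w < 1) * w powi k))
    has_sum (norm w powi m / \<bar>1 - norm w\<bar>)) UNIV"
proof -
  have "((\<lambda>k::int. sgn (1 - norm w) * (hsign (k \<ge> m) (norm w < 1) * norm w powi k))
    has_sum (sgn (1 - norm w) * (norm w powi m / (1 - norm w)))) UNIV"
    using has_sum_two_sided_geometric[of "norm w" m] assms by (intro has_sum_cmult_right) auto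
  moreover have "sgn (1 - norm w) * (norm w powi m / (1 - norm w)) = norm w powi m / \<bar>1 - norm w\<bar>"
    using assms by (auto simp: sgn_if abs_if divide_simps)
  moreover have "sgn (1 - norm w) * (hsign (k \<ge> m) (norm w < 1) * norm w powi k)
      = norm (hsign (k \<ge> m) (norm w < 1) * w powi k)" for k :: int
    using assms by (auto simp: sgn_if hsign_def norm_mult norm_power_int)
  ultimately show ?thesis
    by simp
qed

text \<open>Expands a denominator inside an outer sum. Since the inner sum of norms has a closed
  form, absolute convergence of the double series reduces to that of one single series.\<close>

lemma has_sum_iterated_geometric:
  fixes g w :: "'b \<Rightarrow> complex"
  assumes w: "\<And>r. r \<in> R \<Longrightarrow> w r \<noteq> 0" "\<And>r. r \<in> R \<Longrightarrow> norm (w r) \<noteq> 1"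
    and abs: "(\<lambda>r. norm (g r) * (norm (w r) powi m / \<bar>1 - norm (w r)\<bar>)) summable_on R"
    and S: "((\<lambda>r. g r * (w r powi m / (1 - w r))) has_sum S) R"
  shows "((\<lambda>(r, k::int). g r * (hsign (k \<ge> m) (norm (w r) < 1) * w r powi k)) has_sum S) (R \<times> UNIV)"
proof (rule has_sum_SigmaI[OF _ S])
  show "((\<lambda>k. case (r, k) of (r, k) \<Rightarrow> g r * (hsign (m \<le> k) (norm (w r) < 1) * w r powi k))
    has_sum g r * (w r powi m / (1 - w r))) UNIV" if "r \<in> R" for r
    using has_sum_cmult_right[OF has_sum_two_sided_geometric[OF w[OF that]]] by simp
  have "(\<lambda>(r, k). norm (g r * (hsign (k \<ge> m) (norm (w r) < 1) * w r powi k))) summable_on R \<times> UNIV"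
  proof (rule summable_on_SigmaI[OF _ abs])
    show "((\<lambda>k. case (r, k) of (r, k) \<Rightarrow> norm (g r * (hsign (k \<ge> m) (norm (w r) < 1) * w r powi k)))
      has_sum norm (g r) * (norm (w r) powi m / \<bar>1 - norm (w r)\<bar>)) UNIV" if "r \<in> R" for r
      using has_sum_cmult_right[OF has_sum_norm_two_sided_geometric[OF w[OF that]], of "norm (g r)"]
      by (simp add: norm_mult)
  qed auto
  then show "(\<lambda>(r, k). g r * (hsign (k \<ge> m) (norm (w r) < 1) * w r powi k)) summable_on R \<times> UNIV"
    by (subst summable_on_iff_abs_summable_on_complex) (simp add: case_prod_unfold)
qed

lemma summable_on_mult_nonneg:
  fixes f :: "'a \<Rightarrow> real" and g :: "'b \<Rightarrow> real"
  assumes "f summable_on X" "g summable_on Y" "\<And>x. f x \<ge> 0" "\<And>y. g y \<ge> 0"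
  shows "(\<lambda>(x, y). f x * g y) summable_on X \<times> Y"
  by (rule summable_on_SigmaI[where g = "\<lambda>x. f x * (\<Sum>\<^sub>\<infinity>y\<in>Y. g y)"])
    (auto intro!: has_sum_cmult_right summable_on_cmult_left has_sum_infsum assms mult_nonneg_nonneg)

lemma has_sum_mult_complex:
  fixes f :: "'a \<Rightarrow> complex" and g :: "'b \<Rightarrow> complex"
  assumes f: "(f has_sum A) X" and g: "(g has_sum B) Y"
  shows "((\<lambda>(x, y). f x * g y) has_sum (A * B)) (X \<times> Y)"
proof (rule has_sum_SigmaI)
  show "((\<lambda>y. case (x, y) of (x, y) \<Rightarrow> f x * g y) has_sum f x * B) Y" for x
    using has_sum_cmult_right[OF g] by simp
  show "((\<lambda>x. f x * B) has_sum (A * B)) X"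
    by (rule has_sum_cmult_left[OF f])
  have norms: "(\<lambda>x. norm (f x)) summable_on X" "(\<lambda>y. norm (g y)) summable_on Y"
    using f g by (simp_all add: has_sum_imp_summable flip: summable_on_iff_abs_summable_on_complex)
  have "(\<lambda>(x, y). norm (f x) * norm (g y)) summable_on X \<times> Y"
    by (rule summable_on_mult_nonneg) (simp_all add: norms)
  then show "(\<lambda>(x, y). f x * g y) summable_on X \<times> Y"
    by (subst summable_on_iff_abs_summable_on_complex) (simp add: case_prod_unfold norm_mult)
qed

text \<open>For all but finitely many \<open>k\<close> the modulus of the exponential is at most 1/2
  or at least 2, which bounds the reciprocal by 2; the finitely many exceptions are covered by the
  sum of their values.\<close>

lemma bounded_inverse_one_minus_exp:
  fixes h \<eta> :: complex
  assumes h: "Re h < 0" and \<eta>: "\<And>k::int. exp (of_int k * h + \<eta>) \<noteq> 1"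
  obtains M where "M > 0" "\<And>k::int. norm (1 / (1 - exp (of_int k * h + \<eta>))) \<le> M"
proof -
  define w where "w k = exp (of_int k * h + \<eta>)" for k :: int
  \<comment> \<open>Outside \<open>K\<close> the real part of the exponent has absolute value at
    least 1.\<close>
  define K where "K = {k::int. \<bar>real_of_int k\<bar> \<le> (1 + \<bar>Re \<eta>\<bar>) / \<bar>Re h\<bar>}"
  have "K \<subseteq> {- \<lfloor>(1 + \<bar>Re \<eta>\<bar>) / \<bar>Re h\<bar>\<rfloor>..\<lfloor>(1 + \<bar>Re \<eta>\<bar>) / \<bar>Re h\<bar>\<rfloor>}"
    unfolding K_def by (auto simp: abs_le_iff le_floor_iff minus_le_iff)
  then have fin: "finite K"
    by (rule finite_subset) simp
  have e: "2 \<le> exp (1::real)"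
    using exp_ge_add_one_self[of "1::real"] by simp
  have le: "norm (1 / (1 - w k)) \<le> 2 + (\<Sum>k\<in>K. norm (1 / (1 - w k)))" for k
  proof (cases "k \<in> K")
    case True
    then have "norm (1 / (1 - w k)) \<le> (\<Sum>k\<in>K. norm (1 / (1 - w k)))"
      by (intro member_le_sum[OF _ _ fin]) auto
    then show ?thesis by simp
  next
    case False
    have "1 \<le> \<bar>real_of_int k * Re h + Re \<eta>\<bar>"
    proof -
      have "1 + \<bar>Re \<eta>\<bar> \<le> \<bar>real_of_int k * Re h\<bar>"
        using False h by (simp add: K_def not_le field_simps abs_mult)
      then show ?thesis by linarith
    qed
    then consider "real_of_int k * Re h + Re \<eta> \<le> - 1" | "1 \<le> real_of_int k * Re h + Re \<eta>"
      by linarith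
    then have "1 / 2 \<le> norm (1 - w k)"
    proof cases
      case 1
      then have "norm (w k) \<le> exp (- 1)"
        by (simp add: w_def)
      also have "\<dots> \<le> 1 / 2"
        using e by (simp add: exp_minus field_simps)
      finally show ?thesis
        using norm_triangle_ineq2[of 1 "w k"] by simp
    next
      case 2
      then have "2 \<le> norm (w k)"
        using e by (simp add: w_def) (metis exp_le_cancel_iff order_trans)
      then show ?thesis
        using norm_triangle_ineq2[of "w k" 1] by (simp add: norm_minus_commute)
    qed
    then have "norm (1 / (1 - w k)) \<le> 2"
      by (simp add: norm_divide divide_simps)
    moreover have "0 \<le> (\<Sum>k\<in>K. norm (1 / (1 - w k)))"
      by (rule sum_nonneg) simp
    ultimately show ?thesis by linarith
  qed
  show ?thesis
  proof (rule that)
    show "0 < 2 + (\<Sum>k\<in>K. norm (1 / (1 - w k)))"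
      by (rule add_pos_nonneg) (auto intro: sum_nonneg)
  qed (use le in \<open>simp add: w_def\<close>)
qed

subsection \<open>Kronecker's double series\<close>

text \<open>The reciprocal tends to 1 as \<open>r\<close> tends to plus infinity and to 0 as
  \<open>r\<close> tends to minus infinity. The deviations are \<open>w / (1 - w)\<close> and
  \<open>inverse w * (w / (1 - w))\<close>, both exponentially small.\<close>

lemma lerch_summand_bound:
  fixes h \<eta> :: complex
  assumes h: "Re h < 0" and \<eta>: "\<And>k::int. exp (of_int k * h + \<eta>) \<noteq> 1"
  obtains K where "K > 0"
    "\<And>r::int. norm (1 / (1 - exp (of_int r * h + \<eta>)) - of_bool (r \<ge> 0)) \<le> K * exp (\<bar>of_int r\<bar> * Re h)"
proof -
  obtain M where M: "M > 0" "\<And>k::int. norm (1 / (1 - exp (of_int k * h + \<eta>))) \<le> M"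
    using bounded_inverse_one_minus_exp[OF h \<eta>] by blast
  define K where "K = M * exp (Re \<eta>) + (M + 1) * exp (- Re \<eta>)"
  have K: "M * exp (Re \<eta>) \<le> K" "(M + 1) * exp (- Re \<eta>) \<le> K" "K > 0"
    using M(1) unfolding K_def by (auto intro: add_pos_pos)
  have "norm (1 / (1 - exp (of_int r * h + \<eta>)) - of_bool (r \<ge> 0)) \<le> K * exp (\<bar>of_int r\<bar> * Re h)" for r :: int
  proof -
    define w where "w = exp (of_int r * h + \<eta>)"
    have w: "w \<noteq> 0" "w \<noteq> 1" "norm (1 / (1 - w)) \<le> M"
      using \<eta> M(2)[of r] by (auto simp: w_def)
    have norm_w: "norm w = exp (Re \<eta>) * exp (of_int r * Re h)"
      by (simp add: w_def add.commute flip: exp_add)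
    show ?thesis
    proof (cases "r \<ge> 0")
      case True
      have "norm (1 / (1 - w) - 1) = norm w * norm (1 / (1 - w))"
        using w by (simp add: field_simps flip: norm_mult)
      also have "\<dots> \<le> norm w * M"
        using w by (intro mult_left_mono) auto
      also have "\<dots> = M * exp (Re \<eta>) * exp (\<bar>of_int r\<bar> * Re h)"
        using True by (simp add: norm_w)
      also have "\<dots> \<le> K * exp (\<bar>of_int r\<bar> * Re h)"
        using K by (intro mult_right_mono) auto
      finally show ?thesis
        using True by (simp add: w_def)
    next
      case False
      have "norm (1 / (1 - w)) = norm (inverse w) * norm (1 / (1 - w) - 1)"
        using w by (simp add: field_simps flip: norm_mult norm_inverse)
      also have "\<dots> \<le> norm (inverse w) * (M + 1)"
        using w norm_triangle_ineq4[of "1 / (1 - w)" 1] by (intro mult_left_mono) auto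
      also have "\<dots> = (M + 1) * exp (- Re \<eta>) * exp (\<bar>of_int r\<bar> * Re h)"
        using False by (simp add: norm_w exp_minus norm_inverse)
      also have "\<dots> \<le> K * exp (\<bar>of_int r\<bar> * Re h)"
        using K by (intro mult_right_mono) auto
      finally show ?thesis
        using False by (simp add: w_def)
    qed
  qed
  with K(3) that show ?thesis by blast
qed

lemma summable_on_two_sided_exp:
  fixes a b :: real
  assumes "\<bar>a\<bar> < - b"
  shows "(\<lambda>r::int. exp (of_int r * a + \<bar>of_int r\<bar> * b)) summable_on UNIV"
proof -
  have "(\<lambda>r::int. if r \<ge> 0 then exp (a + b) ^ nat r else exp (b - a) ^ nat (- r)) summable_on UNIV"
    using assms by (intro summable_on_two_sided_geometric) auto
  moreover have "(if r \<ge> 0 then exp (a + b) ^ nat r else exp (b - a) ^ nat (- r))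
      = exp (of_int r * a + \<bar>of_int r\<bar> * b)" for r :: int
    by (auto simp: algebra_simps simp flip: exp_of_nat_mult)
  ultimately show ?thesis
    by (simp only:)
qed

text \<open>The sum of \<open>x^r / (1 - q^r * y)\<close> with the part \<open>x^r\<close> removed
  for \<open>r \<ge> 0\<close>. The removed part carries the pole at \<open>x = 1\<close>, so the
  tail still converges in a neighbourhood of \<open>\<xi> = 0\<close>.\<close>

definition lerch_tail :: "complex \<Rightarrow> complex \<Rightarrow> complex \<Rightarrow> complex" where
  "lerch_tail h \<xi> \<eta> =
    (\<Sum>\<^sub>\<infinity>r::int. exp (of_int r * \<xi>) * (1 / (1 - exp (of_int r * h + \<eta>)) - of_bool (r \<ge> 0)))"

text \<open>In the annulus where the modulus of \<open>exp \<xi>\<close> lies between that of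
  \<open>exp h\<close> and 1, the removed geometric series can be put back.\<close>

lemma lerch_has_sum:
  fixes h \<xi> \<eta> :: complex
  assumes h: "Re h < 0" and \<xi>: "Re h < Re \<xi>" "Re \<xi> < 0" and \<eta>: "\<And>k::int. exp (of_int k * h + \<eta>) \<noteq> 1"
  shows "((\<lambda>r::int. exp (of_int r * \<xi>) / (1 - exp (of_int r * h + \<eta>)))
      has_sum (1 / (1 - exp \<xi>) + lerch_tail h \<xi> \<eta>)) UNIV"
proof -
  obtain K where K: "K > 0"
    "\<And>r::int. norm (1 / (1 - exp (of_int r * h + \<eta>)) - of_bool (r \<ge> 0)) \<le> K * exp (\<bar>of_int r\<bar> * Re h)"
    using lerch_summand_bound[OF h \<eta>] by blast
  define f where "f r = exp (of_int r * \<xi>) * (1 / (1 - exp (of_int r * h + \<eta>)) - of_bool (r \<ge> 0))" for r :: int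
  have "(\<lambda>r. norm (f r)) summable_on UNIV"
  proof (rule Infinite_Sum.abs_summable_on_comparison_test')
    show "(\<lambda>r::int. K * exp (of_int r * Re \<xi> + \<bar>of_int r\<bar> * Re h)) summable_on UNIV"
      using \<xi> by (intro summable_on_cmult_right summable_on_two_sided_exp) auto
    fix r :: int
    have "norm (f r) \<le> exp (of_int r * Re \<xi>) * (K * exp (\<bar>of_int r\<bar> * Re h))"
      using mult_left_mono[OF K(2)[of r], of "exp (of_int r * Re \<xi>)"] by (simp add: f_def norm_mult)
    then show "norm (f r) \<le> K * exp (of_int r * Re \<xi> + \<bar>of_int r\<bar> * Re h)"
      by (simp add: exp_add mult_ac)
  qed
  then have "(f has_sum lerch_tail h \<xi> \<eta>) UNIV"
    unfolding lerch_tail_def f_def by (rule has_sum_infsum[OF abs_summable_summable])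
  moreover have "((\<lambda>r::int. of_bool (r \<ge> 0) * exp (of_int r * \<xi>)) has_sum (1 / (1 - exp \<xi>))) UNIV"
    using has_sum_two_sided_geometric[of "exp \<xi>" 0] \<xi>
    by (simp add: exp_power_int hsign_def of_bool_def if_distrib cong: if_cong)
  ultimately have "((\<lambda>r. of_bool (r \<ge> 0) * exp (of_int r * \<xi>) + f r)
      has_sum (1 / (1 - exp \<xi>) + lerch_tail h \<xi> \<eta>)) UNIV"
    by (rule has_sum_add[rotated])
  moreover have "of_bool (r \<ge> 0) * exp (of_int r * \<xi>) + f r = exp (of_int r * \<xi>) / (1 - exp (of_int r * h + \<eta>))" for r
    by (simp add: f_def right_diff_distrib)
  ultimately show ?thesis
    by (simp only:)
qed

text \<open>Serves the limit \<open>\<xi> \<rightarrow> 0\<close>: on the strip, half of the decay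
  of the summands remains and gives a majorant independent of \<open>\<xi>\<close>.\<close>

lemma lerch_tail_bounded:
  fixes h \<eta> :: complex
  assumes h: "Re h < 0" and \<eta>: "\<And>k::int. exp (of_int k * h + \<eta>) \<noteq> 1"
  obtains B where "\<And>\<xi>. \<bar>Re \<xi>\<bar> \<le> - Re h / 2 \<Longrightarrow> norm (lerch_tail h \<xi> \<eta>) \<le> B"
proof -
  obtain K where K: "K > 0"
    "\<And>r::int. norm (1 / (1 - exp (of_int r * h + \<eta>)) - of_bool (r \<ge> 0)) \<le> K * exp (\<bar>of_int r\<bar> * Re h)"
    using lerch_summand_bound[OF h \<eta>] by blast
  define g where "g r = K * exp (of_int r * 0 + \<bar>of_int r\<bar> * (Re h / 2))" for r :: int
  have g: "g summable_on UNIV"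
    unfolding g_def using h by (intro summable_on_cmult_right summable_on_two_sided_exp) auto
  show ?thesis
  proof (rule that)
    fix \<xi> :: complex assume \<xi>: "\<bar>Re \<xi>\<bar> \<le> - Re h / 2"
    define f where "f r = exp (of_int r * \<xi>) * (1 / (1 - exp (of_int r * h + \<eta>)) - of_bool (r \<ge> 0))" for r :: int
    have le: "norm (f r) \<le> g r" for r
    proof -
      have "norm (f r) \<le> exp (of_int r * Re \<xi>) * (K * exp (\<bar>of_int r\<bar> * Re h))"
        using mult_left_mono[OF K(2)[of r], of "exp (of_int r * Re \<xi>)"] by (simp add: f_def norm_mult)
      also have "\<dots> = K * exp (of_int r * Re \<xi> + \<bar>of_int r\<bar> * Re h)"
        by (simp add: exp_add)
      also have "\<dots> \<le> g r"
      proof -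
        have "of_int r * Re \<xi> \<le> \<bar>of_int r\<bar> * (- Re h / 2)"
          using abs_ge_self[of "of_int r * Re \<xi>"] mult_left_mono[OF \<xi>, of "\<bar>of_int r\<bar>"]
          by (simp add: abs_mult)
        then show ?thesis
          unfolding g_def using K(1) by (auto simp: field_simps intro!: mult_left_mono)
      qed
      finally show ?thesis .
    qed
    have "(\<lambda>r. norm (f r)) summable_on UNIV"
      by (rule Infinite_Sum.abs_summable_on_comparison_test'[OF g le])
    then have "(f has_sum infsum f UNIV) UNIV"
      by (rule has_sum_infsum[OF abs_summable_summable])
    from norm_infsum_le[OF this has_sum_infsum[OF g] le] show "norm (lerch_tail h \<xi> \<eta>) \<le> infsum g UNIV"
      by (simp add: lerch_tail_def f_def[abs_def])
  qed
qed

text \<open>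
  The coefficients \<open>c\<^sub>m\<close> of the Laurent series of \<open>\<Theta>(x) \<Sum> x\<^sup>r / (1 - q\<^sup>r y)\<close> in \<open>x\<close> satisfy
  \<open>c\<^sub>m\<^sub>+\<^sub>1 = - q\<^sup>m y c\<^sub>m\<close>, because the error term of this recurrence is \<open>\<Theta>(q) = 0\<close>; hence the product
  is a multiple of \<open>\<Theta>(x y)\<close>.
\<close>

lemma theta_times_lerch:
  fixes h \<eta> :: complex
  assumes h: "Re h < 0" and \<eta>: "\<And>k::int. exp (of_int k * h + \<eta>) \<noteq> 1"
  obtains c where "\<And>\<xi>. Re h < Re \<xi> \<Longrightarrow> Re \<xi> < 0 \<Longrightarrow>
    Theta (exp \<xi>) (exp h) * (1 / (1 - exp \<xi>) + lerch_tail h \<xi> \<eta>) = c * Theta (exp (\<xi> + \<eta>)) (exp h)"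
proof -
  define \<kappa> where "\<kappa> = \<i> * complex_of_real pi"
  define t where "t n = exp (h * (of_int n * (of_int n - 1) / 2) + of_int n * \<kappa>)" for n :: int
  define w where "w k = exp (of_int k * h + \<eta>)" for k :: int
  \<comment> \<open>The coefficient of \<open>exp (m * \<xi>)\<close> in the product of the theta
    series, with coefficients \<open>t\<close>, and the Lerch series.\<close>
  define c where "c m = (\<Sum>\<^sub>\<infinity>n. t n / (1 - w (m - n)))" for m
  have w: "w k \<noteq> 1" for k
    using \<eta> by (simp add: w_def)
  obtain M where M: "M > 0" "\<And>k::int. norm (1 / (1 - w k)) \<le> M"
    using bounded_inverse_one_minus_exp[OF h \<eta>] unfolding w_def by blast
  have t: "(\<lambda>n. t n * exp (of_int n * \<xi>)) summable_on UNIV" for \<xi>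
    using theta_has_sum[OF h, of \<xi>] unfolding t_def \<kappa>_def
    by (auto simp: ring_distribs exp_add mult_ac dest: has_sum_imp_summable)
  have c: "((\<lambda>n. t n / (1 - w (m - n))) has_sum c m) UNIV" for m
  proof -
    have "(\<lambda>n. norm (t n)) summable_on UNIV"
      using t[of 0] by (simp add: summable_on_iff_abs_summable_on_complex)
    then have "(\<lambda>n. norm (t n / (1 - w (m - n)))) summable_on UNIV"
    proof (intro Infinite_Sum.abs_summable_on_comparison_test')
      show "norm (t n / (1 - w (m - n))) \<le> norm (t n) * M" for n
        using mult_left_mono[OF M(2)[of "m - n"], of "norm (t n)"] by (simp add: norm_divide)
    qed (intro summable_on_cmult_left)
    then show ?thesis
      unfolding c_def by (rule has_sum_infsum[OF abs_summable_summable])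
  qed
  have rec: "c (m + 1) = exp (of_int m * h + \<eta> + \<kappa>) * c m" for m
  proof -
    have "((\<lambda>n. t n / (1 - w (m + 1 - n))) has_sum c (m + 1)) UNIV
        \<longleftrightarrow> ((\<lambda>n. t (n + 1) / (1 - w (m - n))) has_sum c (m + 1)) UNIV"
      by (rule has_sum_reindex_bij_witness[of _ "\<lambda>n. n + 1" "\<lambda>n. n - 1"]) (auto simp: algebra_simps)
    then have 1: "((\<lambda>n. t (n + 1) / (1 - w (m - n))) has_sum c (m + 1)) UNIV"
      using c by simp
    \<comment> \<open>Uses \<open>t (n + 1) = exp \<kappa> * q^n * t n\<close> and
      \<open>q^n / (1 - w) = q^n + q^n * w / (1 - w)\<close>, where \<open>q^n * w (m - n)\<close>
      no longer depends on \<open>n\<close>.\<close>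
    have 2: "t (n + 1) / (1 - w (m - n)) = exp \<kappa> * (t n * exp (of_int n * h)) + exp (of_int m * h + \<eta> + \<kappa>) * (t n / (1 - w (m - n)))" for n
    proof -
      have a: "t (n + 1) = exp \<kappa> * (t n * exp (of_int n * h))"
        unfolding t_def by (simp only: exp_add[symmetric], rule arg_cong[where f = exp]) (simp add: field_simps)
      have b: "exp (of_int m * h + \<eta> + \<kappa>) = exp \<kappa> * (exp (of_int n * h) * w (m - n))"
        unfolding w_def by (simp only: exp_add[symmetric], rule arg_cong[where f = exp]) (simp add: field_simps)
      show ?thesis
        unfolding a b using w[of "m - n"] by (simp add: field_simps)
    qed
    have "((\<lambda>n. t n * exp (of_int n * h)) has_sum 0) UNIV"
      using theta_has_sum[OF h, of h] theta_at_base[of "exp h"] h unfolding t_def \<kappa>_def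
      by (simp add: ring_distribs exp_add mult_ac)
    from has_sum_add[OF has_sum_cmult_right[OF this] has_sum_cmult_right[OF c]]
    have "((\<lambda>n. t (n + 1) / (1 - w (m - n))) has_sum (exp \<kappa> * 0 + exp (of_int m * h + \<eta> + \<kappa>) * c m)) UNIV"
      unfolding 2 .
    with 1 show ?thesis
      using has_sum_unique by fastforce
  qed
  \<comment> \<open>The solution of the recurrence with \<open>T 0 = 1\<close>; up to a power of
    \<open>exp \<xi>\<close> it is the theta summand at \<open>\<xi> + \<eta>\<close>.\<close>
  define T where "T m = exp (h * (of_int m * (of_int m - 1) / 2) + of_int m * (\<eta> + \<kappa>))" for m :: int
  have T: "T (m + 1) = exp (of_int m * h + \<eta> + \<kappa>) * T m" for m
    unfolding T_def by (simp only: exp_add[symmetric], rule arg_cong[where f = exp]) (simp add: field_simps)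
  have cT: "c m = c 0 * T m" for m
  proof (induction m rule: int_induct[where k = 0])
    case (step2 i)
    then have "exp (of_int (i - 1) * h + \<eta> + \<kappa>) * c (i - 1) = exp (of_int (i - 1) * h + \<eta> + \<kappa>) * (c 0 * T (i - 1))"
      using rec[of "i - 1"] T[of "i - 1"] by simp
    then show ?case by simp
  qed (simp_all add: rec T, simp add: T_def)
  show ?thesis
  proof (rule that)
    fix \<xi> :: complex assume \<xi>: "Re h < Re \<xi>" "Re \<xi> < 0"
    have "((\<lambda>n. t n * exp (of_int n * \<xi>)) has_sum Theta (exp \<xi>) (exp h)) UNIV"
      using theta_has_sum[OF h, of \<xi>] unfolding t_def \<kappa>_def by (simp add: ring_distribs exp_add mult_ac)
    from has_sum_mult_complex[OF this lerch_has_sum[OF h \<xi> \<eta>]]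
    have "((\<lambda>(n, r). t n * exp (of_int n * \<xi>) * (exp (of_int r * \<xi>) / (1 - w r)))
        has_sum (Theta (exp \<xi>) (exp h) * (1 / (1 - exp \<xi>) + lerch_tail h \<xi> \<eta>))) (UNIV \<times> UNIV)"
      by (simp add: w_def)
    \<comment> \<open>Collecting by total power \<open>m = n + r\<close> turns the double series
      into the Cauchy product.\<close>
    also have "?this \<longleftrightarrow> ((\<lambda>(m, n). exp (of_int m * \<xi>) * (t n / (1 - w (m - n))))
        has_sum (Theta (exp \<xi>) (exp h) * (1 / (1 - exp \<xi>) + lerch_tail h \<xi> \<eta>))) (UNIV \<times> UNIV)"
      by (rule has_sum_reindex_bij_witness[of _ "\<lambda>(m, n). (n, m - n)" "\<lambda>(n, r). (n + r, n)"])
        (auto simp: ring_distribs exp_add)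
    finally have "((\<lambda>m. exp (of_int m * \<xi>) * c m)
        has_sum (Theta (exp \<xi>) (exp h) * (1 / (1 - exp \<xi>) + lerch_tail h \<xi> \<eta>))) UNIV"
    proof (rule has_sum_SigmaD)
      show "((\<lambda>n. case (m, n) of (m, n) \<Rightarrow> exp (of_int m * \<xi>) * (t n / (1 - w (m - n))))
          has_sum (exp (of_int m * \<xi>) * c m)) UNIV" for m
        using has_sum_cmult_right[OF c[of m], of "exp (of_int m * \<xi>)"] by simp
    qed
    moreover have "exp (of_int m * \<xi>) * c m = c 0 * exp (h * (of_int m * (of_int m - 1) / 2) + of_int m * (\<xi> + \<eta> + \<i> * of_real pi))" for m
      unfolding cT[of m] T_def \<kappa>_def by (simp add: ring_distribs exp_add)
    ultimately have "((\<lambda>m. c 0 * exp (h * (of_int m * (of_int m - 1) / 2) + of_int m * (\<xi> + \<eta> + \<i> * of_real pi)))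
        has_sum (Theta (exp \<xi>) (exp h) * (1 / (1 - exp \<xi>) + lerch_tail h \<xi> \<eta>))) UNIV"
      by simp
    then show "Theta (exp \<xi>) (exp h) * (1 / (1 - exp \<xi>) + lerch_tail h \<xi> \<eta>) = c 0 * Theta (exp (\<xi> + \<eta>)) (exp h)"
      using has_sum_cmult_right[OF theta_has_sum[OF h, of "\<xi> + \<eta>"]] has_sum_unique by blast
  qed
qed

text \<open>The unknown constant is found by letting \<open>exp \<xi>\<close> tend to 1: the zero of
  theta cancels the simple pole of the series, and the remaining factors tend to
  \<open>qpochhammer_inf q q ^ 3\<close>.\<close>

lemma theta_times_lerch_value:
  fixes h \<xi> \<eta> :: complex
  assumes h: "Re h < 0" and \<xi>: "Re h < Re \<xi>" "Re \<xi> < 0"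
    and \<eta>: "\<And>k::int. exp (of_int k * h + \<eta>) \<noteq> 1"
  shows "1 / (1 - exp \<xi>) + lerch_tail h \<xi> \<eta> = qpochhammer_inf (exp h) (exp h) ^ 3
    * Theta (exp (\<xi> + \<eta>)) (exp h) / (Theta (exp \<xi>) (exp h) * Theta (exp \<eta>) (exp h))"
proof -
  define q where "q = exp h"
  have q: "norm q < 1"
    using h by (simp add: q_def)
  obtain c where c: "\<And>\<xi>. Re h < Re \<xi> \<Longrightarrow> Re \<xi> < 0 \<Longrightarrow>
      Theta (exp \<xi>) q * (1 / (1 - exp \<xi>) + lerch_tail h \<xi> \<eta>) = c * Theta (exp (\<xi> + \<eta>)) q"
    using theta_times_lerch[OF h \<eta>] unfolding q_def by blast
  obtain B where B: "\<And>\<xi>. \<bar>Re \<xi>\<bar> \<le> - Re h / 2 \<Longrightarrow> norm (lerch_tail h \<xi> \<eta>) \<le> B"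
    using lerch_tail_bounded[OF h \<eta>] by blast
  \<comment> \<open>A real sequence tending to 0 inside the annulus; the offset 2 keeps it in the
    strip on which the tail is bounded.\<close>
  define \<zeta> where "\<zeta> n = complex_of_real (Re h / real (n + 2))" for n
  have \<zeta>_range: "Re h < Re (\<zeta> n)" "Re (\<zeta> n) < 0" "\<bar>Re (\<zeta> n)\<bar> \<le> - Re h / 2" for n
  proof -
    have "Re h * real n \<le> 0"
      using h by (intro mult_nonpos_nonneg) auto
    then show "Re h < Re (\<zeta> n)" "Re (\<zeta> n) < 0" "\<bar>Re (\<zeta> n)\<bar> \<le> - Re h / 2"
      using h by (auto simp: \<zeta>_def field_simps abs_if)
  qed
  have "\<zeta> \<longlonglongrightarrow> of_real 0"
    unfolding \<zeta>_def
    by (intro tendsto_of_real real_tendsto_divide_at_top[OF tendsto_const]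
        filterlim_compose[OF filterlim_real_sequentially] filterlim_add_const_nat_at_top)
  then have \<zeta>: "\<zeta> \<longlonglongrightarrow> 0"
    by simp
  have exp_\<zeta>: "(\<lambda>n. exp (\<zeta> n)) \<longlonglongrightarrow> 1"
    using tendsto_exp[OF \<zeta>] by simp
  have qp: "(\<lambda>n. qpochhammer_inf (f n) q) \<longlonglongrightarrow> qpochhammer_inf x q" if "f \<longlonglongrightarrow> x" for f and x :: complex
    using continuous_on_qpochhammer_inf[OF q] that
    by (auto simp: continuous_on_eq_continuous_at intro: isCont_tendsto_compose)
  have tail: "(\<lambda>n. (1 - exp (\<zeta> n)) * lerch_tail h (\<zeta> n) \<eta>) \<longlonglongrightarrow> 0"
  proof (rule tendsto_0_le)
    show "(\<lambda>n. 1 - exp (\<zeta> n)) \<longlonglongrightarrow> 0"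
      using tendsto_diff[OF tendsto_const exp_\<zeta>, of 1] by simp
    show "\<forall>\<^sub>F n in sequentially. norm ((1 - exp (\<zeta> n)) * lerch_tail h (\<zeta> n) \<eta>) \<le> norm (1 - exp (\<zeta> n)) * B"
      unfolding norm_mult by (intro always_eventually allI mult_left_mono B \<zeta>_range) simp
  qed
  have "(\<lambda>n. qpochhammer_inf (exp (\<zeta> n) * q) q * qpochhammer_inf (q / exp (\<zeta> n)) q * qpochhammer_inf q q
      * (1 + (1 - exp (\<zeta> n)) * lerch_tail h (\<zeta> n) \<eta>))
      \<longlonglongrightarrow> qpochhammer_inf (1 * q) q * qpochhammer_inf (q / 1) q * qpochhammer_inf q q * (1 + 0)"
    by (intro tendsto_intros qp exp_\<zeta> tail) auto
  moreover have "qpochhammer_inf (exp (\<zeta> n) * q) q * qpochhammer_inf (q / exp (\<zeta> n)) q * qpochhammer_inf q q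
      * (1 + (1 - exp (\<zeta> n)) * lerch_tail h (\<zeta> n) \<eta>) = c * Theta (exp (\<zeta> n + \<eta>)) q" for n
  proof -
    have "norm (exp (\<zeta> n)) < 1"
      using \<zeta>_range(2) by simp
    then have "1 - exp (\<zeta> n) \<noteq> 0"
      by (metis eq_iff_diff_eq_0 less_irrefl norm_one)
    \<comment> \<open>This factor \<open>1 - exp (\<zeta> n)\<close> multiplies
      \<open>1 / (1 - exp (\<zeta> n))\<close> to 1 and makes the tail contribution
      negligible.\<close>
    moreover have "Theta (exp (\<zeta> n)) q = (1 - exp (\<zeta> n))
        * (qpochhammer_inf (exp (\<zeta> n) * q) q * qpochhammer_inf (q / exp (\<zeta> n)) q * qpochhammer_inf q q)"
      unfolding Theta_def qpochhammer_inf_rec[OF q, of "exp (\<zeta> n)"] by (simp only: mult.assoc)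
    ultimately show ?thesis
      unfolding c[OF \<zeta>_range(1,2), symmetric] by (simp add: distrib_left)
  qed
  moreover have "(\<lambda>n. c * Theta (exp (\<zeta> n + \<eta>)) q) \<longlonglongrightarrow> c * Theta (exp (0 + \<eta>)) q"
  proof (rule tendsto_mult_left, rule continuous_on_tendsto_compose[OF continuous_on_theta[OF q]])
    show "(\<lambda>n. exp (\<zeta> n + \<eta>)) \<longlonglongrightarrow> exp (0 + \<eta>)"
      by (intro tendsto_intros \<zeta>)
  qed auto
  ultimately have c_eq: "c * Theta (exp \<eta>) q = qpochhammer_inf q q ^ 3"
    using LIMSEQ_unique by (fastforce simp: power3_eq_cube)
  \<comment> \<open>The open annulus contains no power of \<open>q\<close>, so theta has no zero
    there.\<close>
  have "exp (\<xi> + of_int k * h) \<noteq> 1" for k :: int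
  proof
    assume "exp (\<xi> + of_int k * h) = 1"
    then have "norm (exp (\<xi> + of_int k * h)) = 1"
      by simp
    then have *: "Re \<xi> + of_int k * Re h = 0"
      by simp
    show False
    proof (cases "k \<ge> 0")
      case True
      then show False
        using * \<xi> h mult_nonneg_nonpos[of "of_int k" "Re h"] by simp
    next
      case False
      then have "of_int k * Re h \<ge> - 1 * Re h"
        using h by (intro mult_right_mono_neg) auto
      then show False
        using * \<xi> by simp
    qed
  qed
  then have "Theta (exp \<xi>) q \<noteq> 0"
    unfolding q_def by (rule theta_nonzero[OF h])
  moreover have "Theta (exp \<eta>) q \<noteq> 0"
    unfolding q_def using \<eta> by (intro theta_nonzero[OF h]) (simp add: add.commute)
  ultimately show ?thesis
    using c[OF \<xi>] by (simp add: c_eq[symmetric] field_simps flip: q_def)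
qed

text \<open>Translating \<open>\<xi>\<close> by a multiple of \<open>h\<close> brings it into the
  annulus; there the denominators of the Lerch series are expanded geometrically, and
  quasi-periodicity undoes the translation in the value.\<close>

theorem kronecker_double_series:
  fixes h \<xi> \<eta> :: complex
  assumes h: "Re h < 0" and \<xi>: "\<And>k::int. of_int k * Re h + Re \<xi> \<noteq> 0"
    and \<eta>: "\<And>k::int. of_int k * Re h + Re \<eta> \<noteq> 0"
  shows "((\<lambda>(k::int, l::int). hsign (of_int l * Re h + Re \<xi> < 0) (of_int k * Re h + Re \<eta> < 0)
        * exp (of_int (k * l) * h + of_int k * \<xi> + of_int l * \<eta>))
      has_sum (qpochhammer_inf (exp h) (exp h) ^ 3
        * Theta (exp (\<xi> + \<eta>)) (exp h) / (Theta (exp \<xi>) (exp h) * Theta (exp \<eta>) (exp h)))) (UNIV \<times> UNIV)"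
proof -
  \<comment> \<open>The least \<open>l\<close> with \<open>l * Re h + Re \<xi> < 0\<close>, hence
    also the starting exponent of the geometric expansions.\<close>
  define m where "m = \<lfloor>Re \<xi> / - Re h\<rfloor> + 1"
  have m: "of_int l * Re h + Re \<xi> < 0 \<longleftrightarrow> l \<ge> m" for l :: int
  proof -
    have "l \<ge> m \<longleftrightarrow> Re \<xi> / - Re h < of_int l"
      unfolding m_def floor_less_iff[symmetric] by linarith
    also have "\<dots> \<longleftrightarrow> of_int l * Re h + Re \<xi> < 0"
      using h by (auto simp: field_simps)
    finally show ?thesis ..
  qed
  define \<zeta> where "\<zeta> = \<xi> + of_int m * h"
  have "\<not> of_int (m - 1) * Re h + Re \<xi> < 0"
    unfolding m by simp
  then have \<zeta>: "Re h < Re \<zeta>" "Re \<zeta> < 0"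
    using m[of m] \<xi>[of "m - 1"] by (auto simp: \<zeta>_def algebra_simps)
  define w where "w k = exp (of_int k * h + \<eta>)" for k :: int
  have norm_w: "norm (w k) = exp (of_int k * Re h + Re \<eta>)" for k
    by (simp add: w_def)
  have norm_w_1: "norm (w k) \<noteq> 1" for k
    using \<eta>[of k] by (simp add: norm_w)
  have w: "exp (of_int k * h + \<eta>) \<noteq> 1" for k :: int
    using norm_w_1[of k] unfolding w_def by (metis norm_one)
  have powi: "w k powi n = exp (of_int n * (of_int k * h + \<eta>))" for k n
    by (simp add: w_def exp_power_int)
  have "((\<lambda>(k, l::int). exp (of_int k * \<xi>) * (hsign (l \<ge> m) (norm (w k) < 1) * w k powi l))
      has_sum (exp (of_int m * \<eta>) * (1 / (1 - exp \<zeta>) + lerch_tail h \<zeta> \<eta>))) (UNIV \<times> UNIV)"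
  proof (rule has_sum_iterated_geometric)
    show "w k \<noteq> 0" for k
      by (simp add: w_def)
    \<comment> \<open>The series of norms is governed by the same Lerch series with all parameters
      replaced by their real parts.\<close>
    have "(\<lambda>k::int. norm (exp (of_int k * of_real (Re \<zeta>)) / (1 - exp (of_int k * of_real (Re h) + of_real (Re \<eta>)) :: complex)))
        summable_on UNIV"
    proof (subst summable_on_iff_abs_summable_on_complex[symmetric], rule has_sum_imp_summable, rule lerch_has_sum)
      show "exp (of_int k * of_real (Re h) + of_real (Re \<eta>)) \<noteq> (1 :: complex)" for k
      proof
        assume "exp (of_int k * of_real (Re h) + of_real (Re \<eta>)) = (1 :: complex)"
        then have "norm (exp (of_int k * of_real (Re h) + of_real (Re \<eta>)) :: complex) = 1"
          by simp
        then show False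
          using norm_w_1[of k] by (simp add: norm_w)
      qed
    qed (use h \<zeta> in auto)
    then have "(\<lambda>k::int. exp (of_int m * Re \<eta>) * norm (exp (of_int k * of_real (Re \<zeta>)) / (1 - exp (of_int k * of_real (Re h) + of_real (Re \<eta>)) :: complex)))
        summable_on UNIV"
      by (rule summable_on_cmult_right)
    moreover have "exp (of_int m * Re \<eta>) * norm (exp (of_int k * of_real (Re \<zeta>)) / (1 - exp (of_int k * of_real (Re h) + of_real (Re \<eta>)) :: complex))
        = norm (exp (of_int k * \<xi>)) * (norm (w k) powi m / \<bar>1 - norm (w k)\<bar>)" for k :: int
    proof -
      have "(1 - exp (of_int k * of_real (Re h) + of_real (Re \<eta>)) :: complex) = of_real (1 - norm (w k))"
        by (simp add: norm_w exp_of_real[symmetric])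
      then have "norm (1 - exp (of_int k * of_real (Re h) + of_real (Re \<eta>)) :: complex) = \<bar>1 - norm (w k)\<bar>"
        by (simp only: norm_of_real)
      moreover have "exp (of_int m * Re \<eta>) * exp (of_int k * Re \<zeta>) = exp (of_int k * Re \<xi>) * norm (w k) powi m"
        unfolding norm_w exp_power_int \<zeta>_def
        by (simp only: exp_add[symmetric], rule arg_cong[where f = exp]) (simp add: algebra_simps)
      ultimately show ?thesis
        by (simp add: norm_divide)
    qed
    ultimately show "(\<lambda>k. norm (exp (of_int k * \<xi>)) * (norm (w k) powi m / \<bar>1 - norm (w k)\<bar>)) summable_on UNIV"
      by (simp only:)
    have "((\<lambda>k. exp (of_int m * \<eta>) * (exp (of_int k * \<zeta>) / (1 - exp (of_int k * h + \<eta>))))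
        has_sum (exp (of_int m * \<eta>) * (1 / (1 - exp \<zeta>) + lerch_tail h \<zeta> \<eta>))) UNIV"
      by (intro has_sum_cmult_right lerch_has_sum h \<zeta> w)
    moreover have "exp (of_int m * \<eta>) * (exp (of_int k * \<zeta>) / (1 - exp (of_int k * h + \<eta>)))
        = exp (of_int k * \<xi>) * (w k powi m / (1 - w k))" for k :: int
    proof -
      have "exp (of_int m * \<eta>) * exp (of_int k * \<zeta>) = exp (of_int k * \<xi>) * w k powi m"
        unfolding powi \<zeta>_def
        by (simp only: exp_add[symmetric], rule arg_cong[where f = exp]) (simp add: algebra_simps)
      then show ?thesis
        by (simp add: w_def)
    qed
    ultimately show "((\<lambda>k. exp (of_int k * \<xi>) * (w k powi m / (1 - w k)))
        has_sum (exp (of_int m * \<eta>) * (1 / (1 - exp \<zeta>) + lerch_tail h \<zeta> \<eta>))) UNIV"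
      by (simp only:)
  qed (use norm_w_1 in auto)
  moreover have "exp (of_int k * \<xi>) * (hsign (l \<ge> m) (norm (w k) < 1) * w k powi l)
      = hsign (of_int l * Re h + Re \<xi> < 0) (of_int k * Re h + Re \<eta> < 0)
        * exp (of_int (k * l) * h + of_int k * \<xi> + of_int l * \<eta>)" for k l
    unfolding powi norm_w m exp_less_one_iff by (simp add: algebra_simps exp_add)
  moreover have "exp (of_int m * \<eta>) * (1 / (1 - exp \<zeta>) + lerch_tail h \<zeta> \<eta>) = qpochhammer_inf (exp h) (exp h) ^ 3
        * Theta (exp (\<xi> + \<eta>)) (exp h) / (Theta (exp \<xi>) (exp h) * Theta (exp \<eta>) (exp h))"
  proof -
    define E where "E \<xi> = exp (- h * (of_int m * (of_int m - 1) / 2) - of_int m * (\<xi> + \<i> * of_real pi))" for \<xi>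
    have "Theta (exp \<zeta>) (exp h) = E \<xi> * Theta (exp \<xi>) (exp h)"
      unfolding \<zeta>_def E_def by (rule theta_quasi_periodic[OF h])
    moreover have "Theta (exp (\<zeta> + \<eta>)) (exp h) = E (\<xi> + \<eta>) * Theta (exp (\<xi> + \<eta>)) (exp h)"
      unfolding E_def using theta_quasi_periodic[OF h, of "\<xi> + \<eta>" m] by (simp add: \<zeta>_def add_ac)
    \<comment> \<open>The prefactor from the geometric expansions exactly balances the different
      quasi-period factors of numerator and denominator.\<close>
    moreover have "exp (of_int m * \<eta>) * E (\<xi> + \<eta>) = E \<xi>"
      unfolding E_def by (simp only: exp_add[symmetric], rule arg_cong[where f = exp]) (simp add: algebra_simps)
    moreover have "E \<xi> \<noteq> 0"
      by (simp add: E_def)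
    moreover have "A * (K * (E' * T) / (E * T1 * T2)) = (A * E') * (K * T / (E * T1 * T2))" for A K E' T E T1 T2 :: complex
      by simp
    ultimately show ?thesis
      unfolding theta_times_lerch_value[OF h \<zeta> w] by (simp only:) simp
  qed
  ultimately show ?thesis
    by (simp only:)
qed

subsection \<open>The Appell function\<close>

text \<open>The half-base shift of the argument cancels the linear term of
  \<open>n * (n - 1) / 2\<close>, leaving a pure Gaussian.\<close>

lemma gauss_theta_has_sum:
  fixes A :: int
  assumes "Re h < 0" "A > 0"
  shows "((\<lambda>n::int. exp (h * (of_int A * of_int n ^ 2 / 2) + of_int n * \<zeta>))
    has_sum Theta (- exp (\<zeta> + h * of_int A / 2)) (exp (h * of_int A))) UNIV"
proof -
  have "Re (h * of_int A) < 0"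
    using assms by (simp add: mult_neg_pos)
  note jacobi_triple_product[OF this, of "\<zeta> + h * of_int A / 2"]
  moreover have "h * of_int A * (of_int n * (of_int n - 1) / 2) + of_int n * (\<zeta> + h * of_int A / 2)
      = h * (of_int A * of_int n ^ 2 / 2) + of_int n * \<zeta>" for n :: int
    by (simp add: field_simps power2_eq_square)
  ultimately show ?thesis
    by (simp only:)
qed

lemma of_int_gauss: "of_int (r * (r - 1) div 2) = (of_int r * (of_int r - 1) / 2 :: complex)"
proof -
  have "2 dvd r * (r - 1)"
    by simp
  then obtain m where m: "r * (r - 1) = 2 * m" ..
  have "of_int r * (of_int r - 1) = (of_int (r * (r - 1)) :: complex)"
    by simp
  then show ?thesis
    unfolding m by simp
qed

text \<open>With both arguments negated, the sign \<open>(-1)^r\<close> disappears from the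
  numerator and the two minus signs cancel in the denominator.\<close>

lemma appell_m_exp:
  "appell_m (- exp \<alpha>) (- exp (\<zeta> + h * of_int A / 2)) (exp (h * of_int A))
    = 1 / Theta (- exp (\<zeta> + h * of_int A / 2)) (exp (h * of_int A))
      * (\<Sum>\<^sub>\<infinity>r::int. exp (h * (of_int A * of_int r ^ 2 / 2) + of_int r * \<zeta>)
          / (1 - exp (\<alpha> + \<zeta> + h * of_int A * (of_int r - 1 / 2))))"
proof -
  define \<beta> where "\<beta> = \<zeta> + h * of_int A / 2"
  have "(- 1) powi r * exp (h * of_int A) powi (r * (r - 1) div 2) * (- exp \<beta>) powi r
        / (1 - exp (h * of_int A) powi (r - 1) * (- exp \<alpha>) * (- exp \<beta>))
      = exp (h * (of_int A * of_int r ^ 2 / 2) + of_int r * \<zeta>)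
          / (1 - exp (\<alpha> + \<zeta> + h * of_int A * (of_int r - 1 / 2)))" for r
  proof -
    have "(- 1) powi r * (- exp \<beta>) powi r = exp (of_int r * \<beta>)"
      by (simp flip: power_int_mult_distrib exp_power_int)
    then have "(- 1) powi r * exp (h * of_int A) powi (r * (r - 1) div 2) * (- exp \<beta>) powi r
        = exp (of_int r * \<beta>) * exp (h * of_int A) powi (r * (r - 1) div 2)"
      by (simp add: mult_ac)
    also have "\<dots> = exp (h * (of_int A * of_int r ^ 2 / 2) + of_int r * \<zeta>)"
      unfolding exp_power_int of_int_gauss \<beta>_def
      by (simp only: exp_add[symmetric], rule arg_cong[where f = exp]) (simp add: field_simps power2_eq_square)
    finally have 1: "(- 1) powi r * exp (h * of_int A) powi (r * (r - 1) div 2) * (- exp \<beta>) powi r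
        = exp (h * (of_int A * of_int r ^ 2 / 2) + of_int r * \<zeta>)" .
    have 2: "exp (h * of_int A) powi (r - 1) * (- exp \<alpha>) * (- exp \<beta>)
        = exp (\<alpha> + \<zeta> + h * of_int A * (of_int r - 1 / 2))"
      unfolding exp_power_int \<beta>_def
      by (simp only: minus_mult_minus mult_minus_right mult_minus_left minus_minus exp_add[symmetric],
          rule arg_cong[where f = exp]) (simp add: field_simps)
    show ?thesis
      unfolding 1 2 ..
  qed
  then show ?thesis
    unfolding appell_m_def \<beta>_def by (simp only:)
qed

lemma summable_on_gauss_norm:
  assumes "Re h < 0" "A > (0::int)"
  shows "(\<lambda>n::int. norm (exp (h * (of_int A * of_int n ^ 2 / 2) + of_int n * \<zeta>))) summable_on UNIV"
  using gauss_theta_has_sum[OF assms, of \<zeta>]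
  by (simp only: has_sum_imp_summable flip: summable_on_iff_abs_summable_on_complex)

subsection \<open>Appell sums as sign-weighted series\<close>

definition qform :: "int \<Rightarrow> int \<Rightarrow> int \<Rightarrow> int \<Rightarrow> int \<Rightarrow> complex" where
  "qform a b c r s = of_int a * of_int r ^ 2 / 2 + of_int b * of_int r * of_int s + of_int c * of_int s ^ 2 / 2"

lemma qform_commute: "qform a b c r s = qform c b a s r"
  by (simp add: qform_def algebra_simps)

text \<open>The Appell function with its theta denominator cleared. The argument \<open>X\<close> is
  the logarithm of the full product in the denominator, so a perturbation of the second variable
  acts on \<open>X\<close> and \<open>\<xi>\<^sub>2\<close> by the same shift.\<close>

definition appell_sum :: "complex \<Rightarrow> int \<Rightarrow> int \<Rightarrow> complex \<Rightarrow> complex \<Rightarrow> int \<Rightarrow> complex" where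
  "appell_sum h c D X \<xi>\<^sub>2 t = (\<Sum>\<^sub>\<infinity>r::int. exp (h * (of_int (c * D) * of_int r ^ 2 / 2) + of_int r * \<xi>\<^sub>2)
    / (1 - exp (of_int (D * (c * r - t)) * h + X)))"

text \<open>Gaussian numerators times uniformly bounded reciprocals.\<close>

lemma appell_summand_has_sum:
  assumes h: "Re h < 0" and c: "c > 0" and D: "D > 0"
    and X: "\<And>k::int. exp (of_int (D * k) * h + X) \<noteq> 1"
  shows "((\<lambda>r::int. exp (h * (of_int (c * D) * of_int r ^ 2 / 2) + of_int r * \<xi>\<^sub>2)
    / (1 - exp (of_int (D * (c * r - t)) * h + X))) has_sum appell_sum h c D X \<xi>\<^sub>2 t) UNIV"
proof -
  have "Re (of_int (c * D) * h) < 0"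
    using h c D by (simp add: mult_pos_neg)
  moreover have exponent: "of_int (D * (c * r - t)) * h + X = of_int r * (of_int (c * D) * h) + (X - of_int (D * t) * h)" for r
    by (simp add: algebra_simps)
  then have "exp (of_int r * (of_int (c * D) * h) + (X - of_int (D * t) * h)) \<noteq> 1" for r :: int
    using X[of "c * r - t"] by (simp only:) simp
  ultimately obtain M where M: "\<And>r::int. norm (1 / (1 - exp (of_int (D * (c * r - t)) * h + X))) \<le> M"
    unfolding exponent by (rule bounded_inverse_one_minus_exp) blast
  have "(\<lambda>r::int. norm (exp (h * (of_int (c * D) * of_int r ^ 2 / 2) + of_int r * \<xi>\<^sub>2)
    / (1 - exp (of_int (D * (c * r - t)) * h + X)))) summable_on UNIV"
  proof (rule Infinite_Sum.abs_summable_on_comparison_test')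
    show "(\<lambda>r::int. norm (exp (h * (of_int (c * D) * of_int r ^ 2 / 2) + of_int r * \<xi>\<^sub>2)) * M) summable_on UNIV"
      using c D by (intro summable_on_cmult_left summable_on_gauss_norm h) simp
    fix r :: int
    show "norm (exp (h * (of_int (c * D) * of_int r ^ 2 / 2) + of_int r * \<xi>\<^sub>2)
        / (1 - exp (of_int (D * (c * r - t)) * h + X)))
      \<le> norm (exp (h * (of_int (c * D) * of_int r ^ 2 / 2) + of_int r * \<xi>\<^sub>2)) * M"
      (is "norm (?x / _) \<le> _")
      using mult_left_mono[OF M[of r] norm_ge_zero[of ?x]]
      by (simp only: norm_divide norm_one times_divide_eq_right mult_1_right)
  qed
  then show ?thesis
    unfolding appell_sum_def by (rule has_sum_infsum[OF abs_summable_summable])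
qed

lemma has_sum_finite_Times:
  fixes f :: "'a \<times> 'b \<Rightarrow> complex"
  assumes "finite T" "\<And>t. t \<in> T \<Longrightarrow> ((\<lambda>y. f (t, y)) has_sum g t) B"
  shows "(f has_sum sum g T) (T \<times> B)"
proof -
  have "(f has_sum sum g T) (\<Union>t\<in>T. {t} \<times> B)"
  proof (rule sum_has_sum[OF assms(1)])
    fix t assume t: "t \<in> T"
    have "((\<lambda>y. f (t, y)) has_sum g t) B \<longleftrightarrow> (f has_sum g t) ({t} \<times> B)"
      by (rule has_sum_reindex_bij_witness[of _ snd "Pair t"]) auto
    then show "(f has_sum g t) ({t} \<times> B)"
      using assms(2)[OF t] by simp
  qed auto
  moreover have "(\<Union>t\<in>T. {t} \<times> B) = T \<times> B"
    by auto
  ultimately show ?thesis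
    by simp
qed

text \<open>The theta series in \<open>n\<close>, the Appell sum in \<open>r\<close> and the
  geometric expansion in \<open>k\<close> combine into one series via
  \<open>r\<^sub>1 = t + c * k\<close>, \<open>s\<^sub>1 = n - b * k\<close>,
  \<open>r\<^sub>2 = r + k\<close>. The sum over \<open>t\<close> makes every
  \<open>r\<^sub>1\<close> occur exactly once.\<close>

lemma appell_half_has_sum:
  fixes a b c D :: int
  assumes h: "Re h < 0" and c: "c > 0" and D: "D > 0" "D = b\<^sup>2 - a * c"
    and X: "X = of_int c * \<xi>\<^sub>1 - of_int b * \<eta>\<^sub>1 + \<xi>\<^sub>2"
    and generic: "\<And>k::int. of_int (D * k) * Re h + Re X \<noteq> 0"
  shows "((\<lambda>(r\<^sub>1, s\<^sub>1, r\<^sub>2). hsign (r\<^sub>1 \<ge> 0) (of_int (D * (c * r\<^sub>2 - r\<^sub>1)) * Re h + Re X < 0)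
        * exp (h * (qform a b c r\<^sub>1 s\<^sub>1 + of_int (c * D) * of_int r\<^sub>2 ^ 2 / 2)
            + of_int r\<^sub>1 * \<xi>\<^sub>1 + of_int s\<^sub>1 * \<eta>\<^sub>1 + of_int r\<^sub>2 * \<xi>\<^sub>2))
      has_sum (\<Sum>t\<in>{0..c - 1}. exp (of_int t * \<xi>\<^sub>1 + h * (of_int a * of_int t ^ 2 / 2))
        * Theta (- exp (\<eta>\<^sub>1 + h * of_int (b * t) + h * of_int c / 2)) (exp (h * of_int c))
        * appell_sum h c D X \<xi>\<^sub>2 t)) UNIV"
proof -
  define w where "w t r = exp (of_int (D * (c * r - t)) * h + X)" for t r :: int
  define g where "g r = exp (h * (of_int (c * D) * of_int r ^ 2 / 2) + of_int r * \<xi>\<^sub>2)" for r :: int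
  define e where "e t = exp (of_int t * \<xi>\<^sub>1 + h * (of_int a * of_int t ^ 2 / 2))" for t :: int
  define \<theta> where "\<theta> t n = exp (h * (of_int c * of_int n ^ 2 / 2) + of_int n * (\<eta>\<^sub>1 + h * of_int (b * t)))"
    for t n :: int
  have norm_w: "norm (w t r) = exp (of_int (D * (c * r - t)) * Re h + Re X)" for t r
    by (simp add: w_def)
  then have norm_w_1: "norm (w t r) \<noteq> 1" for t r
    using generic[of "c * r - t"] by (simp only: exp_eq_one_iff not_False_eq_True)
  have w: "exp (of_int (D * k) * h + X) \<noteq> 1" for k :: int
  proof
    assume "exp (of_int (D * k) * h + X) = 1"
    then have "norm (exp (of_int (D * k) * h + X)) = 1"
      by simp
    then show False
      using generic[of k] by simp
  qed
  have double: "((\<lambda>(r, k::int). g r * (hsign (k \<ge> 0) (norm (w t r) < 1) * w t r powi k))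
      has_sum appell_sum h c D X \<xi>\<^sub>2 t) (UNIV \<times> UNIV)" for t
  proof (rule has_sum_iterated_geometric)
    show "((\<lambda>r. g r * (w t r powi 0 / (1 - w t r))) has_sum appell_sum h c D X \<xi>\<^sub>2 t) UNIV"
      using appell_summand_has_sum[OF h c D(1) w] by (simp add: w_def g_def)
    \<comment> \<open>As in the Kronecker series, absolute convergence is the same statement for the
      real parts of the parameters.\<close>
    have "((\<lambda>r::int. exp (of_real (Re h) * (of_int (c * D) * of_int r ^ 2 / 2) + of_int r * of_real (Re \<xi>\<^sub>2))
        / (1 - exp (of_int (D * (c * r - t)) * of_real (Re h) + of_real (Re X))))
      has_sum appell_sum (of_real (Re h)) c D (of_real (Re X)) (of_real (Re \<xi>\<^sub>2)) t) UNIV"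
    proof (rule appell_summand_has_sum)
      show "exp (of_int (D * k) * of_real (Re h) + of_real (Re X)) \<noteq> (1 :: complex)" for k :: int
      proof
        assume "exp (of_int (D * k) * of_real (Re h) + of_real (Re X)) = (1 :: complex)"
        then have "norm (exp (of_int (D * k) * of_real (Re h) + of_real (Re X) :: complex)) = 1"
          by (simp only: norm_one)
        then show False
          using generic[of k] by simp
      qed
    qed (use h c D in auto)
    then have "(\<lambda>r::int. norm (exp (of_real (Re h) * (of_int (c * D) * of_int r ^ 2 / 2) + of_int r * of_real (Re \<xi>\<^sub>2))
        / (1 - exp (of_int (D * (c * r - t)) * of_real (Re h) + of_real (Re X)) :: complex))) summable_on UNIV"
      by (simp only: has_sum_imp_summable flip: summable_on_iff_abs_summable_on_complex)
    moreover have "norm (exp (of_real (Re h) * (of_int (c * D) * of_int r ^ 2 / 2) + of_int r * of_real (Re \<xi>\<^sub>2))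
        / (1 - exp (of_int (D * (c * r - t)) * of_real (Re h) + of_real (Re X)) :: complex))
        = norm (g r) * (norm (w t r) powi 0 / \<bar>1 - norm (w t r)\<bar>)" for r :: int
    proof -
      have "(1 - exp (of_int (D * (c * r - t)) * of_real (Re h) + of_real (Re X)) :: complex) = of_real (1 - norm (w t r))"
        by (simp add: norm_w exp_of_real[symmetric])
      then have 1: "norm (1 - exp (of_int (D * (c * r - t)) * of_real (Re h) + of_real (Re X)) :: complex) = \<bar>1 - norm (w t r)\<bar>"
        by (simp only: norm_of_real)
      have 2: "norm (exp (of_real (Re h) * (of_int (c * D) * of_int r ^ 2 / 2) + of_int r * of_real (Re \<xi>\<^sub>2)) :: complex) = norm (g r)"
        by (simp add: g_def flip: of_int_power)
      show ?thesis
        unfolding norm_divide 1 2 by simp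
    qed
    ultimately show "(\<lambda>r. norm (g r) * (norm (w t r) powi 0 / \<bar>1 - norm (w t r)\<bar>)) summable_on UNIV"
      by (simp only:)
  qed (use norm_w_1 in \<open>auto simp: w_def\<close>)
  define f where "f t n r k = e t * (\<theta> t n * (g r * (hsign (k \<ge> 0) (norm (w t r) < 1) * w t r powi k)))" for t n r k
  have "((\<lambda>(t, n, r, k). f t n r k) has_sum (\<Sum>t\<in>{0..c - 1}. e t *
      (Theta (- exp (\<eta>\<^sub>1 + h * of_int (b * t) + h * of_int c / 2)) (exp (h * of_int c)) * appell_sum h c D X \<xi>\<^sub>2 t)))
      ({0..c - 1} \<times> (UNIV \<times> (UNIV \<times> UNIV)))"
  proof (rule has_sum_finite_Times)
    fix t
    have "((\<lambda>(n, rk). \<theta> t n * (case rk of (r, k) \<Rightarrow> g r * (hsign (k \<ge> 0) (norm (w t r) < 1) * w t r powi k)))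
      has_sum (Theta (- exp (\<eta>\<^sub>1 + h * of_int (b * t) + h * of_int c / 2)) (exp (h * of_int c)) * appell_sum h c D X \<xi>\<^sub>2 t))
      (UNIV \<times> (UNIV \<times> UNIV))"
      unfolding \<theta>_def by (intro has_sum_mult_complex gauss_theta_has_sum h c double)
    from has_sum_cmult_right[OF this, of "e t"]
    show "((\<lambda>y. case (t, y) of (t, n, r, k) \<Rightarrow> f t n r k) has_sum e t *
      (Theta (- exp (\<eta>\<^sub>1 + h * of_int (b * t) + h * of_int c / 2)) (exp (h * of_int c)) * appell_sum h c D X \<xi>\<^sub>2 t))
      (UNIV \<times> (UNIV \<times> UNIV))"
      by (simp add: f_def case_prod_unfold)
  qed simp
  also have "?this \<longleftrightarrow> ?thesis"
  \<comment> \<open>Division with remainder by \<open>c\<close>: \<open>t\<close> is the residue of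
    \<open>r\<^sub>1\<close> and \<open>k\<close> its quotient.\<close>
  proof (rule has_sum_reindex_bij_witness[where j = "\<lambda>(t, n, r, k). (t + c * k, n - b * k, r + k)"
        and i = "\<lambda>(r\<^sub>1, s\<^sub>1, r\<^sub>2). (r\<^sub>1 mod c, s\<^sub>1 + b * (r\<^sub>1 div c), r\<^sub>2 - r\<^sub>1 div c, r\<^sub>1 div c)"], goal_cases)
    case (5 x)
    obtain t n r k where x: "x = (t, n, r, k)"
      by (metis prod.exhaust)
    have t: "0 \<le> t" "t < c"
      using 5 x by auto
    \<comment> \<open>The geometric expansions start at exponent 0, so their first sign is that of
      \<open>r\<^sub>1\<close>.\<close>
    have "t + c * k \<ge> 0 \<longleftrightarrow> k \<ge> 0"
    proof -
      have "(t + c * k) div c = k"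
        using t by simp
      then show ?thesis
        using pos_imp_zdiv_nonneg_iff[OF c, of "t + c * k"] by simp
    qed
    moreover have "c * (r + k) - (t + c * k) = c * r - t"
      by (simp add: algebra_simps)
    ultimately have 1: "hsign (t + c * k \<ge> 0) (of_int (D * (c * (r + k) - (t + c * k))) * Re h + Re X < 0)
        = (hsign (k \<ge> 0) (norm (w t r) < 1) :: complex)"
      by (simp only: norm_w exp_less_one_iff)
    \<comment> \<open>Along the direction \<open>(c, - b)\<close> the form takes the value
      \<open>- c * D * k^2 / 2\<close>. The Gaussian in \<open>r\<^sub>2\<close> cancels it, so the
      exponent becomes linear in \<open>k\<close>.\<close>
    have 2: "exp (h * (qform a b c (t + c * k) (n - b * k) + of_int (c * D) * of_int (r + k) ^ 2 / 2)
            + of_int (t + c * k) * \<xi>\<^sub>1 + of_int (n - b * k) * \<eta>\<^sub>1 + of_int (r + k) * \<xi>\<^sub>2)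
        = e t * (\<theta> t n * (g r * (w t r powi k)))"
      unfolding e_def \<theta>_def g_def w_def exp_power_int qform_def X D(2)
      by (simp only: exp_add[symmetric], rule arg_cong[where f = exp]) (simp add: field_simps power2_eq_square)
    show ?case
      unfolding x f_def prod.case 1 2 by (simp only: mult_ac)
  next
    case 6
    then show ?case
      by (simp add: e_def mult.assoc)
  qed (use c in auto)
  finally show ?thesis .
qed

subsection \<open>The identity for generic moduli\<close>

text \<open>The weight vanishes unless \<open>r * s \<ge> 0\<close>, and there the mixed factor has
  modulus at most 1; a product of two definite theta series is thus a majorant.\<close>

lemma summable_on_indefinite_theta:
  fixes a b c :: int
  assumes h: "Re h < 0" and abc: "a > 0" "b > 0" "c > 0"
  shows "(\<lambda>(r, s). hsign (r \<ge> 0) (s \<ge> 0) * exp (h * qform a b c r s + of_int r * \<xi> + of_int s * \<eta>))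
    summable_on (UNIV :: (int \<times> int) set)"
proof -
  define G where "G a \<xi> n = exp (h * (of_int a * of_int n ^ 2 / 2) + of_int n * \<xi>)" for a n :: int and \<xi>
  have "((\<lambda>(r, s). G a \<xi> r * G c \<eta> s) has_sum
      (Theta (- exp (\<xi> + h * of_int a / 2)) (exp (h * of_int a)) * Theta (- exp (\<eta> + h * of_int c / 2)) (exp (h * of_int c))))
      (UNIV \<times> UNIV)"
    unfolding G_def by (intro has_sum_mult_complex gauss_theta_has_sum h abc)
  then have "(\<lambda>x. norm (case x of (r, s) \<Rightarrow> G a \<xi> r * G c \<eta> s)) summable_on UNIV"
    by (simp only: has_sum_imp_summable UNIV_Times_UNIV flip: summable_on_iff_abs_summable_on_complex)
  then have "(\<lambda>x. norm (case x of (r, s) \<Rightarrow> hsign (r \<ge> 0) (s \<ge> 0)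
      * exp (h * qform a b c r s + of_int r * \<xi> + of_int s * \<eta>))) summable_on UNIV"
  proof (rule Infinite_Sum.abs_summable_on_comparison_test')
    fix x :: "int \<times> int"
    obtain r s where x: "x = (r, s)" by fastforce
    show "norm (case x of (r, s) \<Rightarrow> hsign (r \<ge> 0) (s \<ge> 0) * exp (h * qform a b c r s + of_int r * \<xi> + of_int s * \<eta>))
        \<le> norm (case x of (r, s) \<Rightarrow> G a \<xi> r * G c \<eta> s)"
    proof (cases "r \<ge> 0 \<longleftrightarrow> s \<ge> 0")
      case True
      then have "r * s \<ge> 0"
        by (auto simp: zero_le_mult_iff)
      then have "b * (r * s) \<ge> 0"
        using abc by simp
      then have "Re (h * of_int (b * (r * s))) \<le> 0"
        using h by (simp add: mult_nonpos_nonneg flip: of_int_mult)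
      then have "norm (exp (h * of_int (b * (r * s)))) \<le> 1"
        by (simp only: norm_exp_eq_Re exp_le_one_iff)
      moreover have "exp (h * qform a b c r s + of_int r * \<xi> + of_int s * \<eta>) = G a \<xi> r * G c \<eta> s * exp (h * of_int (b * (r * s)))"
        unfolding G_def qform_def
        by (simp only: exp_add[symmetric], rule arg_cong[where f = exp]) (simp add: algebra_simps)
      ultimately have "norm (exp (h * qform a b c r s + of_int r * \<xi> + of_int s * \<eta>)) \<le> norm (G a \<xi> r * G c \<eta> s)"
        by (simp only: norm_mult mult_left_le norm_ge_zero mult_nonneg_nonneg)
      then show ?thesis
        using True by (simp add: x hsign_def)
    qed (auto simp: x hsign_def)
  qed
  then show ?thesis
    by (simp only: summable_on_iff_abs_summable_on_complex)
qed

section \<open>Residue systems and the decomposition into parts\<close>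

lemma complete_residue_system_finite:
  assumes "complete_residue_system m U" "m > 0"
  shows "finite U"
proof (rule finite_imageD)
  show "finite ((\<lambda>u. u mod m) ` U)"
    by (rule finite_subset[of _ "{0..<m}"]) (use assms(2) in auto)
  show "inj_on (\<lambda>u. u mod m) U"
    using assms(1) unfolding complete_residue_system_def inj_on_def cong_def by metis
qed

text \<open>Extracts the map that sends an integer to its representative; it is needed to invert the
  reindexing modulo \<open>b\<close>.\<close>

lemma complete_residue_systemE:
  assumes "complete_residue_system m U"
  obtains \<rho> where "\<And>n. \<rho> n \<in> U" "\<And>n. m dvd \<rho> n - n" "\<And>u n. u \<in> U \<Longrightarrow> m dvd u - n \<Longrightarrow> \<rho> n = u"
proof -
  have ex: "\<exists>!u. u \<in> U \<and> m dvd u - n" for n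
    using assms by (simp add: complete_residue_system_def cong_iff_dvd_diff)
  define \<rho> where "\<rho> n = (THE u. u \<in> U \<and> m dvd u - n)" for n
  have "\<rho> n \<in> U \<and> m dvd \<rho> n - n" for n
    unfolding \<rho>_def by (rule theI'[OF ex])
  moreover from this have "\<rho> n = u" if "u \<in> U" "m dvd u - n" for u n
    using ex[of n] that by blast
  ultimately show ?thesis
    using that by blast
qed

definition core_sum :: "complex \<Rightarrow> int \<Rightarrow> int \<Rightarrow> int \<Rightarrow> complex \<Rightarrow> complex \<Rightarrow> int \<Rightarrow> int \<Rightarrow> complex" where
  "core_sum h a b c \<xi> \<eta> u v = (\<Sum>\<^sub>\<infinity>(r, s)\<in>(UNIV :: (int \<times> int) set).
    exp (h * (of_int (b\<^sup>2 * c) * of_int r ^ 2 / 2 + of_int (a * b * c) * of_int r * of_int s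
      + of_int (a * b\<^sup>2) * of_int s ^ 2 / 2 + of_int (c * (a * u + b * v)) * of_int r
      + of_int (a * (b * u + c * v)) * of_int s) + of_int r * \<xi> + of_int s * \<eta>))"

definition kronecker_quotient :: "complex \<Rightarrow> complex \<Rightarrow> complex \<Rightarrow> complex" where
  "kronecker_quotient h \<xi> \<eta> = qpochhammer_inf (exp h) (exp h) ^ 3
        * Theta (exp (\<xi> + \<eta>)) (exp h) / (Theta (exp \<xi>) (exp h) * Theta (exp \<eta>) (exp h))"

text \<open>One Appell sum of the theorem, multiplied by its theta denominator. Exchanging the roles
  of \<open>a\<close>, \<open>\<xi>\<^sub>1\<close> with those of \<open>c\<close>,
  \<open>\<eta>\<^sub>1\<close> gives the other.\<close>

definition appell_part :: "complex \<Rightarrow> int \<Rightarrow> int \<Rightarrow> int \<Rightarrow> complex \<Rightarrow> complex \<Rightarrow> complex \<Rightarrow> complex \<Rightarrow> complex" where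
  "appell_part h a b c \<xi>\<^sub>1 \<eta>\<^sub>1 X \<xi>\<^sub>2 =
    (\<Sum>t\<in>{0..c - 1}. exp (of_int t * \<xi>\<^sub>1 + h * (of_int a * of_int t ^ 2 / 2))
        * Theta (- exp (\<eta>\<^sub>1 + h * of_int (b * t) + h * of_int c / 2)) (exp (h * of_int c))
        * appell_sum h c (b\<^sup>2 - a * c) X \<xi>\<^sub>2 t)"

definition core_part :: "complex \<Rightarrow> int \<Rightarrow> int \<Rightarrow> int \<Rightarrow> int set \<Rightarrow> int set
    \<Rightarrow> complex \<Rightarrow> complex \<Rightarrow> complex \<Rightarrow> complex \<Rightarrow> complex \<Rightarrow> complex \<Rightarrow> complex" where
  "core_part h a b c U V \<xi>\<^sub>1 \<eta>\<^sub>1 X Y \<xi>\<^sub>2 \<eta>\<^sub>2 =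
    (\<Sum>u\<in>U. \<Sum>v\<in>V. exp (h * qform a b c u v + of_int u * \<xi>\<^sub>1 + of_int v * \<eta>\<^sub>1)
        * core_sum h a b c (of_int c * \<xi>\<^sub>1 + \<xi>\<^sub>2) (of_int a * \<eta>\<^sub>1 + \<eta>\<^sub>2) u v
        * kronecker_quotient (h * of_int (b * (b\<^sup>2 - a * c)))
            (X - h * of_int ((b\<^sup>2 - a * c) * u)) (Y - h * of_int ((b\<^sup>2 - a * c) * v)))"

text \<open>All three series are brought to the common summand \<open>T\<close> on quadruples. The
  sign cocycle gives the series \<open>f\<close>, which a reindexing modulo \<open>b\<close> factors
  over residue pairs \<open>(u, v)\<close>.\<close>

lemma indefinite_theta_decomposition:
  fixes a b c D :: int
  assumes h: "Re h < 0" and abc: "a > 0" "b > 0" "c > 0" and D: "D = b\<^sup>2 - a * c" "D > 0"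
    and X: "X = of_int c * \<xi>\<^sub>1 - of_int b * \<eta>\<^sub>1 + \<xi>\<^sub>2"
    and Y: "Y = of_int a * \<eta>\<^sub>1 - of_int b * \<xi>\<^sub>1 + \<eta>\<^sub>2"
    and generic: "\<And>k::int. of_int (D * k) * Re h + Re X \<noteq> 0" "\<And>k::int. of_int (D * k) * Re h + Re Y \<noteq> 0"
    and residues: "complete_residue_system b U" "complete_residue_system b V"
  defines "\<theta> \<equiv> Theta (- exp (\<xi>\<^sub>2 + h * of_int (c * D) / 2)) (exp (h * of_int (c * D)))"
    and "\<phi> \<equiv> Theta (- exp (\<eta>\<^sub>2 + h * of_int (a * D) / 2)) (exp (h * of_int (a * D)))"
  shows "(\<Sum>\<^sub>\<infinity>(r, s)\<in>UNIV. hsign (r \<ge> 0) (s \<ge> 0) * exp (h * qform a b c r s + of_int r * \<xi>\<^sub>1 + of_int s * \<eta>\<^sub>1)) * (\<theta> * \<phi>)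
    = appell_part h a b c \<xi>\<^sub>1 \<eta>\<^sub>1 X \<xi>\<^sub>2 * \<phi> + appell_part h c b a \<eta>\<^sub>1 \<xi>\<^sub>1 Y \<eta>\<^sub>2 * \<theta>
      - core_part h a b c U V \<xi>\<^sub>1 \<eta>\<^sub>1 X Y \<xi>\<^sub>2 \<eta>\<^sub>2"
    (is "?S * _ = ?A * _ + ?B * _ - ?C")
proof -
  define g where "g r = exp (h * (of_int (c * D) * of_int r ^ 2 / 2) + of_int r * \<xi>\<^sub>2)" for r :: int
  define g' where "g' s = exp (h * (of_int (a * D) * of_int s ^ 2 / 2) + of_int s * \<eta>\<^sub>2)" for s :: int
  define P where "P r s = exp (h * qform a b c r s + of_int r * \<xi>\<^sub>1 + of_int s * \<eta>\<^sub>1)" for r s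
  define e\<^sub>3 where "e\<^sub>3 r\<^sub>1 r\<^sub>2 \<longleftrightarrow> of_int (D * (c * r\<^sub>2 - r\<^sub>1)) * Re h + Re X < 0" for r\<^sub>1 r\<^sub>2
  define e\<^sub>4 where "e\<^sub>4 s\<^sub>1 s\<^sub>2 \<longleftrightarrow> of_int (D * (a * s\<^sub>2 - s\<^sub>1)) * Re h + Re Y < 0" for s\<^sub>1 s\<^sub>2
  define T where "T r\<^sub>1 s\<^sub>1 r\<^sub>2 s\<^sub>2 = P r\<^sub>1 s\<^sub>1 * (g r\<^sub>2 * g' s\<^sub>2)" for r\<^sub>1 s\<^sub>1 r\<^sub>2 s\<^sub>2
  have g: "(g has_sum \<theta>) UNIV"
    unfolding g_def \<theta>_def using abc D by (intro gauss_theta_has_sum h) simp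
  have g': "(g' has_sum \<phi>) UNIV"
    unfolding g'_def \<phi>_def using abc D by (intro gauss_theta_has_sum h) simp
  have "((\<lambda>(r, s). hsign (r \<ge> 0) (s \<ge> 0) * P r s) has_sum ?S) UNIV"
    unfolding P_def using summable_on_indefinite_theta[OF h abc] by (rule has_sum_infsum)
  from has_sum_mult_complex[OF this has_sum_mult_complex[OF g g']]
  have S: "((\<lambda>(r\<^sub>1, s\<^sub>1, r\<^sub>2, s\<^sub>2). hsign (r\<^sub>1 \<ge> 0) (s\<^sub>1 \<ge> 0) * T r\<^sub>1 s\<^sub>1 r\<^sub>2 s\<^sub>2) has_sum (?S * (\<theta> * \<phi>))) UNIV"
    by (subst has_sum_reindex_bij_witness[where T = "UNIV \<times> (UNIV \<times> UNIV)" and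
          j = "\<lambda>(r\<^sub>1, s\<^sub>1, r\<^sub>2, s\<^sub>2). ((r\<^sub>1, s\<^sub>1), r\<^sub>2, s\<^sub>2)" and i = "\<lambda>((r\<^sub>1, s\<^sub>1), r\<^sub>2, s\<^sub>2). (r\<^sub>1, s\<^sub>1, r\<^sub>2, s\<^sub>2)"])
      (auto simp: T_def)
  have PA: "P r\<^sub>1 s\<^sub>1 * g r\<^sub>2 = exp (h * (qform a b c r\<^sub>1 s\<^sub>1 + of_int (c * D) * of_int r\<^sub>2 ^ 2 / 2)
            + of_int r\<^sub>1 * \<xi>\<^sub>1 + of_int s\<^sub>1 * \<eta>\<^sub>1 + of_int r\<^sub>2 * \<xi>\<^sub>2)" for r\<^sub>1 s\<^sub>1 r\<^sub>2
    unfolding P_def g_def by (simp only: exp_add[symmetric], rule arg_cong[where f = exp]) (simp add: algebra_simps)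
  have "((\<lambda>(r\<^sub>1, s\<^sub>1, r\<^sub>2). hsign (r\<^sub>1 \<ge> 0) (e\<^sub>3 r\<^sub>1 r\<^sub>2) * (P r\<^sub>1 s\<^sub>1 * g r\<^sub>2)) has_sum ?A) UNIV"
    using appell_half_has_sum[OF h abc(3) D(2,1) X generic(1)]
    by (simp only: PA e\<^sub>3_def appell_part_def D(1))
  from has_sum_mult_complex[OF this g']
  have A: "((\<lambda>(r\<^sub>1, s\<^sub>1, r\<^sub>2, s\<^sub>2). hsign (r\<^sub>1 \<ge> 0) (e\<^sub>3 r\<^sub>1 r\<^sub>2) * T r\<^sub>1 s\<^sub>1 r\<^sub>2 s\<^sub>2) has_sum (?A * \<phi>)) UNIV"
    by (subst has_sum_reindex_bij_witness[where T = "UNIV \<times> UNIV" and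
          j = "\<lambda>(r\<^sub>1, s\<^sub>1, r\<^sub>2, s\<^sub>2). ((r\<^sub>1, s\<^sub>1, r\<^sub>2), s\<^sub>2)" and i = "\<lambda>((r\<^sub>1, s\<^sub>1, r\<^sub>2), s\<^sub>2). (r\<^sub>1, s\<^sub>1, r\<^sub>2, s\<^sub>2)"])
      (auto simp: T_def)
  \<comment> \<open>The second Appell part is the first one with the two variables
    exchanged.\<close>
  have D': "D = b\<^sup>2 - c * a"
    by (simp add: D mult.commute)
  have PB: "P r\<^sub>1 s\<^sub>1 * g' s\<^sub>2 = exp (h * (qform c b a s\<^sub>1 r\<^sub>1 + of_int (a * D) * of_int s\<^sub>2 ^ 2 / 2)
            + of_int s\<^sub>1 * \<eta>\<^sub>1 + of_int r\<^sub>1 * \<xi>\<^sub>1 + of_int s\<^sub>2 * \<eta>\<^sub>2)" for r\<^sub>1 s\<^sub>1 s\<^sub>2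
    unfolding P_def g'_def qform_commute[of a b c r\<^sub>1 s\<^sub>1]
    by (simp only: exp_add[symmetric], rule arg_cong[where f = exp]) (simp add: algebra_simps)
  have "((\<lambda>(s\<^sub>1, r\<^sub>1, s\<^sub>2). hsign (s\<^sub>1 \<ge> 0) (e\<^sub>4 s\<^sub>1 s\<^sub>2) * (P r\<^sub>1 s\<^sub>1 * g' s\<^sub>2)) has_sum ?B) UNIV"
    using appell_half_has_sum[OF h abc(1) D(2) D' Y generic(2)]
    by (simp only: PB e\<^sub>4_def appell_part_def D')
  from has_sum_mult_complex[OF this g]
  have B: "((\<lambda>(r\<^sub>1, s\<^sub>1, r\<^sub>2, s\<^sub>2). hsign (s\<^sub>1 \<ge> 0) (e\<^sub>4 s\<^sub>1 s\<^sub>2) * T r\<^sub>1 s\<^sub>1 r\<^sub>2 s\<^sub>2) has_sum (?B * \<theta>)) UNIV"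
    by (subst has_sum_reindex_bij_witness[where T = "UNIV \<times> UNIV" and
          j = "\<lambda>(r\<^sub>1, s\<^sub>1, r\<^sub>2, s\<^sub>2). ((s\<^sub>1, r\<^sub>1, s\<^sub>2), r\<^sub>2)" and i = "\<lambda>((s\<^sub>1, r\<^sub>1, s\<^sub>2), r\<^sub>2). (r\<^sub>1, s\<^sub>1, r\<^sub>2, s\<^sub>2)"])
      (auto simp: T_def)
  define R where "R = ?A * \<phi> + ?B * \<theta> + - (?S * (\<theta> * \<phi>))"
  define f where "f r\<^sub>1 s\<^sub>1 r\<^sub>2 s\<^sub>2 = hsign (e\<^sub>3 r\<^sub>1 r\<^sub>2) (e\<^sub>4 s\<^sub>1 s\<^sub>2) * T r\<^sub>1 s\<^sub>1 r\<^sub>2 s\<^sub>2" for r\<^sub>1 s\<^sub>1 r\<^sub>2 s\<^sub>2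
  have f_eq: "f r\<^sub>1 s\<^sub>1 r\<^sub>2 s\<^sub>2 = hsign (r\<^sub>1 \<ge> 0) (e\<^sub>3 r\<^sub>1 r\<^sub>2) * T r\<^sub>1 s\<^sub>1 r\<^sub>2 s\<^sub>2 + hsign (s\<^sub>1 \<ge> 0) (e\<^sub>4 s\<^sub>1 s\<^sub>2) * T r\<^sub>1 s\<^sub>1 r\<^sub>2 s\<^sub>2
      + - (hsign (r\<^sub>1 \<ge> 0) (s\<^sub>1 \<ge> 0) * T r\<^sub>1 s\<^sub>1 r\<^sub>2 s\<^sub>2)" for r\<^sub>1 s\<^sub>1 r\<^sub>2 s\<^sub>2
    unfolding f_def hsign_cocycle[of "r\<^sub>1 \<ge> 0" "e\<^sub>3 r\<^sub>1 r\<^sub>2" "s\<^sub>1 \<ge> 0" "e\<^sub>4 s\<^sub>1 s\<^sub>2", symmetric] by (simp add: algebra_simps)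
  have "((\<lambda>(r\<^sub>1, s\<^sub>1, r\<^sub>2, s\<^sub>2). f r\<^sub>1 s\<^sub>1 r\<^sub>2 s\<^sub>2) has_sum R) UNIV"
    using has_sum_add[OF has_sum_add[OF A B] has_sum_uminusI[OF S]]
    unfolding R_def f_eq by (simp only: case_prod_unfold)
  moreover obtain \<rho> where \<rho>: "\<And>n. \<rho> n \<in> U" "\<And>n. b dvd \<rho> n - n" "\<And>u n. u \<in> U \<Longrightarrow> b dvd u - n \<Longrightarrow> \<rho> n = u"
    using complete_residue_systemE[OF residues(1)] by metis
  moreover obtain \<sigma> where \<sigma>: "\<And>n. \<sigma> n \<in> V" "\<And>n. b dvd \<sigma> n - n" "\<And>u n. u \<in> V \<Longrightarrow> b dvd u - n \<Longrightarrow> \<sigma> n = u"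
    using complete_residue_systemE[OF residues(2)] by metis
  \<comment> \<open>The representatives satisfy \<open>r\<^sub>1 - c * r\<^sub>2 = u - b * l\<close>
    and \<open>s\<^sub>1 - a * s\<^sub>2 = v - b * k\<close>. Crosswise, \<open>k\<close> is
    subtracted from \<open>r\<^sub>2\<close> and \<open>l\<close> from \<open>s\<^sub>2\<close>,
    which is what decouples \<open>(r, s)\<close> from \<open>(k, l)\<close>.\<close>
  define i where "i = (\<lambda>(r\<^sub>1, s\<^sub>1, r\<^sub>2, s\<^sub>2).
    let u = \<rho> (r\<^sub>1 - c * r\<^sub>2); v = \<sigma> (s\<^sub>1 - a * s\<^sub>2); l = (u - (r\<^sub>1 - c * r\<^sub>2)) div b; k = (v - (s\<^sub>1 - a * s\<^sub>2)) div b
    in ((u, v), (r\<^sub>2 - k, s\<^sub>2 - l), (k, l)))"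
  define j where "j = (\<lambda>((u, v), (r, s), (k, l)). (u + c * (r + k) - b * l, v + a * (s + l) - b * k, r + k, s + l))"
  define F where "F u v r s = exp (h * (of_int (b\<^sup>2 * c) * of_int r ^ 2 / 2 + of_int (a * b * c) * of_int r * of_int s
      + of_int (a * b\<^sup>2) * of_int s ^ 2 / 2 + of_int (c * (a * u + b * v)) * of_int r
      + of_int (a * (b * u + c * v)) * of_int s) + of_int r * (of_int c * \<xi>\<^sub>1 + \<xi>\<^sub>2) + of_int s * (of_int a * \<eta>\<^sub>1 + \<eta>\<^sub>2))"
    for u v r s :: int
  define h' where "h' = h * of_int (b * D)"
  define X' where "X' u = X - h * of_int (D * u)" for u
  define Y' where "Y' v = Y - h * of_int (D * v)" for v
  define H where "H u v k l = hsign (of_int l * Re h' + Re (X' u) < 0) (of_int k * Re h' + Re (Y' v) < 0)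
        * exp (of_int (k * l) * h' + of_int k * X' u + of_int l * Y' v)" for u v k l :: int
  have H: "((\<lambda>(k, l). H u v k l) has_sum kronecker_quotient h' (X' u) (Y' v)) (UNIV \<times> UNIV)" for u v
    unfolding H_def kronecker_quotient_def
  proof (rule kronecker_double_series)
    show "Re h' < 0"
    proof -
      have "0 < b * D"
        using abc D by simp
      then have "0 < real_of_int (b * D)"
        by (simp only: of_int_0_less_iff)
      then show ?thesis
        unfolding h'_def using h by (simp add: mult_neg_pos del: of_int_mult)
    qed
    show "of_int k * Re h' + Re (X' u) \<noteq> 0" for k :: int
      using generic(1)[of "k * b - u"] by (simp add: h'_def X'_def algebra_simps)
    show "of_int k * Re h' + Re (Y' v) \<noteq> 0" for k :: int
      using generic(2)[of "k * b - v"] by (simp add: h'_def Y'_def algebra_simps)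
  qed
  have "((\<lambda>(r\<^sub>1, s\<^sub>1, r\<^sub>2, s\<^sub>2). f r\<^sub>1 s\<^sub>1 r\<^sub>2 s\<^sub>2) has_sum R) UNIV
      \<longleftrightarrow> ((\<lambda>((u, v), (r, s), (k, l)). P u v * F u v r s * H u v k l) has_sum R) ((U \<times> V) \<times> (UNIV \<times> UNIV))"
  proof (rule has_sum_reindex_bij_witness[where i = j and j = i], goal_cases)
    case (1 x)
    obtain r\<^sub>1 s\<^sub>1 r\<^sub>2 s\<^sub>2 where x: "x = (r\<^sub>1, s\<^sub>1, r\<^sub>2, s\<^sub>2)"
      by (metis prod.exhaust)
    show ?case
      using \<rho>(2)[of "r\<^sub>1 - c * r\<^sub>2"] \<sigma>(2)[of "s\<^sub>1 - a * s\<^sub>2"]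
      by (simp add: x i_def j_def Let_def)
  next
    case (2 x)
    then show ?case
      by (auto simp: i_def Let_def \<rho> \<sigma> split: prod.splits)
  next
    case (3 x)
    then obtain u v r s k l where x: "x = ((u, v), (r, s), (k, l))" "u \<in> U" "v \<in> V"
      by auto
    have 1: "u + c * (r + k) - b * l - c * (r + k) = u - b * l" "v + a * (s + l) - b * k - a * (s + l) = v - b * k"
      by simp_all
    have 2: "\<rho> (u - b * l) = u" "\<sigma> (v - b * k) = v"
      using x by (auto intro!: \<rho> \<sigma>)
    show ?case
      using abc by (simp add: x i_def j_def Let_def 1 2)
  next
    case (5 x)
    obtain u v r s k l where ix: "i x = ((u, v), (r, s), (k, l))"
      by (metis prod.exhaust)
    obtain r\<^sub>1 s\<^sub>1 r\<^sub>2 s\<^sub>2 where x: "x = (r\<^sub>1, s\<^sub>1, r\<^sub>2, s\<^sub>2)"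
      by (metis prod.exhaust)
    have "j (i x) = x"
      using \<rho>(2)[of "r\<^sub>1 - c * r\<^sub>2"] \<sigma>(2)[of "s\<^sub>1 - a * s\<^sub>2"]
      by (simp add: x i_def j_def Let_def)
    then have x': "x = (u + c * (r + k) - b * l, v + a * (s + l) - b * k, r + k, s + l)"
      unfolding ix j_def by simp
    \<comment> \<open>Here \<open>c * r\<^sub>2 - r\<^sub>1\<close> becomes
      \<open>b * l - u\<close>: each sign depends on only one of the new variables, as in the
      Kronecker series.\<close>
    have 1: "e\<^sub>3 (u + c * (r + k) - b * l) (r + k) \<longleftrightarrow> of_int l * Re h' + Re (X' u) < 0"
      unfolding e\<^sub>3_def h'_def X'_def by (simp add: algebra_simps)
    have 2: "e\<^sub>4 (v + a * (s + l) - b * k) (s + l) \<longleftrightarrow> of_int k * Re h' + Re (Y' v) < 0"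
      unfolding e\<^sub>4_def h'_def Y'_def by (simp add: algebra_simps)
    \<comment> \<open>The squares of \<open>k\<close> and \<open>l\<close> and all products with
      \<open>r\<close> and \<open>s\<close> cancel; of the quadratic terms in \<open>k\<close> and
      \<open>l\<close> only \<open>b * D * k * l\<close> survives.\<close>
    have 3: "T (u + c * (r + k) - b * l) (v + a * (s + l) - b * k) (r + k) (s + l)
        = P u v * F u v r s * exp (of_int (k * l) * h' + of_int k * X' u + of_int l * Y' v)"
      unfolding T_def P_def g_def g'_def F_def h'_def X'_def Y'_def X Y qform_def D(1)
      by (simp only: exp_add[symmetric], rule arg_cong[where f = exp]) (simp add: field_simps power2_eq_square)
    show ?case
      unfolding ix unfolding x' prod.case f_def 1 2 3 H_def by (simp only: mult_ac)
  qed auto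
  ultimately have R: "((\<lambda>((u, v), (r, s), (k, l)). P u v * F u v r s * H u v k l) has_sum R) ((U \<times> V) \<times> (UNIV \<times> UNIV))"
    by simp
  have "((\<lambda>(u, v). P u v * core_sum h a b c (of_int c * \<xi>\<^sub>1 + \<xi>\<^sub>2) (of_int a * \<eta>\<^sub>1 + \<eta>\<^sub>2) u v * kronecker_quotient h' (X' u) (Y' v))
      has_sum R) (U \<times> V)"
  proof (rule has_sum_SigmaD[OF R])
    let ?G = "\<lambda>((u, v), (r, s), (k, l)). P u v * F u v r s * H u v k l"
    let ?g = "\<lambda>(u, v). P u v * core_sum h a b c (of_int c * \<xi>\<^sub>1 + \<xi>\<^sub>2) (of_int a * \<eta>\<^sub>1 + \<eta>\<^sub>2) u v
      * kronecker_quotient h' (X' u) (Y' v)"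
    show "((\<lambda>y. ?G (uv, y)) has_sum ?g uv) (UNIV \<times> UNIV)" if uv: "uv \<in> U \<times> V" for uv
    proof -
      obtain u v where uv_eq: "uv = (u, v)"
        by fastforce
      let ?K = "\<lambda>((r, s), (k, l)). P u v * F u v r s * H u v k l"
      let ?k = "\<lambda>(r, s). P u v * F u v r s * kronecker_quotient h' (X' u) (Y' v)"
      \<comment> \<open>Summability on the fibre is inherited from the full series. Inside the fibre
        \<open>(k, l)\<close> is summed first by Kronecker's formula, then \<open>(r, s)\<close>
        gives the core sum.\<close>
      have "(\<lambda>y. ?G (uv, y)) summable_on UNIV \<times> UNIV"
        by (rule summable_on_SigmaD1[where A = "U \<times> V" and f = "\<lambda>x y. ?G (x, y)"])
          (use has_sum_imp_summable[OF R] uv in \<open>simp_all add: case_prod_unfold\<close>)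
      then have sum: "(?K has_sum infsum ?K (UNIV \<times> UNIV)) (UNIV \<times> UNIV)"
        by (intro has_sum_infsum) (simp add: uv_eq case_prod_unfold)
      have "((\<lambda>kl. ?K (rs, kl)) has_sum ?k rs) (UNIV \<times> UNIV)" for rs
        using has_sum_cmult_right[OF H[of u v], of "P u v * F u v (fst rs) (snd rs)"]
        by (simp add: case_prod_unfold)
      with sum have "(?k has_sum infsum ?K (UNIV \<times> UNIV)) UNIV"
        by (intro has_sum_SigmaD[where f = ?K and A = UNIV and B = "\<lambda>_. UNIV \<times> UNIV"]) simp_all
      then have "infsum ?K (UNIV \<times> UNIV)
          = (\<Sum>\<^sub>\<infinity>x. P u v * (case x of (r, s) \<Rightarrow> F u v r s) * kronecker_quotient h' (X' u) (Y' v))"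
        by (auto simp: case_prod_unfold dest: infsumI)
      also have "\<dots> = ?g uv"
        unfolding infsum_cmult_left' infsum_cmult_right' core_sum_def F_def uv_eq by simp
      finally show ?thesis
        using sum by (simp add: uv_eq case_prod_unfold)
    qed
  qed
  then have "R = (\<Sum>(u, v)\<in>U \<times> V. P u v * core_sum h a b c (of_int c * \<xi>\<^sub>1 + \<xi>\<^sub>2) (of_int a * \<eta>\<^sub>1 + \<eta>\<^sub>2) u v
      * kronecker_quotient h' (X' u) (Y' v))"
    using complete_residue_system_finite[OF residues(1)] complete_residue_system_finite[OF residues(2)] abc
    by (auto intro!: has_sum_unique has_sum_finite)
  also have "\<dots> = ?C"
    unfolding core_part_def P_def h'_def X'_def Y'_def D(1) by (rule sum.cartesian_product[symmetric])
  finally show ?thesis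
    unfolding R_def by (simp add: algebra_simps)
qed

subsection \<open>Removing the restriction on the moduli\<close>

text \<open>The extra \<open>\<bar>n\<bar>\<close> absorbs a factor
  \<open>exp (n * \<delta>)\<close> with \<open>\<delta>\<close> between 0 and 1, uniformly in
  \<open>\<delta>\<close>.\<close>

lemma summable_on_gauss_abs:
  fixes h \<beta> :: real
  assumes "h > 0"
  shows "(\<lambda>n::int. exp (\<beta> * n - h * (real_of_int n)\<^sup>2 + \<bar>of_int n\<bar>)) summable_on UNIV"
proof (rule summable_on_comparison_test)
  show "(\<lambda>n::int. exp ((\<beta> + 1) * n - h * (real_of_int n)\<^sup>2) + exp ((\<beta> - 1) * n - h * (real_of_int n)\<^sup>2)) summable_on UNIV"
    by (intro summable_on_add summable_on_gauss assms)
  show "exp (\<beta> * n - h * (of_int n)\<^sup>2 + \<bar>of_int n\<bar>)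
      \<le> exp ((\<beta> + 1) * n - h * (of_int n)\<^sup>2) + exp ((\<beta> - 1) * n - h * (of_int n)\<^sup>2)" for n :: int
    by (cases "n \<ge> 0") (auto simp: algebra_simps)
qed simp

lemma mult_le_abs:
  fixes x \<delta> :: real
  assumes "\<delta> \<in> {0<..<1}"
  shows "x * \<delta> \<le> \<bar>x\<bar>"
proof -
  have "x * \<delta> \<le> \<bar>x\<bar> * \<delta>"
    using assms by (intro mult_right_mono) auto
  also have "\<dots> \<le> \<bar>x\<bar>"
    using assms by (intro mult_left_le) auto
  finally show ?thesis .
qed

text \<open>A small positive shift moves \<open>x\<close> strictly inside the gap that begins at the
  largest multiple of \<open>s\<close> not exceeding \<open>x\<close>.\<close>

lemma eventually_at_right_avoids_progression:
  fixes s x :: real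
  assumes "s > 0"
  shows "\<forall>\<^sub>F \<delta> in at_right 0. \<forall>k::int. x + \<delta> \<noteq> s * of_int k"
proof -
  define n where "n = \<lfloor>x / s\<rfloor>"
  have "of_int n \<le> x / s" "x / s < of_int n + 1"
    unfolding n_def by linarith+
  then have n: "s * of_int n \<le> x" "x < s * (of_int n + 1)"
    using assms by (simp_all add: pos_le_divide_eq pos_divide_less_eq mult.commute)
  have "\<forall>\<^sub>F \<delta> in at_right 0. \<delta> \<in> {0<..<s * (of_int n + 1) - x}"
    using n by (intro eventually_at_right_real) simp
  then show ?thesis
  proof eventually_elim
    case (elim \<delta>)
    show ?case
    proof (intro allI notI)
      fix k :: int assume "x + \<delta> = s * of_int k"
      then have "s * of_int n < s * of_int k" "s * of_int k < s * of_int (n + 1)"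
        using n elim by auto
      then have "n < k" "k < n + 1"
        using assms by (simp_all only: mult_less_cancel_left_pos of_int_less_iff)
      then show False by simp
    qed
  qed
qed

section \<open>Continuity of the building blocks under small real shifts\<close>

lemma tendsto_of_real_at_right_0: "((\<lambda>\<delta>. complex_of_real \<delta>) \<longlongrightarrow> 0) (at_right 0)"
  using tendsto_of_real[OF tendsto_ident_at, of 0 "{0<..}"] by simp

lemma tendsto_theta:
  assumes "norm q < 1" "(f \<longlongrightarrow> x) F" "x \<noteq> 0"
  shows "((\<lambda>n. Theta (f n) q) \<longlongrightarrow> Theta x q) F"
proof -
  have "isCont (\<lambda>x. Theta x q) x"
    using continuous_on_theta[OF assms(1)] assms(3) by (simp add: continuous_on_eq_continuous_at open_Compl)
  then show ?thesis
    by (rule isCont_tendsto_compose) (rule assms(2))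
qed

text \<open>Dominated convergence; the point is a bound on the perturbed reciprocals
  \<open>1 / (1 - w r * exp \<delta>)\<close> uniform in \<open>r\<close>.\<close>

lemma tendsto_appell_sum:
  assumes h: "Re h < 0" and c: "c > 0" and D: "D > 0"
    and X: "\<And>k::int. exp (of_int (D * k) * h + X) \<noteq> 1"
  shows "((\<lambda>\<delta>. appell_sum h c D (X + of_real \<delta>) (\<xi>\<^sub>2 + of_real \<delta>) t) \<longlongrightarrow> appell_sum h c D X \<xi>\<^sub>2 t) (at_right 0)"
proof -
  define w where "w r = exp (of_int (D * (c * r - t)) * h + X)" for r
  define e where "e r = exp (h * (of_int (c * D) * of_int r ^ 2 / 2) + of_int r * \<xi>\<^sub>2)" for r :: int
  have "Re (of_int (c * D) * h) < 0"
    using h c D by (simp add: mult_pos_neg)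
  moreover have exponent: "of_int (D * (c * r - t)) * h + X = of_int r * (of_int (c * D) * h) + (X - of_int (D * t) * h)" for r
    by (simp add: algebra_simps)
  then have "exp (of_int r * (of_int (c * D) * h) + (X - of_int (D * t) * h)) \<noteq> 1" for r :: int
    using X[of "c * r - t"] by (simp only:) simp
  ultimately obtain M where M: "M > 0" "\<And>r::int. norm (1 / (1 - w r)) \<le> M"
    unfolding exponent w_def by (rule bounded_inverse_one_minus_exp) blast
  show ?thesis
    unfolding appell_sum_def
  proof (rule tendsto_infsum_dominated[where M = "\<lambda>r. norm (e r) * exp \<bar>of_int r\<bar> * (2 * M)"])
  show "((\<lambda>\<delta>. exp (h * (of_int (c * D) * of_int r ^ 2 / 2) + of_int r * (\<xi>\<^sub>2 + of_real \<delta>))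
      / (1 - exp (of_int (D * (c * r - t)) * h + (X + of_real \<delta>))))
    \<longlongrightarrow> exp (h * (of_int (c * D) * of_int r ^ 2 / 2) + of_int r * \<xi>\<^sub>2)
      / (1 - exp (of_int (D * (c * r - t)) * h + X))) (at_right 0)" for r
  proof -
    have "((\<lambda>\<delta>. exp (h * (of_int (c * D) * of_int r ^ 2 / 2) + of_int r * (\<xi>\<^sub>2 + of_real \<delta>))
        / (1 - exp (of_int (D * (c * r - t)) * h + (X + of_real \<delta>))))
      \<longlongrightarrow> exp (h * (of_int (c * D) * of_int r ^ 2 / 2) + of_int r * (\<xi>\<^sub>2 + 0))
        / (1 - exp (of_int (D * (c * r - t)) * h + (X + 0)))) (at_right 0)"
      using X[of "c * r - t"] by (intro tendsto_intros tendsto_of_real_at_right_0) simp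
    then show ?thesis by simp
  qed
  have "((\<lambda>\<delta>::real. \<bar>exp \<delta> - 1\<bar> * (M + 1)) \<longlongrightarrow> \<bar>exp 0 - 1\<bar> * (M + 1)) (at_right 0)"
    by (intro tendsto_intros)
  then have "\<forall>\<^sub>F \<delta>::real in at_right 0. \<bar>exp \<delta> - 1\<bar> * (M + 1) < 1 / 2"
    by (rule order_tendstoD) simp
  moreover have "\<forall>\<^sub>F \<delta>::real in at_right 0. \<delta> \<in> {0<..<1}"
    by (rule eventually_at_right_real) simp
  ultimately show "\<forall>\<^sub>F \<delta> in at_right 0. \<forall>r\<in>UNIV. norm (exp (h * (of_int (c * D) * of_int r ^ 2 / 2) + of_int r * (\<xi>\<^sub>2 + of_real \<delta>))
      / (1 - exp (of_int (D * (c * r - t)) * h + (X + of_real \<delta>))))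
    \<le> norm (e r) * exp \<bar>of_int r\<bar> * (2 * M)"
  proof eventually_elim
    case (elim \<delta>)
    show ?case
    proof
      fix r
      define z where "z = 1 / (1 - w r)"
      have w: "1 - w r \<noteq> 0"
        using X[of "c * r - t"] by (simp add: w_def)
      have "norm ((exp (of_real \<delta>) - 1) * (z - 1)) \<le> \<bar>exp \<delta> - 1\<bar> * (M + 1)"
      proof -
        have "norm (exp (of_real \<delta>) - 1 :: complex) = \<bar>exp \<delta> - 1\<bar>"
          by (metis exp_of_real norm_of_real of_real_1 of_real_diff)
        moreover have "norm (z - 1) \<le> M + 1"
          using M(2)[of r] norm_triangle_ineq4[of z 1] unfolding z_def by simp
        ultimately show ?thesis
          unfolding norm_mult by (metis abs_ge_zero mult_left_mono)
      qed
      then have "1 / 2 \<le> norm (1 - (exp (of_real \<delta>) - 1) * (z - 1))"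
        using norm_triangle_ineq2[of 1 "(exp (of_real \<delta>) - 1) * (z - 1)"] elim by simp
      \<comment> \<open>Since \<open>z - 1 = w r / (1 - w r)\<close>, the perturbed denominator is
        the old one times a factor of modulus at least 1/2 once \<open>\<delta>\<close> is
        small.\<close>
      moreover have "(1 - w r) * (1 - (exp (of_real \<delta>) - 1) * (z - 1)) = 1 - w r * exp (of_real \<delta>)"
        using w unfolding z_def by (simp add: field_simps)
      ultimately have "norm (1 - w r) * (1 / 2) \<le> norm (1 - w r * exp (of_real \<delta>))"
        by (metis mult_left_mono norm_ge_zero norm_mult)
      then have "norm (1 / (1 - w r * exp (of_real \<delta>))) \<le> 2 * norm (1 / (1 - w r))"
        using w by (simp add: norm_divide divide_simps split: if_splits)
      also have "\<dots> \<le> 2 * M"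
        using M(2) by simp
      finally have 1: "norm (1 / (1 - w r * exp (of_real \<delta>))) \<le> 2 * M" .
      have "of_int r * \<delta> \<le> \<bar>of_int r\<bar>"
        by (rule mult_le_abs[OF elim(2)])
      then have "norm (exp (of_int r * of_real \<delta>) :: complex) \<le> exp \<bar>of_int r\<bar>"
        by simp
      then have 2: "norm (e r) * norm (exp (of_int r * of_real \<delta>) :: complex) * norm (1 / (1 - w r * exp (of_real \<delta>)))
          \<le> norm (e r) * exp \<bar>of_int r\<bar> * (2 * M)"
        using 1 by (intro mult_mono) auto
      have "exp (h * (of_int (c * D) * of_int r ^ 2 / 2) + of_int r * (\<xi>\<^sub>2 + of_real \<delta>))
          / (1 - exp (of_int (D * (c * r - t)) * h + (X + of_real \<delta>)))
        = e r * exp (of_int r * of_real \<delta>) * (1 / (1 - w r * exp (of_real \<delta>)))"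
        by (simp add: e_def w_def ring_distribs exp_add mult_ac)
      with 2 show "norm (exp (h * (of_int (c * D) * of_int r ^ 2 / 2) + of_int r * (\<xi>\<^sub>2 + of_real \<delta>))
          / (1 - exp (of_int (D * (c * r - t)) * h + (X + of_real \<delta>))))
        \<le> norm (e r) * exp \<bar>of_int r\<bar> * (2 * M)"
        by (simp only: norm_mult)
    qed
  qed
  have "(\<lambda>r::int. exp (Re \<xi>\<^sub>2 * r - (- Re h * of_int (c * D) / 2) * (real_of_int r)\<^sup>2 + \<bar>of_int r\<bar>)) summable_on UNIV"
    using h c D by (intro summable_on_gauss_abs) (simp add: mult_neg_pos)
  moreover have "exp (Re \<xi>\<^sub>2 * r - (- Re h * of_int (c * D) / 2) * (of_int r)\<^sup>2 + \<bar>of_int r\<bar>) = norm (e r) * exp \<bar>of_int r\<bar>" for r :: int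
    unfolding e_def norm_exp_eq_Re exp_add[symmetric] by (simp add: algebra_simps flip: of_int_power)
  ultimately show "(\<lambda>r. norm (e r) * exp \<bar>of_int r\<bar> * (2 * M)) summable_on UNIV"
    by (intro summable_on_cmult_left) (simp only:)
qed simp
qed

text \<open>The difference of the two sides is half of
  \<open>b * sqrt (a * c) * (sqrt c * r + sqrt a * s)^2\<close>. With
  \<open>b > sqrt (a * c)\<close> this shows that the form in the core sum is positive
  definite.\<close>

lemma core_form_lower_bound:
  fixes a b c :: int and r s :: real
  assumes "a > 0" "b > 0" "c > 0"
  shows "b * (b - sqrt (a * c)) * (c * r\<^sup>2 + a * s\<^sup>2) / 2
    \<le> b\<^sup>2 * c * r\<^sup>2 / 2 + a * b * c * r * s + a * b\<^sup>2 * s\<^sup>2 / 2"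
proof -
  have "0 \<le> b * sqrt (a * c) * (sqrt c * r + sqrt a * s)\<^sup>2"
    using assms by simp
  also have "(sqrt c * r + sqrt a * s)\<^sup>2 = c * r\<^sup>2 + a * s\<^sup>2 + 2 * sqrt (a * c) * r * s"
    using assms by (simp add: power2_sum power_mult_distrib real_sqrt_mult)
  also have "b * sqrt (a * c) * (c * r\<^sup>2 + a * s\<^sup>2 + 2 * sqrt (a * c) * r * s)
      = b * sqrt (a * c) * (c * r\<^sup>2 + a * s\<^sup>2) + 2 * b * (sqrt (a * c) * sqrt (a * c)) * r * s"
    by (simp add: algebra_simps)
  also have "sqrt (a * c) * sqrt (a * c) = a * c"
    using assms by simp
  finally show ?thesis
    by (simp add: algebra_simps power2_eq_square)
qed

text \<open>The diagonal lower bound for the form splits the majorant into a product of two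
  one-dimensional Gaussians.\<close>

lemma tendsto_core_sum:
  assumes h: "Re h < 0" and abc: "a > 0" "b > 0" "c > 0" and D: "b\<^sup>2 - a * c > 0"
  shows "((\<lambda>\<delta>. core_sum h a b c (\<xi> + of_real \<delta>) (\<eta> + of_real \<delta>) u v) \<longlongrightarrow> core_sum h a b c \<xi> \<eta> u v) (at_right 0)"
  unfolding core_sum_def case_prod_unfold
proof (rule tendsto_infsum_dominated)
  define N where "N r s = h * (of_int (b\<^sup>2 * c) * of_int r ^ 2 / 2 + of_int (a * b * c) * of_int r * of_int s
      + of_int (a * b\<^sup>2) * of_int s ^ 2 / 2 + of_int (c * (a * u + b * v)) * of_int r
      + of_int (a * (b * u + c * v)) * of_int s)" for r s :: int
  define \<kappa> where "\<kappa> = b * (b - sqrt (a * c))"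
  have "sqrt (a * c) < b"
    using D abc by (intro real_less_lsqrt) (simp_all flip: of_int_mult of_int_power)
  then have \<kappa>: "\<kappa> > 0"
    using abc by (simp add: \<kappa>_def)
  define G where "G \<alpha> \<beta> n = exp (\<beta> * n - \<alpha> * (of_int n)\<^sup>2 + \<bar>of_int n\<bar>)" for \<alpha> \<beta> :: real and n :: int
  define M where "M r s = G (- Re h * \<kappa> * c / 2) (Re h * of_int (c * (a * u + b * v)) + Re \<xi>) r
      * G (- Re h * \<kappa> * a / 2) (Re h * of_int (a * (b * u + c * v)) + Re \<eta>) s" for r s
  show "((\<lambda>\<delta>. exp (N (fst x) (snd x) + of_int (fst x) * (\<xi> + of_real \<delta>) + of_int (snd x) * (\<eta> + of_real \<delta>)))
      \<longlongrightarrow> exp (N (fst x) (snd x) + of_int (fst x) * \<xi> + of_int (snd x) * \<eta>)) (at_right 0)" for x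
  proof -
    have "((\<lambda>\<delta>. exp (N (fst x) (snd x) + of_int (fst x) * (\<xi> + of_real \<delta>) + of_int (snd x) * (\<eta> + of_real \<delta>)))
      \<longlongrightarrow> exp (N (fst x) (snd x) + of_int (fst x) * (\<xi> + 0) + of_int (snd x) * (\<eta> + 0))) (at_right 0)"
      by (intro tendsto_intros tendsto_of_real_at_right_0)
    then show ?thesis by simp
  qed
  have "\<forall>\<^sub>F \<delta>::real in at_right 0. \<delta> \<in> {0<..<1}"
    by (rule eventually_at_right_real) simp
  then show "\<forall>\<^sub>F \<delta> in at_right 0. \<forall>x\<in>UNIV. norm (exp (N (fst x) (snd x)
      + of_int (fst x) * (\<xi> + of_real \<delta>) + of_int (snd x) * (\<eta> + of_real \<delta>))) \<le> M (fst x) (snd x)"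
  proof eventually_elim
    case (elim \<delta>)
    show ?case
    proof
      fix x :: "int \<times> int"
      obtain r s where x: "x = (r, s)" by fastforce
      have le_abs: "of_int n * \<delta> \<le> \<bar>of_int n\<bar>" for n :: int
        by (rule mult_le_abs[OF elim])
      have "Re (N r s) = Re h * (b\<^sup>2 * c * (of_int r)\<^sup>2 / 2 + a * b * c * of_int r * of_int s + a * b\<^sup>2 * (of_int s)\<^sup>2 / 2)
          + Re h * of_int (c * (a * u + b * v)) * r + Re h * of_int (a * (b * u + c * v)) * s"
        unfolding N_def by (simp add: algebra_simps flip: of_int_power of_int_mult of_int_add)
      also have "Re h * (b\<^sup>2 * c * (of_int r)\<^sup>2 / 2 + a * b * c * of_int r * of_int s + a * b\<^sup>2 * (of_int s)\<^sup>2 / 2)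
          \<le> Re h * (\<kappa> * (c * (of_int r)\<^sup>2 + a * (of_int s)\<^sup>2) / 2)"
        using h core_form_lower_bound[OF abc, of "of_int r" "of_int s"]
        unfolding \<kappa>_def by (intro mult_left_mono_neg) auto
      finally have "Re (N r s) + r * Re \<xi> + s * Re \<eta> + r * \<delta> + s * \<delta> \<le>
          Re h * (\<kappa> * (c * (of_int r)\<^sup>2 + a * (of_int s)\<^sup>2) / 2)
          + Re h * of_int (c * (a * u + b * v)) * r + Re h * of_int (a * (b * u + c * v)) * s
          + r * Re \<xi> + s * Re \<eta> + \<bar>of_int r\<bar> + \<bar>of_int s\<bar>"
        using le_abs[of r] le_abs[of s] by linarith
      then show "norm (exp (N (fst x) (snd x) + of_int (fst x) * (\<xi> + of_real \<delta>) + of_int (snd x) * (\<eta> + of_real \<delta>)))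
          \<le> M (fst x) (snd x)"
        unfolding M_def G_def exp_add[symmetric] norm_exp_eq_Re exp_le_cancel_iff
        by (simp add: x algebra_simps add_divide_distrib)
    qed
  qed
  have "(\<lambda>(r, s). M r s) summable_on UNIV \<times> UNIV"
    unfolding M_def
  proof (rule summable_on_mult_nonneg)
    show "G (- Re h * \<kappa> * c / 2) \<beta> summable_on UNIV" "G (- Re h * \<kappa> * a / 2) \<beta> summable_on UNIV" for \<beta>
      unfolding G_def using h \<kappa> abc by (intro summable_on_gauss_abs; simp add: mult_neg_pos)+
  qed (simp_all add: G_def)
  then show "(\<lambda>x. M (fst x) (snd x)) summable_on UNIV"
    by (simp add: case_prod_unfold)
qed simp


lemma tendsto_kronecker_quotient:
  assumes h: "Re h < 0" and \<xi>: "\<And>k::int. exp (\<xi> + of_int k * h) \<noteq> 1" and \<eta>: "\<And>k::int. exp (\<eta> + of_int k * h) \<noteq> 1"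
  shows "((\<lambda>\<delta>. kronecker_quotient h (\<xi> + of_real \<delta>) (\<eta> + of_real \<delta>)) \<longlongrightarrow> kronecker_quotient h \<xi> \<eta>) (at_right 0)"
proof -
  have q: "norm (exp h) < 1"
    using h by simp
  have "((\<lambda>\<delta>. kronecker_quotient h (\<xi> + of_real \<delta>) (\<eta> + of_real \<delta>)) \<longlongrightarrow> kronecker_quotient h (\<xi> + 0) (\<eta> + 0)) (at_right 0)"
    unfolding kronecker_quotient_def using theta_nonzero[OF h \<xi>] theta_nonzero[OF h \<eta>]
    by (intro tendsto_intros tendsto_theta q tendsto_of_real_at_right_0) simp_all
  then show ?thesis by simp
qed

text \<open>In this normalisation the zeros of theta sit at minus the half-odd powers of the
  base.\<close>

lemma gauss_theta_nonzero:
  assumes h: "Re h < 0" and A: "A > 0" and generic: "\<And>k::int. exp \<zeta> \<noteq> - exp (h * (of_int A * (of_int k + 1 / 2)))"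
  shows "Theta (- exp (\<zeta> + h * of_int A / 2)) (exp (h * of_int A)) \<noteq> 0"
proof -
  have "Theta (exp (\<zeta> + h * of_int A / 2 + \<i> * of_real pi)) (exp (h * of_int A)) \<noteq> 0"
  proof (rule theta_nonzero)
    show "Re (h * of_int A) < 0"
      using h A by (simp add: mult_neg_pos)
    show "exp (\<zeta> + h * of_int A / 2 + \<i> * of_real pi + of_int k * (h * of_int A)) \<noteq> 1" for k
    proof
      assume 1: "exp (\<zeta> + h * of_int A / 2 + \<i> * of_real pi + of_int k * (h * of_int A)) = 1"
      \<comment> \<open>The index is \<open>- k - 1\<close> because \<open>A / 2 + k * A\<close>
        must equal minus a half-odd multiple of \<open>A\<close>.\<close>
      define E where "E = h * (of_int A * (of_int (- k - 1) + 1 / 2))"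
      have "\<zeta> + h * of_int A / 2 + \<i> * of_real pi + of_int k * (h * of_int A) = \<zeta> + (\<i> * of_real pi + - E)"
        by (simp add: E_def field_simps)
      with 1 have "exp (\<zeta> + (\<i> * of_real pi + - E)) = 1"
        by (simp only:)
      then have "- exp \<zeta> = exp E"
        by (simp add: exp_add exp_minus exp_diff field_simps)
      then have "exp \<zeta> = - exp E"
        by (metis minus_minus)
      then show False
        using generic unfolding E_def by blast
    qed
  qed
  then show ?thesis
    by (simp add: exp_add)
qed

text \<open>Adding a small \<open>\<delta> > 0\<close> to \<open>\<xi>\<^sub>2\<close> and
  \<open>\<eta>\<^sub>2\<close> also adds it to \<open>X\<close> and \<open>Y\<close> and makes
  their moduli generic, while the indefinite series is unchanged. Every other part is continuous as
  \<open>\<delta>\<close> tends to 0.\<close>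

theorem indefinite_theta_identity:
  fixes a b c D :: int
  assumes h: "Re h < 0" and abc: "a > 0" "b > 0" "c > 0" and D: "D = b\<^sup>2 - a * c" "D > 0"
    and X: "X = of_int c * \<xi>\<^sub>1 - of_int b * \<eta>\<^sub>1 + \<xi>\<^sub>2"
    and Y: "Y = of_int a * \<eta>\<^sub>1 - of_int b * \<xi>\<^sub>1 + \<eta>\<^sub>2"
    and generic: "\<And>k::int. exp (of_int (D * k) * h + X) \<noteq> 1" "\<And>k::int. exp (of_int (D * k) * h + Y) \<noteq> 1"
    and residues: "complete_residue_system b U" "complete_residue_system b V"
  defines "\<theta> \<equiv> Theta (- exp (\<xi>\<^sub>2 + h * of_int (c * D) / 2)) (exp (h * of_int (c * D)))"
    and "\<phi> \<equiv> Theta (- exp (\<eta>\<^sub>2 + h * of_int (a * D) / 2)) (exp (h * of_int (a * D)))"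
  shows "(\<Sum>\<^sub>\<infinity>(r, s)\<in>UNIV. hsign (r \<ge> 0) (s \<ge> 0) * exp (h * qform a b c r s + of_int r * \<xi>\<^sub>1 + of_int s * \<eta>\<^sub>1)) * (\<theta> * \<phi>)
    = appell_part h a b c \<xi>\<^sub>1 \<eta>\<^sub>1 X \<xi>\<^sub>2 * \<phi> + appell_part h c b a \<eta>\<^sub>1 \<xi>\<^sub>1 Y \<eta>\<^sub>2 * \<theta>
      - core_part h a b c U V \<xi>\<^sub>1 \<eta>\<^sub>1 X Y \<xi>\<^sub>2 \<eta>\<^sub>2"
    (is "?S * _ = _")
proof -
  define \<theta>' where "\<theta>' \<delta> = Theta (- exp (\<xi>\<^sub>2 + of_real \<delta> + h * of_int (c * D) / 2)) (exp (h * of_int (c * D)))" for \<delta>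
  define \<phi>' where "\<phi>' \<delta> = Theta (- exp (\<eta>\<^sub>2 + of_real \<delta> + h * of_int (a * D) / 2)) (exp (h * of_int (a * D)))" for \<delta>
  define R where "R \<delta> = appell_part h a b c \<xi>\<^sub>1 \<eta>\<^sub>1 (X + of_real \<delta>) (\<xi>\<^sub>2 + of_real \<delta>) * \<phi>' \<delta>
      + appell_part h c b a \<eta>\<^sub>1 \<xi>\<^sub>1 (Y + of_real \<delta>) (\<eta>\<^sub>2 + of_real \<delta>) * \<theta>' \<delta>
      - core_part h a b c U V \<xi>\<^sub>1 \<eta>\<^sub>1 (X + of_real \<delta>) (Y + of_real \<delta>) (\<xi>\<^sub>2 + of_real \<delta>) (\<eta>\<^sub>2 + of_real \<delta>)" for \<delta> :: real
  have neg: "Re (h * of_int n) < 0" if "n > 0" for n :: int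
    using h that by (simp add: mult_neg_pos)
  have \<theta>: "(\<theta>' \<longlongrightarrow> \<theta>) (at_right 0)"
  proof -
    have "(\<theta>' \<longlongrightarrow> Theta (- exp (\<xi>\<^sub>2 + 0 + h * of_int (c * D) / 2)) (exp (h * of_int (c * D)))) (at_right 0)"
      unfolding \<theta>'_def using neg[of "c * D"] abc D(2)
      by (intro tendsto_theta tendsto_intros tendsto_of_real_at_right_0) (simp_all del: of_int_mult)
    then show ?thesis by (simp add: \<theta>_def)
  qed
  have \<phi>: "(\<phi>' \<longlongrightarrow> \<phi>) (at_right 0)"
  proof -
    have "(\<phi>' \<longlongrightarrow> Theta (- exp (\<eta>\<^sub>2 + 0 + h * of_int (a * D) / 2)) (exp (h * of_int (a * D)))) (at_right 0)"
      unfolding \<phi>'_def using neg[of "a * D"] abc D(2)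
      by (intro tendsto_theta tendsto_intros tendsto_of_real_at_right_0) (simp_all del: of_int_mult)
    then show ?thesis by (simp add: \<phi>_def)
  qed
  have "((\<lambda>\<delta>. core_part h a b c U V \<xi>\<^sub>1 \<eta>\<^sub>1 (X + of_real \<delta>) (Y + of_real \<delta>) (\<xi>\<^sub>2 + of_real \<delta>) (\<eta>\<^sub>2 + of_real \<delta>))
      \<longlongrightarrow> core_part h a b c U V \<xi>\<^sub>1 \<eta>\<^sub>1 X Y \<xi>\<^sub>2 \<eta>\<^sub>2) (at_right 0)"
  proof -
    have "((\<lambda>\<delta>. core_sum h a b c (of_int c * \<xi>\<^sub>1 + (\<xi>\<^sub>2 + of_real \<delta>)) (of_int a * \<eta>\<^sub>1 + (\<eta>\<^sub>2 + of_real \<delta>)) u v)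
        \<longlongrightarrow> core_sum h a b c (of_int c * \<xi>\<^sub>1 + \<xi>\<^sub>2) (of_int a * \<eta>\<^sub>1 + \<eta>\<^sub>2) u v) (at_right 0)" for u v
      unfolding add.assoc[symmetric] using D by (intro tendsto_core_sum h abc) simp
    moreover have "((\<lambda>\<delta>. kronecker_quotient (h * of_int (b * D)) (X + of_real \<delta> - h * of_int (D * u)) (Y + of_real \<delta> - h * of_int (D * v)))
        \<longlongrightarrow> kronecker_quotient (h * of_int (b * D)) (X - h * of_int (D * u)) (Y - h * of_int (D * v))) (at_right 0)" for u v
    proof -
      have "exp (X - h * of_int (D * u) + of_int k * (h * of_int (b * D))) \<noteq> 1" for k
        using generic(1)[of "b * k - u"] by (simp add: algebra_simps)
      moreover have "exp (Y - h * of_int (D * v) + of_int k * (h * of_int (b * D))) \<noteq> 1" for k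
        using generic(2)[of "b * k - v"] by (simp add: algebra_simps)
      moreover have "0 < b * D"
        using abc D by simp
      ultimately have "((\<lambda>\<delta>. kronecker_quotient (h * of_int (b * D)) (X - h * of_int (D * u) + of_real \<delta>) (Y - h * of_int (D * v) + of_real \<delta>))
        \<longlongrightarrow> kronecker_quotient (h * of_int (b * D)) (X - h * of_int (D * u)) (Y - h * of_int (D * v))) (at_right 0)"
        by (intro tendsto_kronecker_quotient neg)
      then show ?thesis
        by (simp add: algebra_simps)
    qed
    ultimately show ?thesis
      unfolding core_part_def D(1)[symmetric] by (intro tendsto_intros)
  qed
  moreover have "((\<lambda>\<delta>. appell_part h a b c \<xi>\<^sub>1 \<eta>\<^sub>1 (X + of_real \<delta>) (\<xi>\<^sub>2 + of_real \<delta>))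
      \<longlongrightarrow> appell_part h a b c \<xi>\<^sub>1 \<eta>\<^sub>1 X \<xi>\<^sub>2) (at_right 0)"
    unfolding appell_part_def D(1)[symmetric] by (intro tendsto_intros tendsto_appell_sum h abc D(2) generic)
  moreover have D': "D = b\<^sup>2 - c * a"
    by (simp add: D mult.commute)
  have "((\<lambda>\<delta>. appell_part h c b a \<eta>\<^sub>1 \<xi>\<^sub>1 (Y + of_real \<delta>) (\<eta>\<^sub>2 + of_real \<delta>))
      \<longlongrightarrow> appell_part h c b a \<eta>\<^sub>1 \<xi>\<^sub>1 Y \<eta>\<^sub>2) (at_right 0)"
    unfolding appell_part_def D'[symmetric] by (intro tendsto_intros tendsto_appell_sum h abc D(2) generic)
  ultimately have R_lim: "(R \<longlongrightarrow> appell_part h a b c \<xi>\<^sub>1 \<eta>\<^sub>1 X \<xi>\<^sub>2 * \<phi> + appell_part h c b a \<eta>\<^sub>1 \<xi>\<^sub>1 Y \<eta>\<^sub>2 * \<theta>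
      - core_part h a b c U V \<xi>\<^sub>1 \<eta>\<^sub>1 X Y \<xi>\<^sub>2 \<eta>\<^sub>2) (at_right 0)"
    unfolding R_def by (intro tendsto_intros \<theta> \<phi>)
  have S_lim: "((\<lambda>\<delta>. ?S * (\<theta>' \<delta> * \<phi>' \<delta>)) \<longlongrightarrow> ?S * (\<theta> * \<phi>)) (at_right 0)"
    by (intro tendsto_intros \<theta> \<phi>)
  have "\<forall>\<^sub>F \<delta> in at_right 0. ?S * (\<theta>' \<delta> * \<phi>' \<delta>) = R \<delta>"
  proof -
    \<comment> \<open>The forbidden values of \<open>Re X + \<delta>\<close> and
      \<open>Re Y + \<delta>\<close> form an arithmetic progression with this step.\<close>
    have pos: "- (of_int D * Re h) > 0"
      using h D(2) by (simp add: mult_pos_neg)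
    from eventually_at_right_avoids_progression[OF pos, of "Re X"] eventually_at_right_avoids_progression[OF pos, of "Re Y"]
    show ?thesis
    proof eventually_elim
      case (elim \<delta>)
      have "of_int (D * k) * Re h + Re (X + of_real \<delta>) \<noteq> 0" "of_int (D * k) * Re h + Re (Y + of_real \<delta>) \<noteq> 0" for k :: int
        using elim(1)[rule_format, of k] elim(2)[rule_format, of k] by (auto simp: algebra_simps)
      then show ?case
        unfolding R_def \<theta>'_def \<phi>'_def
        by (intro indefinite_theta_decomposition h abc D residues) (simp_all add: X Y)
    qed
  qed
  from Lim_transform_eventually[OF S_lim this] R_lim show ?thesis
    by (rule tendsto_unique[OF trivial_limit_at_right_real])
qed

section \<open>Translation into the notation of the statement\<close>

lemma appell_m_eq_appell_sum:
  "appell_m (- exp (h * (of_int D * (of_int c / 2 - of_int t)) + (X - \<xi>\<^sub>2)))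
      (- exp (\<xi>\<^sub>2 + h * of_int (c * D) / 2)) (exp (h * of_int (c * D)))
    = appell_sum h c D X \<xi>\<^sub>2 t / Theta (- exp (\<xi>\<^sub>2 + h * of_int (c * D) / 2)) (exp (h * of_int (c * D)))"
proof -
  have exponent: "h * (of_int D * (of_int c / 2 - of_int t)) + (X - \<xi>\<^sub>2) + \<xi>\<^sub>2 + h * of_int (c * D) * (of_int r - 1 / 2)
      = of_int (D * (c * r - t)) * h + X" for r :: int
    by (simp add: field_simps)
  show ?thesis
    unfolding appell_m_exp appell_sum_def exponent by simp
qed

text \<open>Stated with exponentials in place of the variables, so that both Appell sums of the
  theorem are instances.\<close>

lemma appell_part_eq:
  fixes a b c D :: int
  assumes D: "D = b\<^sup>2 - a * c" and h: "h = 2 * of_real pi * \<i> * \<tau>"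
    and X: "X = of_int c * \<xi>\<^sub>1 - of_int b * \<eta>\<^sub>1 + \<xi>\<^sub>2"
  shows "(\<Sum>t\<in>{0..c - 1}.
      exp \<xi>\<^sub>1 powi t * qpow \<tau> (a * t\<^sup>2 / 2)
      * Theta (- exp \<eta>\<^sub>1 * qpow \<tau> (b * t + c / 2)) (exp h powi c)
      * appell_m (- qpow \<tau> (D * (c / 2 - t)) * exp \<xi>\<^sub>1 powi c * exp \<eta>\<^sub>1 powi (- b))
          (- qpow \<tau> (c * D / 2) * exp \<xi>\<^sub>2) (exp h powi (c * D)))
    = appell_part h a b c \<xi>\<^sub>1 \<eta>\<^sub>1 X \<xi>\<^sub>2 / Theta (- exp (\<xi>\<^sub>2 + h * of_int (c * D) / 2)) (exp (h * of_int (c * D)))"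
  unfolding appell_part_def sum_divide_distrib
proof (intro sum.cong refl)
  fix t :: int
  have qpow: "qpow \<tau> e = exp (h * of_real e)" for e
    by (simp add: qpow_def h)
  have 1: "exp \<xi>\<^sub>1 powi t * qpow \<tau> (a * t\<^sup>2 / 2) = exp (of_int t * \<xi>\<^sub>1 + h * (of_int a * of_int t ^ 2 / 2))"
    by (simp add: qpow exp_power_int exp_add)
  have 2: "- exp \<eta>\<^sub>1 * qpow \<tau> (b * t + c / 2) = - exp (\<eta>\<^sub>1 + h * of_int (b * t) + h * of_int c / 2)"
    by (simp add: qpow exp_add ring_distribs)
  have 3: "exp h powi n = exp (h * of_int n)" for n
    by (simp add: exp_power_int mult.commute)
  have 4: "- qpow \<tau> (D * (c / 2 - t)) * exp \<xi>\<^sub>1 powi c * exp \<eta>\<^sub>1 powi (- b)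
      = - exp (h * (of_int D * (of_int c / 2 - of_int t)) + (X - \<xi>\<^sub>2))"
    unfolding qpow exp_power_int mult_minus_left exp_add[symmetric] X
    by (simp add: algebra_simps)
  have 5: "- qpow \<tau> (c * D / 2) * exp \<xi>\<^sub>2 = - exp (\<xi>\<^sub>2 + h * of_int (c * D) / 2)"
    by (simp add: qpow exp_add)
  show "exp \<xi>\<^sub>1 powi t * qpow \<tau> (a * t\<^sup>2 / 2)
      * Theta (- exp \<eta>\<^sub>1 * qpow \<tau> (b * t + c / 2)) (exp h powi c)
      * appell_m (- qpow \<tau> (D * (c / 2 - t)) * exp \<xi>\<^sub>1 powi c * exp \<eta>\<^sub>1 powi (- b))
          (- qpow \<tau> (c * D / 2) * exp \<xi>\<^sub>2) (exp h powi (c * D))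
    = exp (of_int t * \<xi>\<^sub>1 + h * (of_int a * of_int t ^ 2 / 2))
      * Theta (- exp (\<eta>\<^sub>1 + h * of_int (b * t) + h * of_int c / 2)) (exp (h * of_int c))
      * appell_sum h c (b\<^sup>2 - a * c) X \<xi>\<^sub>2 t / Theta (- exp (\<xi>\<^sub>2 + h * of_int (c * D) / 2)) (exp (h * of_int (c * D)))"
    unfolding 1 2 3 4 5 appell_m_eq_appell_sum D[symmetric] by simp
qed

text \<open>The first two genericity hypotheses keep the thetas of \<open>x\<^sub>2\<close> and
  \<open>y\<^sub>2\<close> away from zero; the last two do so for the Appell denominators and for
  the denominators of the Kronecker quotients.\<close>

theorem theorem1p8:
  fixes q \<tau> x\<^sub>1 x\<^sub>2 y\<^sub>1 y\<^sub>2 :: complex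
    and a b c D :: int
    and U V :: "int set"
  assumes q: "0 < norm q" "norm q < 1" "q = exp (2 * of_real pi * \<i> * \<tau>)"
    and abc: "a > 0" "b > 0" "c > 0"
    and D: "D = b\<^sup>2 - a * c" "D > 0"
    and nonzero: "x\<^sub>1 \<noteq> 0" "x\<^sub>2 \<noteq> 0" "y\<^sub>1 \<noteq> 0" "y\<^sub>2 \<noteq> 0"
    and generic:
      "\<And>k :: int. x\<^sub>2 \<noteq> - qpow \<tau> (c * D * (k + 1 / 2))"
      "\<And>k :: int. y\<^sub>2 \<noteq> - qpow \<tau> (a * D * (k + 1 / 2))"
      "\<And>k :: int. x\<^sub>1 powi c * y\<^sub>1 powi (- b) * x\<^sub>2 \<noteq> q powi (D * k)"
      "\<And>k :: int. x\<^sub>1 powi (- b) * y\<^sub>1 powi a * y\<^sub>2 \<noteq> q powi (D * k)"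
    and residues: "complete_residue_system b U" "complete_residue_system b V"
  shows
    "(\<Sum>\<^sub>\<infinity>(r\<^sub>1, s\<^sub>1)\<in>(UNIV :: (int \<times> int) set).
        sg2 r\<^sub>1 s\<^sub>1 * qpow \<tau> (a * r\<^sub>1\<^sup>2 / 2 + b * r\<^sub>1 * s\<^sub>1 + c * s\<^sub>1\<^sup>2 / 2)
          * x\<^sub>1 powi r\<^sub>1 * y\<^sub>1 powi s\<^sub>1)
     = (\<Sum>t\<in>{0..c - 1}.
          x\<^sub>1 powi t * qpow \<tau> (a * t\<^sup>2 / 2)
          * Theta (- y\<^sub>1 * qpow \<tau> (b * t + c / 2)) (q powi c)
          * appell_m (- qpow \<tau> (D * (c / 2 - t)) * x\<^sub>1 powi c * y\<^sub>1 powi (- b))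
              (- qpow \<tau> (c * D / 2) * x\<^sub>2) (q powi (c * D)))
     + (\<Sum>t\<in>{0..a - 1}.
          y\<^sub>1 powi t * qpow \<tau> (c * t\<^sup>2 / 2)
          * Theta (- x\<^sub>1 * qpow \<tau> (b * t + a / 2)) (q powi a)
          * appell_m (- qpow \<tau> (D * (a / 2 - t)) * y\<^sub>1 powi a * x\<^sub>1 powi (- b))
              (- qpow \<tau> (a * D / 2) * y\<^sub>2) (q powi (a * D)))
     - inverse (Theta (- x\<^sub>2 * qpow \<tau> (c * D / 2)) (q powi (c * D))
                * Theta (- y\<^sub>2 * qpow \<tau> (a * D / 2)) (q powi (a * D)))
       * (\<Sum>u\<in>U. \<Sum>v\<in>V.
            qpow \<tau> (a * u\<^sup>2 / 2 + b * u * v + c * v\<^sup>2 / 2) * x\<^sub>1 powi u * y\<^sub>1 powi v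
            * (\<Sum>\<^sub>\<infinity>(r\<^sub>2, s\<^sub>2)\<in>(UNIV :: (int \<times> int) set).
                 qpow \<tau> (b\<^sup>2 * c * r\<^sub>2\<^sup>2 / 2 + a * b * c * r\<^sub>2 * s\<^sub>2 + a * b\<^sup>2 * s\<^sub>2\<^sup>2 / 2
                         + c * (a * u + b * v) * r\<^sub>2 + a * (b * u + c * v) * s\<^sub>2)
                 * (x\<^sub>1 powi c * x\<^sub>2) powi r\<^sub>2 * (y\<^sub>1 powi a * y\<^sub>2) powi s\<^sub>2)
            * (qpochhammer_inf (q powi (b * D)) (q powi (b * D)) ^ 3
               * Theta (x\<^sub>1 powi (c - b) * y\<^sub>1 powi (a - b) * x\<^sub>2 * y\<^sub>2 * q powi (- D * (u + v)))
                   (q powi (b * D))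
               / (Theta (x\<^sub>1 powi c * y\<^sub>1 powi (- b) * x\<^sub>2 * q powi (- D * u)) (q powi (b * D))
                  * Theta (x\<^sub>1 powi (- b) * y\<^sub>1 powi a * y\<^sub>2 * q powi (- D * v)) (q powi (b * D)))))"
proof -
  define h where "h = 2 * of_real pi * \<i> * \<tau>"
  \<comment> \<open>Any logarithms serve here, as these variables occur only to integer powers; the
    logarithm \<open>h\<close> of \<open>q\<close> is dictated by \<open>\<tau>\<close> because of
    the fractional powers.\<close>
  define \<xi>\<^sub>1 \<xi>\<^sub>2 \<eta>\<^sub>1 \<eta>\<^sub>2 where "\<xi>\<^sub>1 = Ln x\<^sub>1" and "\<xi>\<^sub>2 = Ln x\<^sub>2" and "\<eta>\<^sub>1 = Ln y\<^sub>1" and "\<eta>\<^sub>2 = Ln y\<^sub>2"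
  have x: "x\<^sub>1 = exp \<xi>\<^sub>1" "x\<^sub>2 = exp \<xi>\<^sub>2" "y\<^sub>1 = exp \<eta>\<^sub>1" "y\<^sub>2 = exp \<eta>\<^sub>2"
    using nonzero by (simp_all add: \<xi>\<^sub>1_def \<xi>\<^sub>2_def \<eta>\<^sub>1_def \<eta>\<^sub>2_def)
  have q_exp: "q = exp h"
    unfolding h_def by (rule q(3))
  then have h: "Re h < 0"
    using q(2) by simp
  have qpow: "qpow \<tau> e = exp (h * of_real e)" for e
    by (simp add: qpow_def h_def)
  have powi: "exp z powi n = exp (z * of_int n)" for z :: complex and n
    by (simp add: exp_power_int mult.commute)
  define X where "X = of_int c * \<xi>\<^sub>1 - of_int b * \<eta>\<^sub>1 + \<xi>\<^sub>2"
  define Y where "Y = of_int a * \<eta>\<^sub>1 - of_int b * \<xi>\<^sub>1 + \<eta>\<^sub>2"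
  define \<theta> where "\<theta> = Theta (- exp (\<xi>\<^sub>2 + h * of_int (c * D) / 2)) (exp (h * of_int (c * D)))"
  define \<phi> where "\<phi> = Theta (- exp (\<eta>\<^sub>2 + h * of_int (a * D) / 2)) (exp (h * of_int (a * D)))"
  have "\<theta> \<noteq> 0"
    unfolding \<theta>_def using abc D(2) generic(1)
    by (intro gauss_theta_nonzero h) (simp_all add: x qpow mult.assoc)
  have "\<phi> \<noteq> 0"
    unfolding \<phi>_def using abc D(2) generic(2)
    by (intro gauss_theta_nonzero h) (simp_all add: x qpow mult.assoc)
  have expX: "exp X = x\<^sub>1 powi c * y\<^sub>1 powi (- b) * x\<^sub>2"
    unfolding x powi X_def by (simp add: mult_ac add_ac flip: exp_add)
  have expY: "exp Y = x\<^sub>1 powi (- b) * y\<^sub>1 powi a * y\<^sub>2"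
    unfolding x powi Y_def by (simp add: mult_ac add_ac flip: exp_add)
  have genX: "exp (of_int (D * k) * h + X) \<noteq> 1" for k
  proof
    assume "exp (of_int (D * k) * h + X) = 1"
    then have "exp X = q powi (D * - k)"
      by (simp add: q_exp exp_power_int exp_add exp_minus field_simps)
    then show False
      using generic(3)[of "- k"] by (simp add: expX)
  qed
  have genY: "exp (of_int (D * k) * h + Y) \<noteq> 1" for k
  proof
    assume "exp (of_int (D * k) * h + Y) = 1"
    then have "exp Y = q powi (D * - k)"
      by (simp add: q_exp exp_power_int exp_add exp_minus field_simps)
    then show False
      using generic(4)[of "- k"] by (simp add: expY)
  qed
  have S: "(\<Sum>\<^sub>\<infinity>(r\<^sub>1, s\<^sub>1)\<in>(UNIV :: (int \<times> int) set).
        sg2 r\<^sub>1 s\<^sub>1 * qpow \<tau> (a * r\<^sub>1\<^sup>2 / 2 + b * r\<^sub>1 * s\<^sub>1 + c * s\<^sub>1\<^sup>2 / 2)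
          * x\<^sub>1 powi r\<^sub>1 * y\<^sub>1 powi s\<^sub>1)
      = (\<Sum>\<^sub>\<infinity>(r, s)\<in>UNIV. hsign (r \<ge> 0) (s \<ge> 0) * exp (h * qform a b c r s + of_int r * \<xi>\<^sub>1 + of_int s * \<eta>\<^sub>1))"
    unfolding sg2_eq_hsign
    by (intro infsum_cong) (auto simp: x qpow powi exp_add qform_def mult_ac)
  have \<theta>: "Theta (- x\<^sub>2 * qpow \<tau> (c * D / 2)) (q powi (c * D)) = \<theta>"
    by (simp add: x q_exp powi qpow \<theta>_def exp_add)
  have \<phi>: "Theta (- y\<^sub>2 * qpow \<tau> (a * D / 2)) (q powi (a * D)) = \<phi>"
    by (simp add: x q_exp powi qpow \<phi>_def exp_add)
  have A: "(\<Sum>t\<in>{0..c - 1}.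
          x\<^sub>1 powi t * qpow \<tau> (a * t\<^sup>2 / 2)
          * Theta (- y\<^sub>1 * qpow \<tau> (b * t + c / 2)) (q powi c)
          * appell_m (- qpow \<tau> (D * (c / 2 - t)) * x\<^sub>1 powi c * y\<^sub>1 powi (- b))
              (- qpow \<tau> (c * D / 2) * x\<^sub>2) (q powi (c * D)))
      = appell_part h a b c \<xi>\<^sub>1 \<eta>\<^sub>1 X \<xi>\<^sub>2 / \<theta>"
    unfolding x q_exp \<theta>_def by (rule appell_part_eq[OF D(1) h_def X_def])
  have "D = b\<^sup>2 - c * a"
    by (simp add: D mult.commute)
  then have B: "(\<Sum>t\<in>{0..a - 1}.
          y\<^sub>1 powi t * qpow \<tau> (c * t\<^sup>2 / 2)
          * Theta (- x\<^sub>1 * qpow \<tau> (b * t + a / 2)) (q powi a)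
          * appell_m (- qpow \<tau> (D * (a / 2 - t)) * y\<^sub>1 powi a * x\<^sub>1 powi (- b))
              (- qpow \<tau> (a * D / 2) * y\<^sub>2) (q powi (a * D)))
      = appell_part h c b a \<eta>\<^sub>1 \<xi>\<^sub>1 Y \<eta>\<^sub>2 / \<phi>"
    unfolding x q_exp \<phi>_def by (rule appell_part_eq[OF _ h_def Y_def])
  have C: "(\<Sum>u\<in>U. \<Sum>v\<in>V.
            qpow \<tau> (a * u\<^sup>2 / 2 + b * u * v + c * v\<^sup>2 / 2) * x\<^sub>1 powi u * y\<^sub>1 powi v
            * (\<Sum>\<^sub>\<infinity>(r\<^sub>2, s\<^sub>2)\<in>(UNIV :: (int \<times> int) set).
                 qpow \<tau> (b\<^sup>2 * c * r\<^sub>2\<^sup>2 / 2 + a * b * c * r\<^sub>2 * s\<^sub>2 + a * b\<^sup>2 * s\<^sub>2\<^sup>2 / 2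
                         + c * (a * u + b * v) * r\<^sub>2 + a * (b * u + c * v) * s\<^sub>2)
                 * (x\<^sub>1 powi c * x\<^sub>2) powi r\<^sub>2 * (y\<^sub>1 powi a * y\<^sub>2) powi s\<^sub>2)
            * (qpochhammer_inf (q powi (b * D)) (q powi (b * D)) ^ 3
               * Theta (x\<^sub>1 powi (c - b) * y\<^sub>1 powi (a - b) * x\<^sub>2 * y\<^sub>2 * q powi (- D * (u + v)))
                   (q powi (b * D))
               / (Theta (x\<^sub>1 powi c * y\<^sub>1 powi (- b) * x\<^sub>2 * q powi (- D * u)) (q powi (b * D))
                  * Theta (x\<^sub>1 powi (- b) * y\<^sub>1 powi a * y\<^sub>2 * q powi (- D * v)) (q powi (b * D)))))
      = core_part h a b c U V \<xi>\<^sub>1 \<eta>\<^sub>1 X Y \<xi>\<^sub>2 \<eta>\<^sub>2"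
    unfolding core_part_def D(1)[symmetric]
  proof (intro sum.cong refl arg_cong2[where f = "(*)"])
    fix u v :: int
    show "qpow \<tau> (a * u\<^sup>2 / 2 + b * u * v + c * v\<^sup>2 / 2) * x\<^sub>1 powi u * y\<^sub>1 powi v
        = exp (h * qform a b c u v + of_int u * \<xi>\<^sub>1 + of_int v * \<eta>\<^sub>1)"
      by (simp add: x qpow powi exp_add qform_def mult_ac)
    show "(\<Sum>\<^sub>\<infinity>(r\<^sub>2, s\<^sub>2)\<in>(UNIV :: (int \<times> int) set).
                 qpow \<tau> (b\<^sup>2 * c * r\<^sub>2\<^sup>2 / 2 + a * b * c * r\<^sub>2 * s\<^sub>2 + a * b\<^sup>2 * s\<^sub>2\<^sup>2 / 2
                         + c * (a * u + b * v) * r\<^sub>2 + a * (b * u + c * v) * s\<^sub>2)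
                 * (x\<^sub>1 powi c * x\<^sub>2) powi r\<^sub>2 * (y\<^sub>1 powi a * y\<^sub>2) powi s\<^sub>2)
        = core_sum h a b c (of_int c * \<xi>\<^sub>1 + \<xi>\<^sub>2) (of_int a * \<eta>\<^sub>1 + \<eta>\<^sub>2) u v"
      unfolding core_sum_def
    proof (intro infsum_cong, clarify)
      fix r s :: int
      have "x\<^sub>1 powi c * x\<^sub>2 = exp (of_int c * \<xi>\<^sub>1 + \<xi>\<^sub>2)" "y\<^sub>1 powi a * y\<^sub>2 = exp (of_int a * \<eta>\<^sub>1 + \<eta>\<^sub>2)"
        by (simp_all add: x powi exp_add mult.commute)
      then show "qpow \<tau> (b\<^sup>2 * c * r\<^sup>2 / 2 + a * b * c * r * s + a * b\<^sup>2 * s\<^sup>2 / 2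
                         + c * (a * u + b * v) * r + a * (b * u + c * v) * s)
                 * (x\<^sub>1 powi c * x\<^sub>2) powi r * (y\<^sub>1 powi a * y\<^sub>2) powi s
        = exp (h * (of_int (b\<^sup>2 * c) * of_int r ^ 2 / 2 + of_int (a * b * c) * of_int r * of_int s
            + of_int (a * b\<^sup>2) * of_int s ^ 2 / 2 + of_int (c * (a * u + b * v)) * of_int r
            + of_int (a * (b * u + c * v)) * of_int s)
          + of_int r * (of_int c * \<xi>\<^sub>1 + \<xi>\<^sub>2) + of_int s * (of_int a * \<eta>\<^sub>1 + \<eta>\<^sub>2))"
        by (simp only: qpow exp_power_int exp_add[symmetric]) simp
    qed
    have 1: "x\<^sub>1 powi c * y\<^sub>1 powi (- b) * x\<^sub>2 * q powi (- D * u) = exp (X - h * of_int (D * u))"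
      unfolding expX[symmetric] q_exp powi by (simp flip: exp_add)
    have 2: "x\<^sub>1 powi (- b) * y\<^sub>1 powi a * y\<^sub>2 * q powi (- D * v) = exp (Y - h * of_int (D * v))"
      unfolding expY[symmetric] q_exp powi by (simp flip: exp_add)
    have 3: "x\<^sub>1 powi (c - b) * y\<^sub>1 powi (a - b) * x\<^sub>2 * y\<^sub>2 * q powi (- D * (u + v))
        = exp (X - h * of_int (D * u) + (Y - h * of_int (D * v)))"
      unfolding x q_exp powi exp_add[symmetric] X_def Y_def by (simp add: algebra_simps)
    show "qpochhammer_inf (q powi (b * D)) (q powi (b * D)) ^ 3
               * Theta (x\<^sub>1 powi (c - b) * y\<^sub>1 powi (a - b) * x\<^sub>2 * y\<^sub>2 * q powi (- D * (u + v)))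
                   (q powi (b * D))
               / (Theta (x\<^sub>1 powi c * y\<^sub>1 powi (- b) * x\<^sub>2 * q powi (- D * u)) (q powi (b * D))
                  * Theta (x\<^sub>1 powi (- b) * y\<^sub>1 powi a * y\<^sub>2 * q powi (- D * v)) (q powi (b * D)))
        = kronecker_quotient (h * of_int (b * D)) (X - h * of_int (D * u)) (Y - h * of_int (D * v))"
      unfolding 1 2 3 kronecker_quotient_def unfolding q_exp powi ..
  qed
  have "(\<Sum>\<^sub>\<infinity>(r, s)\<in>UNIV. hsign (r \<ge> 0) (s \<ge> 0) * exp (h * qform a b c r s + of_int r * \<xi>\<^sub>1 + of_int s * \<eta>\<^sub>1)) * (\<theta> * \<phi>)
    = appell_part h a b c \<xi>\<^sub>1 \<eta>\<^sub>1 X \<xi>\<^sub>2 * \<phi> + appell_part h c b a \<eta>\<^sub>1 \<xi>\<^sub>1 Y \<eta>\<^sub>2 * \<theta>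
      - core_part h a b c U V \<xi>\<^sub>1 \<eta>\<^sub>1 X Y \<xi>\<^sub>2 \<eta>\<^sub>2"
    unfolding \<theta>_def \<phi>_def
    by (rule indefinite_theta_identity[OF h abc D X_def Y_def genX genY residues])
  \<comment> \<open>It remains to divide by the two nonvanishing theta factors.\<close>
  moreover have "s = \<alpha> / \<theta> + \<beta> / \<phi> - inverse (\<theta> * \<phi>) * \<gamma>" if "s * (\<theta> * \<phi>) = \<alpha> * \<phi> + \<beta> * \<theta> - \<gamma>" for s \<alpha> \<beta> \<gamma>
  proof -
    have "s = (\<alpha> * \<phi> + \<beta> * \<theta> - \<gamma>) / (\<theta> * \<phi>)"
      using that \<open>\<theta> \<noteq> 0\<close> \<open>\<phi> \<noteq> 0\<close> by (simp add: nonzero_eq_divide_eq)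
    also have "\<dots> = \<alpha> / \<theta> + \<beta> / \<phi> - inverse (\<theta> * \<phi>) * \<gamma>"
      using \<open>\<theta> \<noteq> 0\<close> \<open>\<phi> \<noteq> 0\<close> by (simp add: field_simps)
    finally show ?thesis .
  qed
  ultimately show ?thesis
    unfolding S A B C \<theta> \<phi> by blast
qed

end
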